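(* Fix $N\in\mathbb{N}$ and $\beta\in\mathbb{R}_+^N$. Let $(X,T^{1,0}X,\mathcal{T})$ be a compact Sasakian manifold. Let $$\mathcal{M}=\{\varphi\in\mathscr{C}^\infty(X,\mathbb{R}):\mathcal{T}\varphi\equiv0,\ \mathcal{V}(\varphi)\text{ is strictly pseudoconvex}\}/\mathbb{R}\cdot 1,$$ where $1$ denotes the constant function one (so functions differing by a constant are identified), equipped with the quotient topology induced by the $\mathscr{C}^\infty$-topology on $\mathscr{C}^\infty(X,\mathbb{R})$, and let $$\mathcal{S}_\beta=\{[\varphi]\in\mathcal{M}:(\mathcal{V}(\varphi),\mathcal{T})\text{ is induced by a }\beta\text{-weighted sphere}\}.$$ Then $\mathcal{S}_\beta$ is nowhere dense in $\mathcal{M}$. Furthermore, if $\mathcal{S}_\beta\ne\emptyset$, then $\mathcal{S}_\beta\subset\mathcal{M}$ has no isolated points. In particular, for any $[\varphi]\in\mathcal{S}_\beta$ there exist $\varepsilon>0$ and a continuous non-constant map $\gamma\colon[0,\varepsilon)\to\mathcal{M}$ with $\gamma(0)=[\varphi]$ and $\gamma([0,\varepsilon))\subset\mathcal{S}_\beta$.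
   Context: $X$ is smooth, connected, orientable, of real dimension $2n+1$, $n\ge1$. A (codimension one) CR structure is a rank-$n$ complex subbundle $T^{1,0}X\subset\mathbb{C}TX$ with $T^{1,0}X\cap\overline{T^{1,0}X}=0$, closed under Lie brackets. It is strictly pseudoconvex if there is a non-vanishing real one form $\alpha$ with $\ker\alpha=\operatorname{Re}T^{1,0}X$ and $\frac{1}{2i}d\alpha(Z,\overline Z)>0$ for all $Z\in T^{1,0}X\setminus\{0\}$. A Sasakian manifold is a triple $(X,T^{1,0}X,\mathcal{T})$ with $T^{1,0}X$ a CR structure and $\mathcal{T}$ a real vector field which is transversal ($\mathbb{C}TX=T^{1,0}X\oplus\overline{T^{1,0}X}\oplus\mathbb{C}\mathcal{T}$) and CR ($[\mathcal{T},Z]$ is a section of $T^{1,0}X$ for every smooth section $Z$ of $T^{1,0}X$), such that the real one form $\alpha$ defined by $\alpha(\mathcal{T})\equiv1$, $\ker\alpha=\operatorname{Re}T^{1,0}X$ satisfies $\frac{1}{2i}d\alpha(Z,\overline Z)>0$ for all $Z\in T^{1,0}X\setminus\{0\}$. For $\varphi\in\mathscr{C}^\infty(X,\mathbb{R})$ with $\mathcal{T}\varphi\equiv0$ put $\mathcal{V}(\varphi)=\{Z-iZ(\varphi)\mathcal{T}: Z\in T^{1,0}X\}$; this is a CR structure for which $\mathcal{T}$ is transversal and CR, and $\mathcal{V}(\varphi)=\mathcal{V}(\psi)$ iff $\varphi-\psi$ is constant. For $\beta\in\mathbb{R}_+^N$ ($\mathbb{R}_+=(0,\infty)$) let $\mathcal{T}_\beta=i\sum_{j=1}^N\beta_j(z_j\partial_{z_j}-\overline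 z_j\partial_{\overline z_j})$ on $\mathbb{C}^N$. $(\mathcal{V},\mathcal{T})$ is induced by a $\beta$-weighted sphere if there is a smooth embedding $F\colon X\to\mathbb{C}^N$ which is CR with respect to $\mathcal{V}$ ($F_*\mathcal{V}=\mathbb{C}TF(X)\cap T^{1,0}\mathbb{C}^N$) such that $F(X)\subset\{|z|=1\}$ and $F_*\mathcal{T}=\mathcal{T}_\beta\circ F$. *)

theory Defs
  imports "HOL-Analysis.Analysis" "HOL-Library.Function_Algebras"
begin

section \<open>Smooth manifolds\<close>

text \<open>A manifold is a type \<open>'a\<close> in the classes \<open>t2_space\<close> and \<open>second_countable_topology\<close>
  together with a (not necessarily maximal) smooth atlas. A chart is a pair of its domain and its
  coordinate map; the coordinate map is only meaningful on the domain.\<close>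

primrec iter_deriv ::
  "'e::real_normed_vector list \<Rightarrow> ('e \<Rightarrow> 'f::real_normed_vector) \<Rightarrow> 'e \<Rightarrow> 'f" where
  "iter_deriv [] f = f"
| "iter_deriv (v # vs) f = iter_deriv vs (\<lambda>x. frechet_derivative f (at x) v)"

text \<open>Only meant for open \<open>S\<close>.\<close>
definition smooth_on :: "'e::euclidean_space set \<Rightarrow> ('e \<Rightarrow> 'f::real_normed_vector) \<Rightarrow> bool" where
  "smooth_on S f \<longleftrightarrow> (\<forall>vs. \<forall>x\<in>S. iter_deriv vs f differentiable (at x))"

type_synonym ('a, 'e) chart = "'a set \<times> ('a \<Rightarrow> 'e)"

definition smooth_atlas ::
  "('a::{t2_space,second_countable_topology}, 'e::euclidean_space) chart set \<Rightarrow> bool" where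
  "smooth_atlas A \<longleftrightarrow>
     (\<Union>(U, x)\<in>A. U) = UNIV \<and>
     (\<forall>(U, x)\<in>A. open U \<and> open (x ` U) \<and> (\<exists>y. homeomorphism U (x ` U) x y)) \<and>
     (\<forall>(U, x)\<in>A. \<forall>(V, y)\<in>A. smooth_on (x ` (U \<inter> V)) (y \<circ> inv_into U x))"

definition orientable_atlas ::
  "('a::{t2_space,second_countable_topology}, real ^ 'm) chart set \<Rightarrow> bool" where
  "orientable_atlas A \<longleftrightarrow>
     (\<exists>B. smooth_atlas B \<and> smooth_atlas (A \<union> B) \<and>
       (\<forall>(U, x)\<in>B. \<forall>(V, y)\<in>B. \<forall>p\<in>x ` (U \<inter> V).
          det (matrix (frechet_derivative (y \<circ> inv_into U x) (at p))) > 0))"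

definition smooth_map ::
  "('a, 'e::euclidean_space) chart set \<Rightarrow> ('a \<Rightarrow> 'f::real_normed_vector) \<Rightarrow> bool" where
  "smooth_map A f \<longleftrightarrow> (\<forall>(U, x)\<in>A. smooth_on (x ` U) (f \<circ> inv_into U x))"

definition std_atlas :: "('e::euclidean_space, 'e) chart set" where
  "std_atlas = {(UNIV, id)}"

section \<open>The complexified tangent bundle\<close>

text \<open>Complex tangent vectors at \<open>p\<close> are the complex linear derivations at \<open>p\<close> of the algebra of
  complex valued smooth functions. As HOL functions are total, they are extended by zero to
  functions that are not smooth.\<close>

type_synonym 'a cvec = "('a \<Rightarrow> complex) \<Rightarrow> complex"

definition ctangent :: "('a, 'e::euclidean_space) chart set \<Rightarrow> 'a \<Rightarrow> 'a cvec set" where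
  "ctangent A p = {v.
     (\<forall>f g. smooth_map A f \<and> smooth_map A g \<longrightarrow>
        v (\<lambda>q. f q + g q) = v f + v g \<and>
        v (\<lambda>q. f q * g q) = f p * v g + v f * g p) \<and>
     (\<forall>c f. smooth_map A f \<longrightarrow> v (\<lambda>q. c * f q) = c * v f) \<and>
     (\<forall>f. \<not> smooth_map A f \<longrightarrow> v f = 0)}"

definition cscale :: "complex \<Rightarrow> 'a cvec \<Rightarrow> 'a cvec" where
  "cscale c v = (\<lambda>f. c * v f)"

interpretation cvs: vector_space cscale
  by unfold_locales (auto simp: cscale_def fun_eq_iff algebra_simps)

definition cconj :: "'a cvec \<Rightarrow> 'a cvec" where
  "cconj v = (\<lambda>f. cnj (v (\<lambda>q. cnj (f q))))"

definition real_tangent :: "('a, 'e::euclidean_space) chart set \<Rightarrow> 'a \<Rightarrow> 'a cvec set" where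
  "real_tangent A p = {v \<in> ctangent A p. cconj v = v}"

definition cvector_field :: "('a, 'e::euclidean_space) chart set \<Rightarrow> ('a \<Rightarrow> 'a cvec) \<Rightarrow> bool" where
  "cvector_field A V \<longleftrightarrow>
     (\<forall>p. V p \<in> ctangent A p) \<and> (\<forall>f. smooth_map A f \<longrightarrow> smooth_map A (\<lambda>p. V p f))"

definition real_vector_field :: "('a, 'e::euclidean_space) chart set \<Rightarrow> ('a \<Rightarrow> 'a cvec) \<Rightarrow> bool" where
  "real_vector_field A V \<longleftrightarrow> cvector_field A V \<and> (\<forall>p. V p \<in> real_tangent A p)"

definition smooth_section ::
  "('a, 'e::euclidean_space) chart set \<Rightarrow> ('a \<Rightarrow> 'a cvec set) \<Rightarrow> ('a \<Rightarrow> 'a cvec) \<Rightarrow> bool" where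
  "smooth_section A E Z \<longleftrightarrow> cvector_field A Z \<and> (\<forall>p. Z p \<in> E p)"

definition lie_bracket :: "('a \<Rightarrow> 'a cvec) \<Rightarrow> ('a \<Rightarrow> 'a cvec) \<Rightarrow> 'a \<Rightarrow> 'a cvec" where
  "lie_bracket V W = (\<lambda>p f. V p (\<lambda>q. W q f) - W p (\<lambda>q. V q f))"

text \<open>Since smooth functions on open sets can be cut off, it is no restriction that local frames
  are restrictions of global vector fields.\<close>
definition complex_subbundle ::
  "('a::topological_space, 'e::euclidean_space) chart set \<Rightarrow> nat \<Rightarrow> ('a \<Rightarrow> 'a cvec set) \<Rightarrow> bool" where
  "complex_subbundle A k E \<longleftrightarrow>
     (\<forall>p. E p \<subseteq> ctangent A p \<and> cvs.subspace (E p) \<and> cvs.dim (E p) = k) \<and>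
     (\<forall>p. \<exists>U Z. open U \<and> p \<in> U \<and> (\<forall>i<k. cvector_field A (Z i)) \<and>
        (\<forall>q\<in>U. cvs.span ((\<lambda>i. Z i q) ` {..<k}) = E q))"

section \<open>One forms\<close>

text \<open>A real one form is represented by its complex linear extension to the complexified tangent
  spaces; its values outside of these are irrelevant.\<close>
definition real_one_form ::
  "('a, 'e::euclidean_space) chart set \<Rightarrow> ('a \<Rightarrow> 'a cvec \<Rightarrow> complex) \<Rightarrow> bool" where
  "real_one_form A \<alpha> \<longleftrightarrow>
     (\<forall>p. \<forall>u\<in>ctangent A p. \<forall>v\<in>ctangent A p. \<alpha> p (u + v) = \<alpha> p u + \<alpha> p v) \<and>
     (\<forall>p. \<forall>v\<in>ctangent A p. \<forall>c. \<alpha> p (cscale c v) = c * \<alpha> p v) \<and>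
     (\<forall>p. \<forall>v\<in>ctangent A p. \<alpha> p (cconj v) = cnj (\<alpha> p v)) \<and>
     (\<forall>V. cvector_field A V \<longrightarrow> smooth_map A (\<lambda>p. \<alpha> p (V p)))"

text \<open>The exterior derivative at \<open>p\<close>, by Cartan's formula
  \<open>d\<alpha>(V,W) = V(\<alpha>(W)) - W(\<alpha>(V)) - \<alpha>([V,W])\<close>. The right hand side at \<open>p\<close> depends only on the values
  \<open>v\<close>, \<open>w\<close> of the vector fields \<open>V\<close>, \<open>W\<close> at \<open>p\<close>, and any \<open>v\<close>, \<open>w\<close> extend to vector fields.\<close>
definition ext_deriv ::
  "('a, 'e::euclidean_space) chart set \<Rightarrow> ('a \<Rightarrow> 'a cvec \<Rightarrow> complex) \<Rightarrow> 'a \<Rightarrow> 'a cvec \<Rightarrow> 'a cvec \<Rightarrow> complex" where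
  "ext_deriv A \<alpha> p v w = (THE c. \<forall>V W.
     cvector_field A V \<and> cvector_field A W \<and> V p = v \<and> W p = w \<longrightarrow>
     c = V p (\<lambda>q. \<alpha> q (W q)) - W p (\<lambda>q. \<alpha> q (V q)) - \<alpha> p (lie_bracket V W p))"

section \<open>CR structures and Sasakian manifolds\<close>

definition CR_structure ::
  "('a::topological_space, 'e::euclidean_space) chart set \<Rightarrow> nat \<Rightarrow> ('a \<Rightarrow> 'a cvec set) \<Rightarrow> bool" where
  "CR_structure A n E \<longleftrightarrow>
     complex_subbundle A n E \<and>
     (\<forall>p. E p \<inter> cconj ` E p = {0}) \<and>
     (\<forall>Z W. smooth_section A E Z \<and> smooth_section A E W \<longrightarrow> smooth_section A E (lie_bracket Z W))"

definition real_part :: "('a \<Rightarrow> 'a cvec set) \<Rightarrow> 'a \<Rightarrow> 'a cvec set" where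
  "real_part E p = (\<lambda>Z. cscale (1/2) (Z + cconj Z)) ` E p"

definition form_kernel ::
  "('a, 'e::euclidean_space) chart set \<Rightarrow> ('a \<Rightarrow> 'a cvec \<Rightarrow> complex) \<Rightarrow> 'a \<Rightarrow> 'a cvec set" where
  "form_kernel A \<alpha> p = {v \<in> real_tangent A p. \<alpha> p v = 0}"

definition positive_levi_form ::
  "('a, 'e::euclidean_space) chart set \<Rightarrow> ('a \<Rightarrow> 'a cvec set) \<Rightarrow> ('a \<Rightarrow> 'a cvec \<Rightarrow> complex) \<Rightarrow> bool" where
  "positive_levi_form A E \<alpha> \<longleftrightarrow>
     (\<forall>p. \<forall>Z\<in>E p - {0}.
        1 / (2 * \<i>) * ext_deriv A \<alpha> p Z (cconj Z) \<in> \<real> \<and>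
        Re (1 / (2 * \<i>) * ext_deriv A \<alpha> p Z (cconj Z)) > 0)"

definition strictly_pseudoconvex ::
  "('a, 'e::euclidean_space) chart set \<Rightarrow> ('a \<Rightarrow> 'a cvec set) \<Rightarrow> bool" where
  "strictly_pseudoconvex A E \<longleftrightarrow>
     (\<exists>\<alpha>. real_one_form A \<alpha> \<and>
        (\<forall>p. \<exists>v\<in>real_tangent A p. \<alpha> p v \<noteq> 0) \<and>
        (\<forall>p. form_kernel A \<alpha> p = real_part E p) \<and>
        positive_levi_form A E \<alpha>)"

definition transversal ::
  "('a, 'e::euclidean_space) chart set \<Rightarrow> ('a \<Rightarrow> 'a cvec set) \<Rightarrow> ('a \<Rightarrow> 'a cvec) \<Rightarrow> bool" where
  "transversal A E T \<longleftrightarrow>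
     (\<forall>p. \<forall>v\<in>ctangent A p.
        \<exists>!(Z, W, c). Z \<in> E p \<and> W \<in> cconj ` E p \<and> v = Z + W + cscale c (T p))"

definition CR_vector_field ::
  "('a, 'e::euclidean_space) chart set \<Rightarrow> ('a \<Rightarrow> 'a cvec set) \<Rightarrow> ('a \<Rightarrow> 'a cvec) \<Rightarrow> bool" where
  "CR_vector_field A E T \<longleftrightarrow>
     (\<forall>Z. smooth_section A E Z \<longrightarrow> smooth_section A E (lie_bracket T Z))"

text \<open>The form \<open>\<alpha>\<close> below is uniquely determined on the complexified tangent spaces by its value
  on \<open>T\<close> and its kernel.\<close>
definition sasakian ::
  "('a::topological_space, 'e::euclidean_space) chart set \<Rightarrow> nat \<Rightarrow> ('a \<Rightarrow> 'a cvec set) \<Rightarrow> ('a \<Rightarrow> 'a cvec) \<Rightarrow> bool" where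
  "sasakian A n E T \<longleftrightarrow>
     CR_structure A n E \<and> real_vector_field A T \<and> transversal A E T \<and> CR_vector_field A E T \<and>
     (\<exists>\<alpha>. real_one_form A \<alpha> \<and> (\<forall>p. \<alpha> p (T p) = 1) \<and>
        (\<forall>p. form_kernel A \<alpha> p = real_part E p) \<and> positive_levi_form A E \<alpha>)"

definition deformed ::
  "('a \<Rightarrow> 'a cvec set) \<Rightarrow> ('a \<Rightarrow> 'a cvec) \<Rightarrow> ('a \<Rightarrow> real) \<Rightarrow> 'a \<Rightarrow> 'a cvec set" where
  "deformed E T \<phi> p = {Z - cscale (\<i> * Z (\<lambda>q. of_real (\<phi> q))) (T p) | Z. Z \<in> E p}"

section \<open>Embeddings into weighted spheres\<close>

definition pushforward ::
  "('b, 'e::euclidean_space) chart set \<Rightarrow> ('a \<Rightarrow> 'b) \<Rightarrow> 'a cvec \<Rightarrow> 'b cvec" where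
  "pushforward B F v = (\<lambda>g. if smooth_map B g then v (g \<circ> F) else 0)"

definition d_z :: "'N::finite \<Rightarrow> complex ^ 'N \<Rightarrow> (complex ^ 'N) cvec" where
  "d_z j z = (\<lambda>g. if smooth_map std_atlas g
     then (frechet_derivative g (at z) (axis j 1) - \<i> * frechet_derivative g (at z) (axis j \<i>)) / 2
     else 0)"

definition d_zbar :: "'N::finite \<Rightarrow> complex ^ 'N \<Rightarrow> (complex ^ 'N) cvec" where
  "d_zbar j z = (\<lambda>g. if smooth_map std_atlas g
     then (frechet_derivative g (at z) (axis j 1) + \<i> * frechet_derivative g (at z) (axis j \<i>)) / 2
     else 0)"

definition T10_CN :: "complex ^ 'N::finite \<Rightarrow> (complex ^ 'N) cvec set" where
  "T10_CN z = cvs.span (range (\<lambda>j. d_z j z))"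

definition weighted_field :: "real ^ 'N::finite \<Rightarrow> complex ^ 'N \<Rightarrow> (complex ^ 'N) cvec" where
  "weighted_field \<beta> z = cscale \<i>
     (\<Sum>j\<in>UNIV. cscale (of_real (\<beta> $ j)) (cscale (z $ j) (d_z j z) - cscale (cnj (z $ j)) (d_zbar j z)))"

definition smooth_embedding ::
  "('a::topological_space, 'e::euclidean_space) chart set \<Rightarrow> ('a \<Rightarrow> 'f::euclidean_space) \<Rightarrow> bool" where
  "smooth_embedding A F \<longleftrightarrow>
     smooth_map A F \<and>
     (\<forall>p. inj_on (pushforward std_atlas F) (ctangent A p)) \<and>
     (\<exists>G. homeomorphism UNIV (range F) F G)"

text \<open>The complexified tangent space of \<open>F(X)\<close> at \<open>F(p)\<close> is the image of the one of \<open>X\<close> at \<open>p\<close>.\<close>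
definition CR_embedding ::
  "('a::topological_space, 'e::euclidean_space) chart set \<Rightarrow> ('a \<Rightarrow> 'a cvec set) \<Rightarrow>
   ('a \<Rightarrow> complex ^ 'N::finite) \<Rightarrow> bool" where
  "CR_embedding A E F \<longleftrightarrow>
     smooth_embedding A F \<and>
     (\<forall>p. pushforward std_atlas F ` E p = pushforward std_atlas F ` ctangent A p \<inter> T10_CN (F p))"

definition induced_by_weighted_sphere ::
  "('a::topological_space, 'e::euclidean_space) chart set \<Rightarrow> real ^ 'N::finite \<Rightarrow>
   ('a \<Rightarrow> 'a cvec set) \<Rightarrow> ('a \<Rightarrow> 'a cvec) \<Rightarrow> bool" where
  "induced_by_weighted_sphere A \<beta> E T \<longleftrightarrow>
     (\<exists>F :: 'a \<Rightarrow> complex ^ 'N. CR_embedding A E F \<and> range F \<subseteq> sphere 0 1 \<and>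
        (\<forall>p. pushforward std_atlas F (T p) = weighted_field \<beta> (F p)))"

section \<open>The moduli space\<close>

definition smooth_nbhd ::
  "('a, 'e::euclidean_space) chart set \<Rightarrow> ('a, 'e) chart \<Rightarrow> 'e set \<Rightarrow> 'e list \<Rightarrow> real \<Rightarrow>
   ('a \<Rightarrow> real) \<Rightarrow> ('a \<Rightarrow> real) set" where
  "smooth_nbhd A = (\<lambda>(U, x) K vs \<epsilon> f. {g. smooth_map A g \<and>
     (\<forall>y\<in>K. \<bar>iter_deriv vs (g \<circ> inv_into U x) y - iter_deriv vs (f \<circ> inv_into U x) y\<bar> < \<epsilon>)})"

text \<open>Uniform convergence of all derivatives on compact subsets of charts, on the space of smooth
  real valued functions.\<close>
definition smooth_topology :: "('a, 'e::euclidean_space) chart set \<Rightarrow> ('a \<Rightarrow> real) topology" where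
  "smooth_topology A = topology_generated_by
     {smooth_nbhd A (U, x) K vs \<epsilon> f | U x K vs \<epsilon> f.
        (U, x) \<in> A \<and> compact K \<and> K \<subseteq> x ` U \<and> \<epsilon> > 0 \<and> smooth_map A f}"

definition quotient_topology :: "'b topology \<Rightarrow> ('b \<Rightarrow> 'c) \<Rightarrow> 'c topology" where
  "quotient_topology X q =
     topology (\<lambda>S. S \<subseteq> q ` topspace X \<and> openin X {x \<in> topspace X. q x \<in> S})"

lemma istopology_quotient:
  "istopology (\<lambda>S. S \<subseteq> q ` topspace X \<and> openin X {x \<in> topspace X. q x \<in> S})"
proof -
  have "{x \<in> topspace X. q x \<in> S \<inter> T} = {x \<in> topspace X. q x \<in> S} \<inter> {x \<in> topspace X. q x \<in> T}" for S T
    by auto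
  moreover have "{x \<in> topspace X. q x \<in> \<Union>\<K>} = (\<Union>S\<in>\<K>. {x \<in> topspace X. q x \<in> S})" for \<K>
    by auto
  ultimately show ?thesis
    unfolding istopology_def by (auto intro!: openin_Int openin_Union)
qed

lemma openin_quotient_topology:
  "openin (quotient_topology X q) S \<longleftrightarrow> S \<subseteq> q ` topspace X \<and> openin X {x \<in> topspace X. q x \<in> S}"
  by (simp add: quotient_topology_def topology_inverse' istopology_quotient)

lemma topspace_quotient_topology: "topspace (quotient_topology X q) = q ` topspace X"
proof -
  have "{x \<in> topspace X. q x \<in> q ` topspace X} = topspace X" by auto
  then have "openin (quotient_topology X q) (q ` topspace X)"
    by (simp add: openin_quotient_topology)
  then show ?thesis
    using openin_subset openin_quotient_topology openin_topspace by (metis subset_antisym)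
qed

lemma quotient_map_quotient_topology: "quotient_map X (quotient_topology X q) q"
  by (auto simp: quotient_map_def openin_quotient_topology topspace_quotient_topology)

definition admissible ::
  "('a, 'e::euclidean_space) chart set \<Rightarrow> ('a \<Rightarrow> 'a cvec set) \<Rightarrow> ('a \<Rightarrow> 'a cvec) \<Rightarrow> ('a \<Rightarrow> real) set" where
  "admissible A E T = {\<phi>. smooth_map A \<phi> \<and> (\<forall>p. T p (\<lambda>q. of_real (\<phi> q)) = 0) \<and>
     strictly_pseudoconvex A (deformed E T \<phi>)}"

definition mod_const :: "('a \<Rightarrow> real) set \<Rightarrow> (('a \<Rightarrow> real) \<times> ('a \<Rightarrow> real)) set" where
  "mod_const P = {(\<phi>, \<psi>). \<phi> \<in> P \<and> \<psi> \<in> P \<and> (\<exists>c. \<forall>p. \<phi> p - \<psi> p = c)}"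

definition moduli_space ::
  "('a, 'e::euclidean_space) chart set \<Rightarrow> ('a \<Rightarrow> 'a cvec set) \<Rightarrow> ('a \<Rightarrow> 'a cvec) \<Rightarrow>
   ('a \<Rightarrow> real) set topology" where
  "moduli_space A E T = quotient_topology
     (subtopology (smooth_topology A) (admissible A E T))
     (\<lambda>\<phi>. mod_const (admissible A E T) `` {\<phi>})"

definition sphere_induced ::
  "('a::topological_space, 'e::euclidean_space) chart set \<Rightarrow> ('a \<Rightarrow> 'a cvec set) \<Rightarrow> ('a \<Rightarrow> 'a cvec) \<Rightarrow>
   real ^ 'N::finite \<Rightarrow> ('a \<Rightarrow> real) set set" where
  "sphere_induced A E T \<beta> = {mod_const (admissible A E T) `` {\<phi>} | \<phi>.
     \<phi> \<in> admissible A E T \<and> induced_by_weighted_sphere A \<beta> (deformed E T \<phi>) T}"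

text \<open>The underlying set of the moduli space is the set of admissible functions modulo constants.\<close>

lemma topspace_smooth_topology:
  fixes A :: "('a, 'e::euclidean_space) chart set"
  assumes "A \<noteq> {}"
  shows "topspace (smooth_topology A) = {f. smooth_map A f}"
proof
  show "topspace (smooth_topology A) \<subseteq> {f. smooth_map A f}"
    by (auto simp: smooth_topology_def smooth_nbhd_def)
  obtain U x where Ux: "(U, x) \<in> A" using assms by auto
  show "{f. smooth_map A f} \<subseteq> topspace (smooth_topology A)"
  proof
    fix f :: "'a \<Rightarrow> real" assume "f \<in> {f. smooth_map A f}"
    then have "f \<in> smooth_nbhd A (U, x) {} [] 1 f"
      by (simp add: smooth_nbhd_def)
    moreover have "smooth_nbhd A (U, x) {} [] 1 f \<in> {smooth_nbhd A (U, x) K vs \<epsilon> f | U x K vs \<epsilon> f.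
        (U, x) \<in> A \<and> compact K \<and> K \<subseteq> x ` U \<and> \<epsilon> > 0 \<and> smooth_map A f}"
      using Ux \<open>f \<in> {f. smooth_map A f}\<close> by force
    ultimately show "f \<in> topspace (smooth_topology A)"
      unfolding smooth_topology_def topology_generated_by_topspace by blast
  qed
qed

lemma topspace_moduli_space:
  assumes "A \<noteq> {}"
  shows "topspace (moduli_space A E T) = admissible A E T // mod_const (admissible A E T)"
proof -
  have "admissible A E T \<subseteq> {f. smooth_map A f}" by (auto simp: admissible_def)
  then show ?thesis
    by (auto simp: moduli_space_def topspace_quotient_topology topspace_subtopology
        topspace_smooth_topology[OF assms] quotient_def)
qed

end

theory Submission
  imports Defs "HOL-Complex_Analysis.Cauchy_Integral_Formula"
begin

text \<open>Let \<open>F\<close> be a sphere map for \<open>\<V>(\<phi>)\<close> with components \<open>F j\<close>. Then \<open>G j = exp (- \<beta> j * \<phi>) * F j\<close> is a CR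
  function for the original structure with \<open>T (G j) = \<i> * \<beta> j * G j\<close>, and \<open>(\<Sum>j. exp (2 * \<beta> j * \<phi>) * \<bar>G j\<bar>\<^sup>2) = 1\<close>.
  Conversely CR functions \<open>G j\<close> of these weights and a solution \<open>\<phi>\<close> of this equation give back \<open>F\<close>.

  \<^emph>\<open>No isolated points.\<close> Scaling one component of a sphere map by \<open>sqrt (1 + s)\<close> and solving the equation
  again gives a smooth path of solutions. Its derivative at \<open>0\<close> is a multiple of \<open>\<bar>F k\<bar>\<^sup>2 / (\<Sum>j. \<beta> j * \<bar>F j\<bar>\<^sup>2)\<close>,
  which is not constant for all \<open>k\<close> since otherwise \<open>F\<close> would map into a torus.

  \<^emph>\<open>Nowhere dense.\<close> A sphere map makes the cone over \<open>X\<close> an immersed complex submanifold, so Cauchy estimates show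
  that CR functions of a fixed weight are determined by their values at finitely many points. Hence
  \<open>\<bar>G j\<bar>\<^sup>2\<close> varies in a finite-dimensional space. On the other hand, for a nonconstant invariant function \<open>y = \<bar>F k\<bar>\<^sup>2\<close>
  and a polynomial \<open>P\<close> the deformation by a small multiple of \<open>P y\<close> is admissible, and the values of \<open>P y\<close> at many points
  can be prescribed. As \<open>1\<close> is not a combination of the functions \<open>t \<mapsto> exp (2 * \<beta> j * t)\<close>, they
  can be chosen such that the equation is not solvable, not even approximately.\<close>

section \<open>Calculus of smooth functions\<close>

text \<open>Admissibility never rests on a general openness theorem: it is only needed at
  deformations built from a sphere map. There a contact form with explicit Levi form is at hand, and
  smallness of two derivatives of a polynomial on \<open>{0..1}\<close> suffices. For nowhere
  density, the interior of the closure is explored around one of its own sphere induced points, but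
  the other functions in it are only limits of solutions, so the contradiction has to survive a
  limit. Expanding the squared moduli at a point turns the equation into a sum over pairs of sample
  points. Its unknown coefficients are bounded and the same at all evaluation points, while the
  known factors change from point to point. These factors are out of control, so no Vandermonde
  determinant is available; instead \<open>power_relation\<close> chooses the prescribed values
  depending on the factors. The size of the perturbation is fixed before this choice, which is
  possible because only finitely many value patterns compete.\<close>

definition ck :: "nat \<Rightarrow> 'e::euclidean_space set \<Rightarrow> ('e \<Rightarrow> 'f::real_normed_vector) \<Rightarrow> bool" where
  "ck k S f \<longleftrightarrow> (\<forall>vs. length vs \<le> k \<longrightarrow> (\<forall>x\<in>S. iter_deriv vs f differentiable (at x)))"

text \<open>Smoothness carries no number to induct on; the levels \<open>ck k\<close> do. Level 0 is
  differentiability rather than continuity.\<close>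

lemma smooth_on_iff_ck: "smooth_on S f \<longleftrightarrow> (\<forall>k. ck k S f)"
  unfolding smooth_on_def ck_def by blast

lemma ck_0: "ck 0 S f \<longleftrightarrow> (\<forall>x\<in>S. f differentiable (at x))"
  by (simp add: ck_def)

lemma ck_Suc:
  "ck (Suc k) S f \<longleftrightarrow>
     (\<forall>x\<in>S. f differentiable (at x)) \<and> (\<forall>v. ck k S (\<lambda>x. frechet_derivative f (at x) v))"
proof
  assume L: "ck (Suc k) S f"
  have "iter_deriv [] f differentiable (at x)" if "x \<in> S" for x
    using L that unfolding ck_def by (metis list.size(3) zero_le)
  moreover have "iter_deriv vs (\<lambda>x. frechet_derivative f (at x) v) differentiable (at x)"
    if "x \<in> S" "length vs \<le> k" for v vs x
    using L that unfolding ck_def by (metis Suc_le_mono iter_deriv.simps(2) length_Cons)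
  ultimately show "(\<forall>x\<in>S. f differentiable (at x)) \<and> (\<forall>v. ck k S (\<lambda>x. frechet_derivative f (at x) v))"
    by (simp add: ck_def)
next
  assume R: "(\<forall>x\<in>S. f differentiable (at x)) \<and> (\<forall>v. ck k S (\<lambda>x. frechet_derivative f (at x) v))"
  show "ck (Suc k) S f"
    unfolding ck_def
  proof (intro allI impI ballI)
    fix vs :: "'a list" and x assume "length vs \<le> Suc k" "x \<in> S"
    then show "iter_deriv vs f differentiable (at x)"
      using R by (cases vs) (auto simp: ck_def)
  qed
qed

lemma ck_mono: "ck k S f \<Longrightarrow> l \<le> k \<Longrightarrow> ck l S f"
  by (meson ck_def order_trans)

lemma ck_SucD: "ck (Suc k) S f \<Longrightarrow> ck k S f"
  by (rule ck_mono) auto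

lemma ck_differentiable: "ck k S f \<Longrightarrow> x \<in> S \<Longrightarrow> f differentiable (at x)"
  using ck_mono[of k S f 0] by (simp add: ck_0)

lemma ck_has_derivative:
  "ck k S f \<Longrightarrow> x \<in> S \<Longrightarrow> (f has_derivative frechet_derivative f (at x)) (at x)"
  using ck_differentiable frechet_derivative_works by blast

lemma has_derivative_cong_open:
  assumes "open S" "x \<in> S" "\<And>y. y \<in> S \<Longrightarrow> f y = g y"
  shows "(f has_derivative D) (at x) \<longleftrightarrow> (g has_derivative D) (at x)"
  using assms has_derivative_transform_within_open by metis

lemma frechet_derivative_cong_open:
  assumes "open S" "x \<in> S" "\<And>y. y \<in> S \<Longrightarrow> f y = g y"
  shows "frechet_derivative f (at x) = frechet_derivative g (at x)"
  unfolding frechet_derivative_def using has_derivative_cong_open[OF assms] by simp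

lemma differentiable_cong_open:
  assumes "open S" "x \<in> S" "\<And>y. y \<in> S \<Longrightarrow> f y = g y"
  shows "f differentiable (at x) \<longleftrightarrow> g differentiable (at x)"
  unfolding differentiable_def using has_derivative_cong_open[OF assms] by simp

lemma iter_deriv_cong:
  assumes "open S" "\<And>y. y \<in> S \<Longrightarrow> f y = g y" "x \<in> S"
  shows "iter_deriv vs f x = iter_deriv vs g x"
  using assms(2,3)
proof (induction vs arbitrary: f g x)
  case (Cons v vs)
  have "frechet_derivative f (at y) v = frechet_derivative g (at y) v" if "y \<in> S" for y
    using frechet_derivative_cong_open[OF assms(1) that Cons.prems(1)] by simp
  from Cons.IH[OF this Cons.prems(2)] show ?case by simp
qed simp

lemma ck_cong:
  assumes "open S" "\<And>y. y \<in> S \<Longrightarrow> f y = g y"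
  shows "ck k S f \<longleftrightarrow> ck k S g"
proof -
  have "iter_deriv vs f differentiable (at x) \<longleftrightarrow> iter_deriv vs g differentiable (at x)" if "x \<in> S" for vs x
    by (rule differentiable_cong_open[OF assms(1) that]) (rule iter_deriv_cong[OF assms])
  then show ?thesis by (auto simp: ck_def)
qed

text \<open>On an open set a derivative known by a formula may replace
  \<open>frechet_derivative\<close>, whose values off \<open>S\<close> are arbitrary.\<close>

lemma ck_SucI:
  assumes "open S" "\<And>x. x \<in> S \<Longrightarrow> (f has_derivative f' x) (at x)" "\<And>v. ck k S (\<lambda>x. f' x v)"
  shows "ck (Suc k) S f"
proof -
  have "frechet_derivative f (at x) v = f' x v" if "x \<in> S" for x v
    using frechet_derivative_at[OF assms(2)[OF that]] by simp
  then show ?thesis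
    unfolding ck_Suc using assms(2,3) ck_cong[OF assms(1), of "\<lambda>x. frechet_derivative f (at x) _" "\<lambda>x. f' x _"]
    by (auto simp: differentiable_def)
qed

lemma ck_const: "open S \<Longrightarrow> ck k S (\<lambda>x. c)"
proof (induction k arbitrary: c)
  case (Suc k)
  show ?case by (rule ck_SucI[OF Suc.prems has_derivative_const]) (rule Suc.IH[OF Suc.prems])
qed (simp add: ck_0)

lemma ck_add: "open S \<Longrightarrow> ck k S f \<Longrightarrow> ck k S g \<Longrightarrow> ck k S (\<lambda>x. f x + g x)"
proof (induction k arbitrary: f g)
  case 0
  then show ?case by (auto simp: ck_0)
next
  case (Suc k)
  show ?case
    by (rule ck_SucI[OF Suc.prems(1), OF has_derivative_add[OF ck_has_derivative[OF Suc.prems(2)] ck_has_derivative[OF Suc.prems(3)]]])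
      (use Suc in \<open>auto simp: ck_Suc\<close>)
qed

lemma ck_bounded_linear:
  assumes "open S" "bounded_linear L"
  shows "ck k S f \<Longrightarrow> ck k S (\<lambda>x. L (f x))"
proof (induction k arbitrary: f)
  case 0
  then show ?case using assms
    by (auto simp: ck_0 intro: bounded_linear_imp_differentiable differentiable_compose)
next
  case (Suc k)
  show ?case
    by (rule ck_SucI[OF assms(1), OF bounded_linear.has_derivative[OF assms(2) ck_has_derivative[OF Suc.prems]]])
      (use Suc in \<open>auto simp: ck_Suc\<close>)
qed

lemma ck_bounded_bilinear:
  assumes "open S" "bounded_bilinear B"
  shows "ck k S f \<Longrightarrow> ck k S g \<Longrightarrow> ck k S (\<lambda>x. B (f x) (g x))"
proof (induction k arbitrary: f g)
  case 0
  have "(\<lambda>x. B (f x) (g x)) differentiable at x" if "x \<in> S" for x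
    using bounded_bilinear.FDERIV[OF assms(2) ck_has_derivative[OF 0(1) that] ck_has_derivative[OF 0(2) that]]
    by (auto simp: differentiable_def)
  then show ?case by (simp add: ck_0)
next
  case (Suc k)
  show ?case
  proof (rule ck_SucI[OF assms(1)])
    show "((\<lambda>x. B (f x) (g x)) has_derivative
        (\<lambda>h. B (f x) (frechet_derivative g (at x) h) + B (frechet_derivative f (at x) h) (g x))) (at x)"
      if "x \<in> S" for x
      using bounded_bilinear.FDERIV[OF assms(2) ck_has_derivative[OF Suc.prems(1) that] ck_has_derivative[OF Suc.prems(2) that]] .
    show "ck k S (\<lambda>x. B (f x) (frechet_derivative g (at x) v) + B (frechet_derivative f (at x) v) (g x))" for v
      using Suc.prems ck_SucD[OF Suc.prems(1)] ck_SucD[OF Suc.prems(2)]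
      by (intro ck_add assms(1) Suc.IH) (auto simp: ck_Suc)
  qed
qed

lemma ck_sum:
  assumes "open S" "finite I" "\<And>i. i \<in> I \<Longrightarrow> ck k S (f i)"
  shows "ck k S (\<lambda>x. \<Sum>i\<in>I. f i x)"
  using assms(2,3) by (induction I rule: finite_induct) (auto intro: ck_const ck_add assms(1))

lemma ck_Pair:
  assumes "open S" "ck k S f" "ck k S g"
  shows "ck k S (\<lambda>x. (f x, g x))"
proof -
  have "ck k S (\<lambda>x. (f x, 0) + (0, g x))"
    by (intro ck_add assms ck_bounded_linear[OF assms(1) _ assms(2), of "\<lambda>t. (t, 0)"]
        ck_bounded_linear[OF assms(1) _ assms(3), of "\<lambda>t. (0, t)"]
        bounded_linear_Pair bounded_linear_ident bounded_linear_zero)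
  then show ?thesis by simp
qed

text \<open>The chain rule differentiates \<open>h\<close> at a moving point in a moving direction.
  Expanding the direction in \<open>Basis\<close> leaves derivatives of \<open>h\<close> in fixed
  directions, composed with \<open>f\<close>, to which the induction hypothesis applies.\<close>

lemma ck_compose:
  fixes f :: "'e::euclidean_space \<Rightarrow> 'g::euclidean_space"
  assumes "open S" "open R"
  shows "ck k R h \<Longrightarrow> ck k S f \<Longrightarrow> f ` S \<subseteq> R \<Longrightarrow> ck k S (\<lambda>x. h (f x))"
proof (induction k arbitrary: h)
  case 0
  then show ?case
    by (auto simp: ck_0 image_subset_iff intro!: differentiable_compose[of h f])
next
  case (Suc k)
  let ?D = "\<lambda>x. frechet_derivative f (at x)"
  have fR: "f x \<in> R" if "x \<in> S" for x using Suc.prems(3) that by auto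
  show ?case
  proof (rule ck_SucI[OF assms(1)])
    fix x assume x: "x \<in> S"
    have D: "((\<lambda>x. h (f x)) has_derivative (\<lambda>v. frechet_derivative h (at (f x)) (?D x v))) (at x)"
      using has_derivative_compose[OF ck_has_derivative[OF Suc.prems(2) x] ck_has_derivative[OF Suc.prems(1) fR[OF x]]] .
    have lin: "linear (frechet_derivative h (at (f x)))"
      using ck_has_derivative[OF Suc.prems(1) fR[OF x]] has_derivative_linear by blast
    have "frechet_derivative h (at (f x)) w =
        (\<Sum>b\<in>Basis. (w \<bullet> b) *\<^sub>R frechet_derivative h (at (f x)) b)" for w
      using linear_sum[OF lin, of "\<lambda>b. (w \<bullet> b) *\<^sub>R b" Basis]
      by (simp add: euclidean_representation linear_scale[OF lin])
    then show "((\<lambda>x. h (f x)) has_derivative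
      (\<lambda>v. \<Sum>b\<in>Basis. (?D x v \<bullet> b) *\<^sub>R frechet_derivative h (at (f x)) b)) (at x)"
      by (rule has_derivative_eq_rhs[OF D ext])
  next
    fix v
    have "ck k S (\<lambda>x. ?D x v \<bullet> b)" for b
      using Suc.prems(2) by (intro ck_bounded_linear[OF assms(1) bounded_linear_inner_left]) (auto simp: ck_Suc)
    moreover have "ck k S (\<lambda>x. frechet_derivative h (at (f x)) b)" for b
      using Suc.IH[of "\<lambda>y. frechet_derivative h (at y) b"] Suc.prems by (auto simp: ck_Suc ck_SucD)
    ultimately show "ck k S (\<lambda>x. \<Sum>b\<in>Basis. (?D x v \<bullet> b) *\<^sub>R frechet_derivative h (at (f x)) b)"
      by (intro ck_sum assms ck_bounded_bilinear[OF assms(1) bounded_bilinear_scaleR]) auto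
  qed
qed

lemma smooth_on_cong:
  "open S \<Longrightarrow> (\<And>y. y \<in> S \<Longrightarrow> f y = g y) \<Longrightarrow> smooth_on S f \<longleftrightarrow> smooth_on S g"
  unfolding smooth_on_iff_ck using ck_cong[of S f g] by blast

lemma smooth_on_subset: "smooth_on S f \<Longrightarrow> R \<subseteq> S \<Longrightarrow> smooth_on R f"
  by (auto simp: smooth_on_def)

lemma smooth_on_open_cover:
  "(\<And>x. x \<in> S \<Longrightarrow> \<exists>R. x \<in> R \<and> smooth_on R f) \<Longrightarrow> smooth_on S f"
  unfolding smooth_on_def by blast

lemma smooth_on_const [simp]: "open S \<Longrightarrow> smooth_on S (\<lambda>x. c)"
  by (simp add: smooth_on_iff_ck ck_const)

lemma smooth_on_add:
  "open S \<Longrightarrow> smooth_on S f \<Longrightarrow> smooth_on S g \<Longrightarrow> smooth_on S (\<lambda>x. f x + g x)"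
  by (simp add: smooth_on_iff_ck ck_add)

lemma smooth_on_sum:
  "open S \<Longrightarrow> finite I \<Longrightarrow> (\<And>i. i \<in> I \<Longrightarrow> smooth_on S (f i)) \<Longrightarrow> smooth_on S (\<lambda>x. \<Sum>i\<in>I. f i x)"
  by (simp add: smooth_on_iff_ck ck_sum)

lemma smooth_on_bounded_linear:
  "open S \<Longrightarrow> bounded_linear L \<Longrightarrow> smooth_on S f \<Longrightarrow> smooth_on S (\<lambda>x. L (f x))"
  by (simp add: smooth_on_iff_ck ck_bounded_linear)

lemma smooth_on_bounded_bilinear:
  "open S \<Longrightarrow> bounded_bilinear B \<Longrightarrow> smooth_on S f \<Longrightarrow> smooth_on S g \<Longrightarrow> smooth_on S (\<lambda>x. B (f x) (g x))"
  by (simp add: smooth_on_iff_ck ck_bounded_bilinear)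

lemma smooth_on_mult:
  fixes f g :: "_ \<Rightarrow> 'f::real_normed_algebra"
  shows "open S \<Longrightarrow> smooth_on S f \<Longrightarrow> smooth_on S g \<Longrightarrow> smooth_on S (\<lambda>x. f x * g x)"
  by (rule smooth_on_bounded_bilinear[OF _ bounded_bilinear_mult])

lemma smooth_on_compose:
  fixes f :: "'e::euclidean_space \<Rightarrow> 'g::euclidean_space"
  shows "open S \<Longrightarrow> open R \<Longrightarrow> smooth_on R h \<Longrightarrow> smooth_on S f \<Longrightarrow> f ` S \<subseteq> R \<Longrightarrow>
    smooth_on S (\<lambda>x. h (f x))"
  by (simp add: smooth_on_iff_ck ck_compose)

lemma smooth_on_id: "open S \<Longrightarrow> smooth_on S (\<lambda>x. x)"
proof -
  assume S: "open S"
  have "ck k S (\<lambda>x. x)" for k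
  proof (cases k)
    case (Suc l)
    have "ck (Suc l) S (\<lambda>x. x)"
      by (rule ck_SucI[OF S has_derivative_ident]) (rule ck_const[OF S])
    then show ?thesis by (simp add: Suc)
  qed (simp add: ck_0)
  then show ?thesis by (simp add: smooth_on_iff_ck)
qed

lemma smooth_on_linear: "open S \<Longrightarrow> bounded_linear L \<Longrightarrow> smooth_on S L"
  by (rule smooth_on_bounded_linear[OF _ _ smooth_on_id])

text \<open>A class of functions closed under directional derivatives consists of smooth functions.
  Each use only has to exhibit such a class, for instance polynomials in \<open>inverse x\<close>
  times an exponential.\<close>

lemma smooth_on_coinduct:
  assumes "open S" "P f"
    and "\<And>f. P f \<Longrightarrow> \<exists>f'. (\<forall>x\<in>S. (f has_derivative f' x) (at x)) \<and> (\<forall>v. P (\<lambda>x. f' x v))"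
  shows "smooth_on S f"
proof -
  have "ck k S f" if "P f" for k f
    using that
  proof (induction k arbitrary: f)
    case 0
    then show ?case using assms(3) by (fastforce simp: ck_0 differentiable_def)
  next
    case (Suc k)
    from assms(3)[OF Suc.prems] obtain f' where
      "\<forall>x\<in>S. (f has_derivative f' x) (at x)" "\<forall>v. P (\<lambda>x. f' x v)" by blast
    then show ?case using ck_SucI[OF assms(1), of f f' k] Suc.IH by blast
  qed
  with assms(2) show ?thesis by (simp add: smooth_on_iff_ck)
qed

lemma smooth_on_differentiable: "smooth_on S f \<Longrightarrow> x \<in> S \<Longrightarrow> f differentiable (at x)"
  using ck_differentiable[of 0 S f] by (simp add: smooth_on_iff_ck)

lemma smooth_on_has_derivative:
  "smooth_on S f \<Longrightarrow> x \<in> S \<Longrightarrow> (f has_derivative frechet_derivative f (at x)) (at x)"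
  by (meson frechet_derivative_works smooth_on_differentiable)

lemma smooth_on_frechet_derivative:
  "smooth_on S f \<Longrightarrow> smooth_on S (\<lambda>x. frechet_derivative f (at x) v)"
  unfolding smooth_on_iff_ck using ck_Suc[of _ S f] by blast

lemma smooth_on_continuous_on: "smooth_on S f \<Longrightarrow> continuous_on S f"
  by (meson continuous_at_imp_continuous_on differentiable_imp_continuous_within smooth_on_differentiable)

lemma smooth_on_iter_deriv: "smooth_on S f \<Longrightarrow> smooth_on S (iter_deriv vs f)"
  by (induction vs arbitrary: f) (auto intro: smooth_on_frechet_derivative)

lemma smooth_on_exp: "smooth_on UNIV (exp :: real \<Rightarrow> real)"
proof (rule smooth_on_coinduct[where P = "\<lambda>f. \<exists>c. f = (\<lambda>x. c * exp x)"])
  show "\<exists>c. exp = (\<lambda>x. c * exp (x::real))" by (rule exI[of _ 1]) auto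
  fix f :: "real \<Rightarrow> real" assume "\<exists>c. f = (\<lambda>x. c * exp x)"
  then obtain c where f: "f = (\<lambda>x. c * exp x)" by blast
  show "\<exists>f'. (\<forall>x\<in>UNIV. (f has_derivative f' x) (at x)) \<and> (\<forall>v. \<exists>c. (\<lambda>x. f' x v) = (\<lambda>x. c * exp x))"
    by (rule exI[of _ "\<lambda>x v. c * v * exp x"])
      (auto simp: f intro!: derivative_eq_intros)
qed auto

lemma smooth_on_inverse: "smooth_on (- {0}) (inverse :: real \<Rightarrow> real)"
proof (rule smooth_on_coinduct[where P = "\<lambda>f. \<exists>c n. f = (\<lambda>x. c * inverse x ^ n)"])
  show "\<exists>c n. inverse = (\<lambda>x::real. c * inverse x ^ n)" by (intro exI[of _ 1]) auto
  fix f :: "real \<Rightarrow> real" assume "\<exists>c n. f = (\<lambda>x. c * inverse x ^ n)"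
  then obtain c n where f: "f = (\<lambda>x. c * inverse x ^ n)" by blast
  have "(f has_derivative (\<lambda>v. (- v * c * n) * inverse x ^ Suc n)) (at x)" if "x \<in> - {0}" for x
  proof -
    have "((\<lambda>x. inverse x) has_derivative (\<lambda>v. - (inverse x * v * inverse x))) (at x)"
      using that by (intro has_derivative_inverse') auto
    from has_derivative_mult_right[OF has_derivative_power[OF this, of n], of c] show ?thesis
      unfolding f by (rule has_derivative_eq_rhs) (cases n; simp add: fun_eq_iff algebra_simps)
  qed
  then show "\<exists>f'. (\<forall>x\<in>- {0}. (f has_derivative f' x) (at x)) \<and>
      (\<forall>v. \<exists>c n. (\<lambda>x. f' x v) = (\<lambda>x::real. c * inverse x ^ n))"
    by (intro exI[of _ "\<lambda>x v. (- v * c * n) * inverse x ^ Suc n"]) blast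
qed auto

lemma smooth_on_real_exp:
  fixes f :: "'e::euclidean_space \<Rightarrow> real"
  shows "open S \<Longrightarrow> smooth_on S f \<Longrightarrow> smooth_on S (\<lambda>x. exp (f x))"
  by (rule smooth_on_compose[OF _ _ smooth_on_exp]) auto

text \<open>Strict monotonicity in \<open>t\<close> makes the root unique on the whole line, so
  \<open>u\<close> is the implicit function. The formula for its derivative involves
  \<open>u\<close> itself and derivatives of \<open>Q\<close>, which raises the level of
  \<open>u\<close> by one at each round.\<close>

lemma implicit_smooth_on:
  fixes Q :: "'e::euclidean_space \<times> real \<Rightarrow> real" and u :: "'e \<Rightarrow> real"
  assumes D: "open D"
    and Q: "smooth_on (D \<times> UNIV) Q"
    and pos: "\<And>z t. z \<in> D \<Longrightarrow> frechet_derivative Q (at (z, t)) (0, 1) > 0"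
    and u: "\<And>z. z \<in> D \<Longrightarrow> Q (z, u z) = 0"
  shows "smooth_on D u"
proof -
  have open': "open (D \<times> (UNIV::real set))" using D by (simp add: open_Times)
  have dQ: "(Q has_derivative frechet_derivative Q (at (z, t))) (at (z, t))" if "z \<in> D" for z t
    using smooth_on_has_derivative[OF Q] that by simp
  have lQ: "linear (frechet_derivative Q (at (z, t)))" if "z \<in> D" for z t
    using dQ[OF that] has_derivative_linear by blast
  have mono: "Q (z, s) < Q (z, t)" if "z \<in> D" "s < t" for z s t
  proof (rule DERIV_pos_imp_increasing[OF that(2)])
    fix x
    have "((\<lambda>x. Q (z, x)) has_derivative (\<lambda>h. frechet_derivative Q (at (z, x)) (0, h))) (at x)"
      by (rule has_derivative_compose[where f = "\<lambda>x. (z, x)" and g = Q])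
        (auto intro!: derivative_eq_intros dQ that(1))
    moreover have "(\<lambda>h. frechet_derivative Q (at (z, x)) (0, h)) = (*) (frechet_derivative Q (at (z, x)) (0, 1))"
    proof
      fix h show "frechet_derivative Q (at (z, x)) (0, h) = frechet_derivative Q (at (z, x)) (0, 1) * h"
        using linear_scale[OF lQ[OF that(1)], of x h "(0, 1)"] by (simp add: mult.commute)
    qed
    ultimately have "DERIV (\<lambda>x. Q (z, x)) x :> frechet_derivative Q (at (z, x)) (0, 1)"
      by (simp add: has_field_derivative_def)
    then show "\<exists>y. DERIV (\<lambda>x. Q (z, x)) x :> y \<and> y > 0" using pos[OF that(1)] by blast
  qed
  have inj: "s = t" if "z \<in> D" "Q (z, s) = Q (z, t)" for z s t
    using mono[OF that(1), of s t] mono[OF that(1), of t s] that(2) by (cases s t rule: linorder_cases) auto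
  define Qt where "Qt z = frechet_derivative Q (at (z, u z)) (0, 1)" for z
  define u' where "u' z v = - (frechet_derivative Q (at (z, u z)) (v, 0) * inverse (Qt z))" for z v
  have Qt: "Qt z > 0" if "z \<in> D" for z using pos[OF that] by (simp add: Qt_def)
  have split: "frechet_derivative Q (at (z, u z)) (a, b) = frechet_derivative Q (at (z, u z)) (a, 0) + b * Qt z"
    if "z \<in> D" for z a b
    using linear_add[OF lQ[OF that], of "u z" "(a, 0)" "(0, b)"] linear_scale[OF lQ[OF that], of "u z" b "(0, 1)"]
    by (simp add: Qt_def)
  have du: "(u has_derivative u' z) (at z)" if z: "z \<in> D" for z
  proof -
    \<comment> \<open>The straightening map \<open>?f\<close> is injective on the whole cylinder, so
      \<open>?g\<close> is a left inverse of it, and the inverse function theorem for a given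
      inverse yields the derivative of \<open>?g\<close>. Its second component at height 0 is
      \<open>u\<close>.\<close>
    let ?f = "\<lambda>p. (fst p, Q p)" and ?g = "\<lambda>p. (fst p, THE t. Q (fst p, t) = snd p)"
    let ?f' = "\<lambda>p. (fst p, frechet_derivative Q (at (z, u z)) p)"
    let ?g' = "\<lambda>p. (fst p, (snd p - frechet_derivative Q (at (z, u z)) (fst p, 0)) * inverse (Qt z))"
    have "(?g has_derivative ?g') (at (?f (z, u z)))"
    proof (rule has_derivative_inverse_strong[where f = ?f and f' = ?f' and x = "(z, u z)", OF open'])
      show "(z, u z) \<in> D \<times> UNIV" using z by simp
      show "continuous_on (D \<times> UNIV) ?f"
        by (intro continuous_intros smooth_on_continuous_on[OF Q])
      show "?g (?f x) = x" if "x \<in> D \<times> UNIV" for x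
      proof (cases x)
        case (Pair y t)
        have "(THE t'. Q (y, t') = Q (y, t)) = t"
          using that Pair by (intro the_equality) (auto intro: inj)
        then show ?thesis by (simp add: Pair)
      qed
      show "(?f has_derivative ?f') (at (z, u z))"
        by (intro has_derivative_Pair dQ z has_derivative_fst has_derivative_ident)
      show "?f' \<circ> ?g' = id"
      proof
        fix p
        have "frechet_derivative Q (at (z, u z)) (?g' p) = snd p"
          using split[OF z, of "fst p" "(snd p - frechet_derivative Q (at (z, u z)) (fst p, 0)) * inverse (Qt z)"]
            Qt[OF z] by (simp add: mult.assoc)
        then show "(?f' \<circ> ?g') p = id p" by (simp add: prod_eq_iff)
      qed
    qed
    then have "(?g has_derivative ?g') (at (z, 0))" using u[OF z] by simp
    then have "((\<lambda>y. snd (?g (y, 0))) has_derivative (\<lambda>v. snd (?g' (v, 0)))) (at z)"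
      by (intro has_derivative_snd has_derivative_compose[where f = "\<lambda>y. (y, 0)" and g = ?g and f' = "\<lambda>v. (v, 0)"])
        (auto intro!: derivative_eq_intros)
    moreover have "snd (?g (y, 0)) = u y" if "y \<in> D" for y
    proof -
      have "(THE t. Q (y, t) = 0) = u y"
        using u[OF that] inj[OF that] by (intro the_equality) auto
      then show ?thesis by simp
    qed
    ultimately show ?thesis
      using has_derivative_cong_open[OF D z, of "\<lambda>y. snd (?g (y, 0))" u]
      by (simp add: u'_def[abs_def])
  qed
  have "ck k D u" for k
  proof (induction k)
    case 0
    then show ?case using du by (auto simp: ck_0 differentiable_def)
  next
    case (Suc k)
    have "ck k D (\<lambda>z. z)" using smooth_on_id[OF D] by (simp add: smooth_on_iff_ck)
    then have pair: "ck k D (\<lambda>z. (z, u z))" by (rule ck_Pair[OF D _ Suc.IH])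
    have c: "ck k D (\<lambda>z. frechet_derivative Q (at (z, u z)) w)" for w
      using ck_compose[OF D open', of k "\<lambda>p. frechet_derivative Q (at p) w" "\<lambda>z. (z, u z)"]
        smooth_on_frechet_derivative[OF Q, of w] pair by (auto simp: smooth_on_iff_ck)
    have "ck k D (\<lambda>z. inverse (Qt z))"
      using ck_compose[OF D _ _ c[of "(0, 1)"], of "- {0}" inverse] smooth_on_inverse Qt
      by (fastforce simp: smooth_on_iff_ck Qt_def)
    then have "ck k D (\<lambda>z. u' z v)" for v
      unfolding u'_def
      by (intro ck_bounded_linear[OF D bounded_linear_minus[OF bounded_linear_ident]]
          ck_bounded_bilinear[OF D bounded_bilinear_mult] c)
    then show ?case using ck_SucI[OF D du] by blast
  qed
  then show ?thesis by (simp add: smooth_on_iff_ck)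
qed

subsection \<open>A smooth bump function\<close>

definition flat :: "real \<Rightarrow> real" where
  "flat x = (if x > 0 then exp (- inverse x) else 0)"

text \<open>The substitution \<open>t = 1/x\<close> turns flatness of \<open>flat\<close> at 0 into
  this decay.\<close>

lemma poly_times_exp_at_top: "((\<lambda>t. poly p t * exp (- t)) \<longlongrightarrow> (0::real)) at_top"
proof -
  have "((\<lambda>t. \<Sum>i\<le>degree p. coeff p i * (t ^ i / exp t)) \<longlongrightarrow> (\<Sum>i\<le>degree p. coeff p i * (0::real))) at_top"
    by (intro tendsto_sum tendsto_mult tendsto_const tendsto_power_div_exp_0)
  then show ?thesis by (simp add: poly_altdef exp_minus sum_distrib_right divide_inverse mult.assoc)
qed

lemma smooth_on_flat: "smooth_on UNIV flat"
proof (rule smooth_on_coinduct[where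
    P = "\<lambda>f. \<exists>p. f = (\<lambda>x::real. if x > 0 then poly p (inverse x) * exp (- inverse x) else 0)"])
  show "\<exists>p. flat = (\<lambda>x. if x > 0 then poly p (inverse x) * exp (- inverse x) else 0)"
    by (rule exI[of _ 1]) (auto simp: flat_def)
  fix f :: "real \<Rightarrow> real"
  assume "\<exists>p. f = (\<lambda>x. if x > 0 then poly p (inverse x) * exp (- inverse x) else 0)"
  then obtain p where f: "f = (\<lambda>x. if x > 0 then poly p (inverse x) * exp (- inverse x) else 0)" by blast
  \<comment> \<open>The derivative of \<open>p(1/x) exp(-1/x)\<close> is
    \<open>x^-2 (p - p')(1/x) exp(-1/x)\<close>. The factor \<open>x^-2\<close> becomes the
    polynomial \<open>[:0, 0, 1:]\<close>, and \<open>v\<close> is the direction.\<close>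
  define q where "q v = smult v ([:0, 0, 1:] * (p - pderiv p))" for v :: real
  have D: "(f has_field_derivative (if x > 0 then poly (q 1) (inverse x) * exp (- inverse x) else 0)) (at x)" for x
  proof (cases x "0::real" rule: linorder_cases)
    case greater
    have "((\<lambda>x. poly p (inverse x) * exp (- inverse x)) has_field_derivative
        poly (q 1) (inverse x) * exp (- inverse x)) (at x)"
      using greater by (auto intro!: derivative_eq_intros simp: q_def power2_eq_square algebra_simps)
    then have "(f has_field_derivative poly (q 1) (inverse x) * exp (- inverse x)) (at x)"
      by (rule has_field_derivative_transform_within_open[of _ _ _ "{0<..}"]) (use greater in \<open>auto simp: f\<close>)
    then show ?thesis using greater by simp
  next
    case less
    have "(f has_field_derivative 0) (at x)"
      by (rule has_field_derivative_transform_within_open[of "\<lambda>_. 0" _ _ "{..<0}"]) (use less in \<open>auto simp: f\<close>)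
    then show ?thesis using less by simp
  next
    case equal
    have "((\<lambda>h. f h / h) \<longlongrightarrow> 0) (at_right 0)"
    proof -
      have "((\<lambda>t. poly ([:0, 1:] * p) t * exp (- t)) \<longlongrightarrow> 0) at_top" by (rule poly_times_exp_at_top)
      moreover have "eventually (\<lambda>t. poly ([:0, 1:] * p) t * exp (- t) = f (inverse t) / inverse t) at_top"
        using eventually_gt_at_top[of 0] by eventually_elim (auto simp: f field_simps)
      ultimately have "((\<lambda>t. f (inverse t) / inverse t) \<longlongrightarrow> 0) at_top"
        using tendsto_cong by fast
      then show ?thesis by (simp add: filterlim_at_right_to_top)
    qed
    moreover have "((\<lambda>h. f h / h) \<longlongrightarrow> 0) (at_left 0)"
    proof (rule tendsto_eventually)
      show "eventually (\<lambda>h. f h / h = 0) (at_left 0)"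
        unfolding eventually_at_filter by (rule always_eventually) (auto simp: f)
    qed
    ultimately have "((\<lambda>h. f h / h) \<longlongrightarrow> 0) (at 0)" by (simp add: filterlim_split_at)
    moreover have "f 0 = 0" by (simp add: f)
    ultimately show ?thesis using equal by (simp add: DERIV_def)
  qed
  show "\<exists>f'. (\<forall>x\<in>UNIV. (f has_derivative f' x) (at x)) \<and>
      (\<forall>v. \<exists>p. (\<lambda>x. f' x v) = (\<lambda>x. if x > 0 then poly p (inverse x) * exp (- inverse x) else 0))"
  proof (intro exI conjI ballI allI)
    show "(f has_derivative (\<lambda>v. if x > 0 then poly (q v) (inverse x) * exp (- inverse x) else 0)) (at x)" for x
      using D[of x] unfolding has_field_derivative_def
      by (rule has_derivative_eq_rhs) (simp add: fun_eq_iff q_def)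
  qed (rule refl)
qed auto

lemma smooth_on_norm_sq: "open S \<Longrightarrow> smooth_on S f \<Longrightarrow> smooth_on S (\<lambda>x. f x \<bullet> f x)"
  by (rule smooth_on_bounded_bilinear[OF _ bounded_bilinear_inner])

text \<open>The closed ball inside \<open>W\<close> is the compact support that later permits
  extension by zero from a chart.\<close>

lemma bump_exists:
  fixes y0 :: "'e::euclidean_space"
  assumes "open W" "y0 \<in> W"
  obtains \<eta> :: "'e \<Rightarrow> real" and r where "smooth_on UNIV \<eta>" "\<eta> y0 = 1" "r > 0" "cball y0 r \<subseteq> W"
    "\<And>y. y \<notin> ball y0 r \<Longrightarrow> \<eta> y = 0"
proof -
  obtain r where r: "r > 0" "cball y0 r \<subseteq> W"
    using assms open_contains_cball by blast
  define \<eta> where "\<eta> y = inverse (flat (r\<^sup>2)) * flat (r\<^sup>2 + - ((y - y0) \<bullet> (y - y0)))" for y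
  have "smooth_on UNIV (\<lambda>y. y + - y0)" by (intro smooth_on_add smooth_on_id smooth_on_const) auto
  then have "smooth_on UNIV (\<lambda>y. (y - y0) \<bullet> (y - y0))"
    using smooth_on_norm_sq[of UNIV "\<lambda>y. y + - y0"] by simp
  then have "smooth_on UNIV \<eta>" unfolding \<eta>_def
    by (intro smooth_on_mult smooth_on_const smooth_on_compose[OF _ _ smooth_on_flat] smooth_on_add
        smooth_on_bounded_linear[OF _ bounded_linear_minus[OF bounded_linear_ident]]) auto
  moreover have "\<eta> y0 = 1" using r by (simp add: \<eta>_def flat_def)
  moreover have "\<eta> y = 0" if "y \<notin> ball y0 r" for y
  proof -
    have "r\<^sup>2 \<le> (norm (y - y0))\<^sup>2"
      using that r by (intro power_mono) (auto simp: dist_norm norm_minus_commute)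
    then show ?thesis by (simp add: \<eta>_def flat_def power2_norm_eq_inner)
  qed
  ultimately show thesis using that r by blast
qed

subsection \<open>Hadamard's lemma\<close>

text \<open>Differentiating under the integral sign produces a factor \<open>t\<close> from the
  inner map, so the integrals with arbitrary weight \<open>t ^ e\<close> form a class closed under
  directional derivatives. Hadamard's lemma is the case \<open>e = 0\<close>.\<close>

lemma smooth_on_segment_integral:
  fixes k :: "'e::euclidean_space \<Rightarrow> 'f::banach"
  assumes "smooth_on (ball y0 r) k"
  shows "smooth_on (ball y0 r) (\<lambda>y. integral {0..1} (\<lambda>t. t ^ e *\<^sub>R k (y0 + t *\<^sub>R (y - y0))))"
proof (rule smooth_on_coinduct[where
    P = "\<lambda>f. \<exists>k e. smooth_on (ball y0 r) k \<and>
      f = (\<lambda>y. integral {0..1} (\<lambda>t. t ^ e *\<^sub>R k (y0 + t *\<^sub>R (y - y0))))"])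
  show "\<exists>k' e'. smooth_on (ball y0 r) k' \<and>
    (\<lambda>y. integral {0..1} (\<lambda>t. t ^ e *\<^sub>R k (y0 + t *\<^sub>R (y - y0)))) =
    (\<lambda>y. integral {0..1} (\<lambda>t. t ^ e' *\<^sub>R k' (y0 + t *\<^sub>R (y - y0))))"
    using assms by blast
next
  fix f :: "'e \<Rightarrow> 'f"
  assume "\<exists>k e. smooth_on (ball y0 r) k \<and> f = (\<lambda>y. integral {0..1} (\<lambda>t. t ^ e *\<^sub>R k (y0 + t *\<^sub>R (y - y0))))"
  then obtain k e where k: "smooth_on (ball y0 r) k"
    and f: "f = (\<lambda>y. integral {0..1} (\<lambda>t. t ^ e *\<^sub>R k (y0 + t *\<^sub>R (y - y0))))" by blast
  let ?seg = "\<lambda>y t. y0 + t *\<^sub>R (y - y0)"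
  have seg: "?seg y t \<in> ball y0 r" if "y \<in> ball y0 r" "t \<in> {0..1}" for y t
  proof -
    have "norm (t *\<^sub>R (y - y0)) \<le> 1 * norm (y - y0)"
      using that(2) by (simp add: mult_left_le_one_le)
    then show ?thesis using that(1) by (simp add: dist_norm norm_minus_commute)
  qed
  let ?Dk = "\<lambda>z. frechet_derivative k (at z)"
  have dk: "(k has_derivative ?Dk z) (at z)" if "z \<in> ball y0 r" for z
    using smooth_on_has_derivative[OF k that] .
  define fx where "fx y t = Blinfun (\<lambda>v. (t ^ e * t) *\<^sub>R ?Dk (?seg y t) v)" for y t
  have blf: "bounded_linear (\<lambda>v. (t ^ e * t) *\<^sub>R ?Dk (?seg y t) v)"
    if "y \<in> ball y0 r" "t \<in> {0..1}" for y t
    by (rule bounded_linear_const_scaleR[OF has_derivative_bounded_linear[OF dk[OF seg[OF that]]]])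
  have fx: "blinfun_apply (fx y t) v = (t ^ e * t) *\<^sub>R ?Dk (?seg y t) v"
    if "y \<in> ball y0 r" "t \<in> {0..1}" for y t v
    unfolding fx_def by (subst bounded_linear_Blinfun_apply[OF blf[OF that]]) simp
  have cseg: "continuous_on (ball y0 r \<times> {0..1}) (\<lambda>z. h (?seg (fst z) (snd z)))"
    if "continuous_on (ball y0 r) h" for h :: "'e \<Rightarrow> 'f"
    by (rule continuous_on_compose2[OF that]) (auto intro!: continuous_intros seg)
  have cfx: "continuous_on (ball y0 r \<times> {0..1}) (\<lambda>(y, t). fx y t)"
  proof (rule continuous_on_blinfun_componentwise)
    fix i :: 'e
    have "continuous_on (ball y0 r \<times> {0..1})
        (\<lambda>z. (snd z ^ e * snd z) *\<^sub>R ?Dk (?seg (fst z) (snd z)) i)"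
      using smooth_on_continuous_on[OF smooth_on_frechet_derivative[OF k]]
      by (intro continuous_intros cseg)
    then show "continuous_on (ball y0 r \<times> {0..1}) (\<lambda>x. blinfun_apply (case x of (y, t) \<Rightarrow> fx y t) i)"
      by (rule continuous_on_eq) (auto simp: fx)
  qed
  have D: "(f has_derivative integral (cbox 0 1) (fx y)) (at y)" if y: "y \<in> ball y0 r" for y
  proof -
    have "((\<lambda>y. integral (cbox 0 1) (\<lambda>t. t ^ e *\<^sub>R k (?seg y t))) has_derivative integral (cbox 0 1) (fx y))
        (at y within ball y0 r)"
    proof (rule leibniz_rule[OF _ _ _ y convex_ball])
      show "continuous_on (ball y0 r \<times> cbox 0 1) (\<lambda>(x, t). fx x t)" using cfx by simp
      show "(\<lambda>t. t ^ e *\<^sub>R k (?seg y t)) integrable_on cbox 0 1" if "y \<in> ball y0 r" for y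
      proof (rule integrable_continuous)
        have "continuous_on {0..1} (\<lambda>t. k (?seg y t))"
          by (rule continuous_on_compose2[OF smooth_on_continuous_on[OF k]])
            (auto intro!: continuous_intros seg that)
        then show "continuous_on (cbox 0 1) (\<lambda>t. t ^ e *\<^sub>R k (?seg y t))"
          by (auto intro!: continuous_intros)
      qed
      show "((\<lambda>y. t ^ e *\<^sub>R k (?seg y t)) has_derivative blinfun_apply (fx y t)) (at y within ball y0 r)"
        if "y \<in> ball y0 r" "t \<in> cbox 0 1" for y t
      proof -
        have t: "t \<in> {0..1}" using that(2) by simp
        have lin: "linear (?Dk (?seg y t))"
          using dk[OF seg[OF that(1) t]] has_derivative_linear by blast
        have "((\<lambda>y. k (?seg y t)) has_derivative (\<lambda>v. ?Dk (?seg y t) (t *\<^sub>R v))) (at y within ball y0 r)"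
          by (rule has_derivative_compose[where f = "\<lambda>y. ?seg y t" and g = k])
            (auto intro!: derivative_eq_intros dk seg that t)
        from has_derivative_scaleR_right[OF this, of "t ^ e"] show ?thesis
          by (rule has_derivative_eq_rhs) (auto simp: fun_eq_iff fx[OF that(1) t] linear_scale[OF lin])
      qed
    qed
    then show ?thesis unfolding f at_within_open[OF y open_ball] box_real .
  qed
  have I: "blinfun_apply (integral (cbox 0 1) (fx y)) v =
      integral {0..1} (\<lambda>t. t ^ Suc e *\<^sub>R ?Dk (?seg y t) v)" if y: "y \<in> ball y0 r" for y v
  proof -
    have "continuous_on (cbox 0 1) (fx y)"
    proof -
      have "continuous_on (cbox 0 1) (\<lambda>t. case (y, t) of (y, t) \<Rightarrow> fx y t)"
        by (rule continuous_on_compose2[OF cfx]) (use y in \<open>auto intro!: continuous_intros\<close>)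
      then show ?thesis by simp
    qed
    then have "fx y integrable_on cbox 0 1" by (rule integrable_continuous)
    from integral_linear[OF this blinfun.bounded_linear_left[of v]]
    have "blinfun_apply (integral (cbox 0 1) (fx y)) v = integral (cbox 0 1) (\<lambda>t. blinfun_apply (fx y t) v)"
      unfolding o_def by (rule sym)
    also have "\<dots> = integral {0..1} (\<lambda>t. t ^ Suc e *\<^sub>R ?Dk (?seg y t) v)"
      unfolding box_real by (rule integral_cong) (simp add: fx[OF y] mult.commute[of _ "_ ^ _"])
    finally show ?thesis .
  qed
  show "\<exists>f'. (\<forall>x\<in>ball y0 r. (f has_derivative f' x) (at x)) \<and>
      (\<forall>v. \<exists>k e. smooth_on (ball y0 r) k \<and>
        (\<lambda>x. f' x v) = (\<lambda>y. integral {0..1} (\<lambda>t. t ^ e *\<^sub>R k (?seg y t))))"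
  proof (intro exI conjI allI ballI)
    show "(f has_derivative (\<lambda>v. integral {0..1} (\<lambda>t. t ^ Suc e *\<^sub>R ?Dk (?seg y t) v))) (at y)"
      if "y \<in> ball y0 r" for y
      using D[OF that] by (rule has_derivative_eq_rhs) (rule ext, rule I[OF that])
    show "smooth_on (ball y0 r) (\<lambda>z. ?Dk z v)" for v by (rule smooth_on_frechet_derivative[OF k])
  qed (rule refl)
qed auto

text \<open>Fundamental theorem of calculus along the segment from \<open>y0\<close> to
  \<open>y\<close>; \<open>g i\<close> averages the partial derivative in direction \<open>i\<close>
  over this segment.\<close>

lemma hadamard:
  fixes k :: "'e::euclidean_space \<Rightarrow> 'f::banach"
  assumes k: "smooth_on (ball y0 r) k" and r: "r > 0"
  obtains g where "\<And>i. smooth_on (ball y0 r) (g i)" "\<And>i. g i y0 = frechet_derivative k (at y0) i"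
    "\<And>y. y \<in> ball y0 r \<Longrightarrow> k y = k y0 + (\<Sum>i\<in>Basis. ((y - y0) \<bullet> i) *\<^sub>R g i y)"
proof -
  let ?seg = "\<lambda>y t. y0 + t *\<^sub>R (y - y0)" and ?Dk = "\<lambda>z. frechet_derivative k (at z)"
  define g where "g i y = integral {0..1} (\<lambda>t. ?Dk (?seg y t) i)" for i y
  show thesis
  proof (rule that[of g])
    show "smooth_on (ball y0 r) (g i)" for i
      using smooth_on_segment_integral[OF smooth_on_frechet_derivative[OF k, of i], of 0]
      by (simp add: g_def[abs_def])
    show "g i y0 = ?Dk y0 i" for i by (simp add: g_def)
    fix y assume y: "y \<in> ball y0 r"
    have seg: "?seg y t \<in> ball y0 r" if "t \<in> {0..1}" for t
    proof -
      have "norm (t *\<^sub>R (y - y0)) \<le> 1 * norm (y - y0)"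
        using that by (simp add: mult_left_le_one_le)
      then show ?thesis using y by (simp add: dist_norm norm_minus_commute)
    qed
    have dk: "(k has_derivative ?Dk z) (at z)" if "z \<in> ball y0 r" for z
      using smooth_on_has_derivative[OF k that] .
    have "((\<lambda>t. ?Dk (?seg y t) (y - y0)) has_integral (k (?seg y 1) - k (?seg y 0))) {0..1}"
    proof (rule fundamental_theorem_of_calculus)
      fix t :: real assume t: "t \<in> {0..1}"
      have "((\<lambda>t. k (?seg y t)) has_derivative (\<lambda>h. ?Dk (?seg y t) (h *\<^sub>R (y - y0)))) (at t within {0..1})"
        by (rule has_derivative_compose[where f = "\<lambda>t. ?seg y t" and g = k])
          (auto intro!: derivative_eq_intros dk seg t)
      moreover have "linear (?Dk (?seg y t))"
        using dk[OF seg[OF t]] has_derivative_linear by blast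
      ultimately show "((\<lambda>t. k (?seg y t)) has_vector_derivative ?Dk (?seg y t) (y - y0)) (at t within {0..1})"
        by (simp add: has_vector_derivative_def linear_scale)
    qed simp
    then have "k y - k y0 = integral {0..1} (\<lambda>t. ?Dk (?seg y t) (y - y0))"
      by (simp add: integral_unique)
    also have "\<dots> = integral {0..1} (\<lambda>t. \<Sum>i\<in>Basis. ((y - y0) \<bullet> i) *\<^sub>R ?Dk (?seg y t) i)"
    proof (rule integral_cong)
      fix t :: real assume t: "t \<in> {0..1}"
      have lin: "linear (?Dk (?seg y t))" using dk[OF seg[OF t]] has_derivative_linear by blast
      show "?Dk (?seg y t) (y - y0) = (\<Sum>i\<in>Basis. ((y - y0) \<bullet> i) *\<^sub>R ?Dk (?seg y t) i)"
        using linear_sum[OF lin, of "\<lambda>i. ((y - y0) \<bullet> i) *\<^sub>R i" Basis]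
        by (simp add: euclidean_representation linear_scale[OF lin])
    qed
    also have "\<dots> = (\<Sum>i\<in>Basis. integral {0..1} (\<lambda>t. ((y - y0) \<bullet> i) *\<^sub>R ?Dk (?seg y t) i))"
    proof (rule integral_sum)
      fix i :: 'e
      have "continuous_on {0..1} (\<lambda>t. ?Dk (?seg y t) i)"
        by (rule continuous_on_compose2[OF smooth_on_continuous_on[OF smooth_on_frechet_derivative[OF k]]])
          (auto intro!: continuous_intros seg)
      then show "(\<lambda>t. ((y - y0) \<bullet> i) *\<^sub>R ?Dk (?seg y t) i) integrable_on {0..1}"
        by (intro integrable_continuous_real continuous_intros)
    qed simp
    finally have "k y - k y0 = (\<Sum>i\<in>Basis. ((y - y0) \<bullet> i) *\<^sub>R g i y)"
      by (simp only: g_def integral_cmul)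
    then show "k y = k y0 + (\<Sum>i\<in>Basis. ((y - y0) \<bullet> i) *\<^sub>R g i y)"
      by (simp only: diff_eq_eq add.commute)
  qed
qed

section \<open>Smooth functions and complex tangent vectors on a manifold\<close>

lemma smooth_on_transform:
  "open S \<Longrightarrow> smooth_on S g \<Longrightarrow> (\<And>y. y \<in> S \<Longrightarrow> f y = g y) \<Longrightarrow> smooth_on S f"
  using smooth_on_cong[of S f g] by blast

locale manifold =
  fixes A :: "('a::{t2_space,second_countable_topology}, 'e::euclidean_space) chart set"
  assumes atlas: "smooth_atlas A"
begin

lemma chart_exists: obtains U x where "(U, x) \<in> A" "p \<in> U"
proof -
  have "p \<in> (\<Union>(U, x)\<in>A. U)" using atlas unfolding smooth_atlas_def by simp
  then show thesis using that by auto
qed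

lemma chart:
  assumes "(U, x) \<in> A"
  shows "open U \<and> open (x ` U) \<and> (\<exists>y. homeomorphism U (x ` U) x y)"
  using atlas assms unfolding smooth_atlas_def by (elim conjE) (drule bspec, assumption, simp)

lemma chart_open: "(U, x) \<in> A \<Longrightarrow> open U" "(U, x) \<in> A \<Longrightarrow> open (x ` U)"
  using chart by simp_all

lemma chart_homeomorphism:
  assumes "(U, x) \<in> A"
  shows "homeomorphism U (x ` U) x (inv_into U x)"
proof -
  obtain y where y: "homeomorphism U (x ` U) x y"
    using chart[OF assms] by blast
  have inj: "inj_on x U"
    by (rule inj_on_inverseI[of _ y]) (use y homeomorphism_apply1 in blast)
  have "continuous_on (x ` U) (inv_into U x)"
    using homeomorphism_cont2[OF y]
    by (rule continuous_on_eq) (use homeomorphism_apply1[OF y] inj in auto)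
  then show ?thesis
    using inj homeomorphism_cont1[OF y] by (auto intro!: homeomorphismI)
qed

lemma chart_inj: "(U, x) \<in> A \<Longrightarrow> inj_on x U"
  using homeomorphism_apply1[OF chart_homeomorphism] by (metis inj_on_inverseI)

lemma chart_inv [simp]: "(U, x) \<in> A \<Longrightarrow> q \<in> U \<Longrightarrow> inv_into U x (x q) = q"
  using chart_inj inv_into_f_f by metis

lemma chart_image_open:
  assumes "(U, x) \<in> A" "open W" "W \<subseteq> U"
  shows "open (x ` W)"
proof -
  have "openin (top_of_set U) W" using assms by (simp add: openin_open_eq chart_open)
  then have "openin (top_of_set (x ` U)) (x ` W)"
    by (rule homeomorphism_imp_open_map[OF chart_homeomorphism[OF assms(1)]])
  then show ?thesis using chart_open(2)[OF assms(1)] openin_open_trans by blast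
qed

lemma chart_transition: "(U, x) \<in> A \<Longrightarrow> (V, y) \<in> A \<Longrightarrow> smooth_on (x ` (U \<inter> V)) (y \<circ> inv_into U x)"
  using atlas unfolding smooth_atlas_def by (elim conjE) (drule bspec, assumption, simp, drule bspec, assumption, simp)

lemma smooth_mapD: "smooth_map A f \<Longrightarrow> (U, x) \<in> A \<Longrightarrow> smooth_on (x ` U) (\<lambda>y. f (inv_into U x y))"
  unfolding smooth_map_def o_def by blast

lemma smooth_mapI:
  "(\<And>U x. (U, x) \<in> A \<Longrightarrow> open (x ` U) \<Longrightarrow> smooth_on (x ` U) (\<lambda>y. f (inv_into U x y))) \<Longrightarrow> smooth_map A f"
  unfolding smooth_map_def o_def using chart_open(2) by blast

lemma smooth_map_const [simp]: "smooth_map A (\<lambda>q. c)"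
  by (rule smooth_mapI) simp

lemma smooth_map_add: "smooth_map A f \<Longrightarrow> smooth_map A g \<Longrightarrow> smooth_map A (\<lambda>q. f q + g q)"
  by (rule smooth_mapI) (rule smooth_on_add[OF _ smooth_mapD smooth_mapD])

lemma smooth_map_mult:
  fixes f g :: "'a \<Rightarrow> 'f::real_normed_algebra"
  shows "smooth_map A f \<Longrightarrow> smooth_map A g \<Longrightarrow> smooth_map A (\<lambda>q. f q * g q)"
  by (rule smooth_mapI) (rule smooth_on_mult[OF _ smooth_mapD smooth_mapD])

lemma smooth_map_bounded_linear:
  assumes "bounded_linear L" "smooth_map A f"
  shows "smooth_map A (\<lambda>q. L (f q))"
  by (rule smooth_mapI) (rule smooth_on_bounded_linear[OF _ assms(1) smooth_mapD[OF assms(2)]])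

lemma smooth_map_compose:
  fixes f :: "'a \<Rightarrow> 'g::euclidean_space"
  assumes "open R" "smooth_on R h" "smooth_map A f" "\<And>q. f q \<in> R"
  shows "smooth_map A (\<lambda>q. h (f q))"
  by (rule smooth_mapI) (rule smooth_on_compose[OF _ assms(1,2) smooth_mapD[OF assms(3)]], use assms(4) in auto)

lemma smooth_map_sum:
  "finite I \<Longrightarrow> (\<And>i. i \<in> I \<Longrightarrow> smooth_map A (f i)) \<Longrightarrow> smooth_map A (\<lambda>q. \<Sum>i\<in>I. f i q)"
  by (induction I rule: finite_induct) (auto intro: smooth_map_add)

lemma smooth_map_of_real: "smooth_map A u \<Longrightarrow> smooth_map A (\<lambda>q. complex_of_real (u q))"
  by (rule smooth_map_bounded_linear[OF bounded_linear_of_real])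

lemma smooth_map_Re: "smooth_map A u \<Longrightarrow> smooth_map A (\<lambda>q. Re (u q))"
  by (rule smooth_map_bounded_linear[OF bounded_linear_Re])

lemma smooth_map_cnj: "smooth_map A u \<Longrightarrow> smooth_map A (\<lambda>q. cnj (u q))"
  by (rule smooth_map_bounded_linear[OF bounded_linear_cnj])

lemma smooth_map_cnj_iff [simp]: "smooth_map A (\<lambda>q. cnj (u q)) \<longleftrightarrow> smooth_map A u"
  using smooth_map_cnj[of u] smooth_map_cnj[of "\<lambda>q. cnj (u q)"] by auto

lemma smooth_map_cmult: "smooth_map A u \<Longrightarrow> smooth_map A (\<lambda>q. (c::'f::real_normed_algebra) * u q)"
  by (intro smooth_map_mult smooth_map_const)

lemma smooth_map_uminus: "smooth_map A u \<Longrightarrow> smooth_map A (\<lambda>q. - u q)"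
  by (rule smooth_map_bounded_linear[OF bounded_linear_minus[OF bounded_linear_ident]])

lemma smooth_map_diff: "smooth_map A f \<Longrightarrow> smooth_map A g \<Longrightarrow> smooth_map A (\<lambda>q. f q - g q)"
  using smooth_map_add[OF _ smooth_map_uminus, of f g] by simp

lemma smooth_map_exp: "smooth_map A u \<Longrightarrow> smooth_map A (\<lambda>q. exp (u q :: real))"
  by (rule smooth_map_compose[OF open_UNIV smooth_on_exp]) auto

lemma smooth_map_poly: "smooth_map A u \<Longrightarrow> smooth_map A (\<lambda>q. poly P (u q :: real))"
  by (induction P) (auto intro!: smooth_map_add smooth_map_mult)

lemmas smooth_map_intros = smooth_map_const smooth_map_add smooth_map_mult smooth_map_of_real
  smooth_map_cnj smooth_map_uminus smooth_map_diff smooth_map_exp smooth_map_poly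

lemma smooth_map_continuous:
  assumes "smooth_map A f"
  shows "continuous_on UNIV f"
proof -
  have "continuous (at q) f" for q
  proof -
    obtain U x where Ux: "(U, x) \<in> A" "q \<in> U" by (rule chart_exists)
    have "continuous_on U (\<lambda>q. f (inv_into U x (x q)))"
      by (rule continuous_on_compose2[OF smooth_on_continuous_on[OF smooth_mapD[OF assms Ux(1)]]
            homeomorphism_cont1[OF chart_homeomorphism[OF Ux(1)]]]) auto
    then have "continuous_on U f" by (rule continuous_on_eq) (simp add: Ux)
    then show ?thesis using Ux(2) chart_open(1)[OF Ux(1)] by (simp add: continuous_on_eq_continuous_at)
  qed
  then show ?thesis by (simp add: continuous_at_imp_continuous_on)
qed

text \<open>In a Hausdorff space the compact set over \<open>K\<close> is closed. Off this set the
  function vanishes, and over \<open>W\<close> it is \<open>k\<close> in coordinates; the two open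
  regions cover the manifold.\<close>

lemma smooth_map_chart_extend:
  assumes c: "(U, x) \<in> A" and W: "open W" "W \<subseteq> x ` U" and k: "smooth_on W k"
    and K: "compact K" "K \<subseteq> W" "\<And>y. y \<in> W - K \<Longrightarrow> k y = 0"
  shows "smooth_map A (\<lambda>q. if q \<in> U \<and> x q \<in> W then k (x q) else 0)" (is "smooth_map A ?f")
proof (rule smooth_mapI)
  fix V y assume V: "(V, y) \<in> A" "open (y ` V)"
  define C where "C = inv_into U x ` K"
  have "compact C" unfolding C_def
    using homeomorphism_cont2[OF chart_homeomorphism[OF c]] K(1,2) W(2)
    by (meson compact_continuous_image continuous_on_subset order_trans)
  then have C: "closed C" by (rule compact_imp_closed)
  have opre: "open {q \<in> U. x q \<in> W}"
    using continuous_open_preimage[OF homeomorphism_cont1[OF chart_homeomorphism[OF c]] chart_open(1)[OF c] W(1)]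
    by (simp add: vimage_def Int_def)
  show "smooth_on (y ` V) (\<lambda>z. ?f (inv_into V y z))"
  proof (rule smooth_on_open_cover)
    fix z assume "z \<in> y ` V"
    then obtain q where q: "q \<in> V" "z = y q" by blast
    show "\<exists>R. z \<in> R \<and> smooth_on R (\<lambda>z. ?f (inv_into V y z))"
    proof (cases "q \<in> U \<and> x q \<in> W")
      case True
      let ?O = "V \<inter> {q \<in> U. x q \<in> W}"
      have oR: "open (y ` ?O)"
        using chart_open(1)[OF V(1)] opre by (intro chart_image_open[OF V(1)]) auto
      have "smooth_on (y ` ?O) (\<lambda>z. k ((x \<circ> inv_into V y) z))"
        by (rule smooth_on_compose[OF oR W(1) k smooth_on_subset[OF chart_transition[OF V(1) c]]])
          (auto simp: V(1))
      then have "smooth_on (y ` ?O) (\<lambda>z. ?f (inv_into V y z))"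
        by (rule smooth_on_transform[OF oR]) (auto simp: V(1))
      moreover have "z \<in> y ` ?O" using q True by blast
      ultimately show ?thesis by (intro exI[of _ "y ` ?O"] conjI)
    next
      case False
      have oR: "open (y ` (V - C))"
        using chart_open(1)[OF V(1)] C by (intro chart_image_open[OF V(1)]) auto
      have "?f q' = 0" if "q' \<notin> C" for q'
      proof -
        have "x q' \<notin> K" if "q' \<in> U"
          using \<open>q' \<notin> C\<close> that c unfolding C_def by (metis chart_inv image_eqI)
        then show ?thesis using K(3) by auto
      qed
      then have "?f (inv_into V y z) = 0" if "z \<in> y ` (V - C)" for z
        using that V(1) by force
      then have "smooth_on (y ` (V - C)) (\<lambda>z. ?f (inv_into V y z))"
        by (intro smooth_on_transform[OF oR smooth_on_const[OF oR]])
      moreover have "q \<notin> C"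
      proof
        assume "q \<in> C"
        then obtain w where "w \<in> K" "q = inv_into U x w" unfolding C_def by blast
        moreover then have "w \<in> x ` U" using K W by blast
        ultimately show False using False K W by (auto simp: inv_into_into f_inv_into_f)
      qed
      ultimately show ?thesis using q by (intro exI[of _ "y ` (V - C)"] conjI) auto
    qed
  qed
qed

subsection \<open>Coordinate derivatives\<close>

definition cd :: "('a, 'e) chart \<Rightarrow> ('a \<Rightarrow> 'f::real_normed_vector) \<Rightarrow> 'a \<Rightarrow> 'e \<Rightarrow> 'f" where
  "cd c f p = frechet_derivative (\<lambda>y. f (inv_into (fst c) (snd c) y)) (at (snd c p))"

lemma cd_has_derivative:
  assumes "smooth_map A f" "(U, x) \<in> A" "p \<in> U"
  shows "((\<lambda>y. f (inv_into U x y)) has_derivative cd (U, x) f p) (at (x p))"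
  using smooth_on_has_derivative[OF smooth_mapD[OF assms(1,2)]] assms(3) by (simp add: cd_def)

lemma cd_eq:
  assumes "((\<lambda>y. f (inv_into U x y)) has_derivative D) (at (x p))"
  shows "cd (U, x) f p = D"
  using frechet_derivative_at[OF assms] by (simp add: cd_def)

lemma cd_linear:
  assumes "smooth_map A f" "(U, x) \<in> A" "p \<in> U"
  shows "linear (cd (U, x) f p)"
  using has_derivative_linear[OF cd_has_derivative[OF assms]] .

definition coord_vec :: "('a, 'e) chart \<Rightarrow> 'a \<Rightarrow> 'e \<Rightarrow> 'a cvec" where
  "coord_vec c p a = (\<lambda>f. if smooth_map A f then cd c f p a else 0)"

lemma cd_add:
  assumes "(U, x) \<in> A" "p \<in> U" "smooth_map A f" "smooth_map A g"
  shows "cd (U, x) (\<lambda>q. f q + g q) p a = cd (U, x) f p a + cd (U, x) g p a"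
proof -
  have "cd (U, x) (\<lambda>q. f q + g q) p = (\<lambda>a. cd (U, x) f p a + cd (U, x) g p a)"
    by (rule cd_eq, rule has_derivative_add[OF cd_has_derivative[OF assms(3,1,2)] cd_has_derivative[OF assms(4,1,2)]])
  then show ?thesis by simp
qed

lemma cd_mult:
  fixes f g :: "'a \<Rightarrow> complex"
  assumes "(U, x) \<in> A" "p \<in> U" "smooth_map A f" "smooth_map A g"
  shows "cd (U, x) (\<lambda>q. f q * g q) p a = f p * cd (U, x) g p a + cd (U, x) f p a * g p"
proof -
  have "cd (U, x) (\<lambda>q. f q * g q) p =
      (\<lambda>a. f (inv_into U x (x p)) * cd (U, x) g p a + cd (U, x) f p a * g (inv_into U x (x p)))"
    by (rule cd_eq, rule has_derivative_mult[OF cd_has_derivative[OF assms(3,1,2)] cd_has_derivative[OF assms(4,1,2)]])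
  then show ?thesis using assms(1,2) by simp
qed

lemma cd_bounded_linear:
  assumes "(U, x) \<in> A" "p \<in> U" "smooth_map A f" "bounded_linear L"
  shows "cd (U, x) (\<lambda>q. L (f q)) p a = L (cd (U, x) f p a)"
proof -
  have "cd (U, x) (\<lambda>q. L (f q)) p = (\<lambda>a. L (cd (U, x) f p a))"
    by (rule cd_eq, rule bounded_linear.has_derivative[OF assms(4) cd_has_derivative[OF assms(3,1,2)]])
  then show ?thesis by simp
qed

lemma coord_vec_ctangent:
  assumes "(U, x) \<in> A" "p \<in> U"
  shows "coord_vec (U, x) p a \<in> ctangent A p"
proof -
  have "cd (U, x) (\<lambda>q. c * f q) p a = c * cd (U, x) f p a" if "smooth_map A f" for c and f :: "'a \<Rightarrow> complex"
    by (rule cd_bounded_linear[OF assms that bounded_linear_mult_right])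
  then show ?thesis
    using assms by (auto simp: ctangent_def coord_vec_def cd_add cd_mult smooth_map_intros smooth_map_cmult)
qed

lemma cconj_coord_vec:
  assumes "(U, x) \<in> A" "p \<in> U"
  shows "cconj (coord_vec (U, x) p a) = coord_vec (U, x) p a"
  using assms cd_bounded_linear[OF assms _ bounded_linear_cnj, where a = a]
  by (auto simp: cconj_def coord_vec_def fun_eq_iff)

lemma ctangent_add:
  "v \<in> ctangent A p \<Longrightarrow> smooth_map A f \<Longrightarrow> smooth_map A g \<Longrightarrow> v (\<lambda>q. f q + g q) = v f + v g"
  by (simp add: ctangent_def)

lemma ctangent_mult:
  "v \<in> ctangent A p \<Longrightarrow> smooth_map A f \<Longrightarrow> smooth_map A g \<Longrightarrow> v (\<lambda>q. f q * g q) = f p * v g + v f * g p"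
  by (simp add: ctangent_def)

lemma ctangent_cmult: "v \<in> ctangent A p \<Longrightarrow> smooth_map A f \<Longrightarrow> v (\<lambda>q. c * f q) = c * v f"
  unfolding ctangent_def by blast

lemma ctangent_const [simp]: "v \<in> ctangent A p \<Longrightarrow> v (\<lambda>q. c) = 0"
  using ctangent_mult[of v p "\<lambda>q. 1" "\<lambda>q. 1"] ctangent_cmult[of v p "\<lambda>q. 1" c] by simp

lemma ctangent_uminus: "v \<in> ctangent A p \<Longrightarrow> smooth_map A f \<Longrightarrow> v (\<lambda>q. - f q) = - v f"
  using ctangent_cmult[of v p f "-1"] by simp

lemma ctangent_diff:
  "v \<in> ctangent A p \<Longrightarrow> smooth_map A f \<Longrightarrow> smooth_map A g \<Longrightarrow> v (\<lambda>q. f q - g q) = v f - v g"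
  using ctangent_add[of v p f "\<lambda>q. - g q"] ctangent_uminus[of v p g] by (simp add: smooth_map_uminus)

lemma ctangent_sum:
  assumes "v \<in> ctangent A p" "finite I" "\<And>i. i \<in> I \<Longrightarrow> smooth_map A (f i)"
  shows "v (\<lambda>q. \<Sum>i\<in>I. f i q) = (\<Sum>i\<in>I. v (f i))"
  using assms(2,3)
  by (induction I rule: finite_induct) (simp_all add: ctangent_const[OF assms(1)] ctangent_add[OF assms(1)] smooth_map_sum)

lemma ctangent_not_smooth: "v \<in> ctangent A p \<Longrightarrow> \<not> smooth_map A f \<Longrightarrow> v f = 0"
  by (simp add: ctangent_def)

lemma ctangent_eqI:
  assumes "v \<in> ctangent A p" "w \<in> ctangent A p" "\<And>f. smooth_map A f \<Longrightarrow> v f = w f"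
  shows "v = w"
proof
  fix f show "v f = w f" 
    using assms(3) ctangent_not_smooth[OF assms(1), of f] ctangent_not_smooth[OF assms(2), of f]
    by (cases "smooth_map A f") simp_all
qed

lemma ctangentI:
  assumes "\<And>f g. smooth_map A f \<Longrightarrow> smooth_map A g \<Longrightarrow> v (\<lambda>q. f q + g q) = v f + v g"
    and "\<And>f g. smooth_map A f \<Longrightarrow> smooth_map A g \<Longrightarrow> v (\<lambda>q. f q * g q) = f p * v g + v f * g p"
    and "\<And>c f. smooth_map A f \<Longrightarrow> v (\<lambda>q. c * f q) = c * v f"
    and "\<And>f. \<not> smooth_map A f \<Longrightarrow> v f = 0"
  shows "v \<in> ctangent A p"
  unfolding ctangent_def using assms by blast

lemma zero_ctangent [simp]: "0 \<in> ctangent A p"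
  by (rule ctangentI) simp_all

lemma plus_ctangent:
  assumes "v \<in> ctangent A p" "w \<in> ctangent A p"
  shows "v + w \<in> ctangent A p"
  by (rule ctangentI)
    (simp_all add: assms[THEN ctangent_add] assms[THEN ctangent_mult] assms[THEN ctangent_cmult]
      assms[THEN ctangent_not_smooth] assms[THEN ctangent_const] algebra_simps)

lemma cscale_ctangent:
  assumes "v \<in> ctangent A p"
  shows "cscale c v \<in> ctangent A p"
  by (rule ctangentI)
    (simp_all add: cscale_def ctangent_add[OF assms] ctangent_mult[OF assms] ctangent_cmult[OF assms]
      ctangent_not_smooth[OF assms] ctangent_const[OF assms] algebra_simps)

lemma cconj_ctangent:
  assumes "v \<in> ctangent A p"
  shows "cconj v \<in> ctangent A p"
  by (rule ctangentI)
    (simp_all add: cconj_def ctangent_add[OF assms] ctangent_mult[OF assms] ctangent_cmult[OF assms]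
      ctangent_not_smooth[OF assms] ctangent_const[OF assms] smooth_map_cnj)

lemma diff_ctangent:
  assumes "v \<in> ctangent A p" "w \<in> ctangent A p"
  shows "v - w \<in> ctangent A p"
proof -
  have "v - w = v + cscale (-1) w" by (simp add: fun_eq_iff cscale_def)
  then show ?thesis using plus_ctangent[OF assms(1) cscale_ctangent[OF assms(2), of "-1"]] by simp
qed

lemma sum_ctangent: "(\<And>i. i \<in> I \<Longrightarrow> v i \<in> ctangent A p) \<Longrightarrow> (\<Sum>i\<in>I. v i) \<in> ctangent A p"
  by (induction I rule: infinite_finite_induct) (auto intro: plus_ctangent)

text \<open>The cut-off coordinate functions \<open>\<xi> i\<close> vanish at \<open>p\<close>; by Hadamard's lemma a smooth function is, up to
  a constant and products of functions vanishing at \<open>p\<close>, a combination of them.\<close>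
lemma cutoff_coordinates:
  assumes c: "(U, x) \<in> A" and p: "p \<in> U"
  obtains \<xi> :: "'e \<Rightarrow> 'a \<Rightarrow> complex" where
    "\<And>i. smooth_map A (\<xi> i)" "\<And>i a. cd (U, x) (\<xi> i) p a = of_real (a \<bullet> i)"
    "\<And>v f. v \<in> ctangent A p \<Longrightarrow> smooth_map A f \<Longrightarrow> v f = (\<Sum>i\<in>Basis. v (\<xi> i) * cd (U, x) f p i)"
proof -
  obtain R where R: "R > 0" "ball (x p) R \<subseteq> x ` U"
    using chart_open(2)[OF c] p open_contains_ball by blast
  obtain \<eta> r where \<eta>: "smooth_on UNIV \<eta>" "\<eta> (x p) = 1" "r > 0" "cball (x p) r \<subseteq> ball (x p) R"
      "\<And>y. y \<notin> ball (x p) r \<Longrightarrow> \<eta> y = (0::real)"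
    by (rule bump_exists[of "ball (x p) R" "x p"]) (use R in auto)
  let ?B = "ball (x p) R"
  define ext where "ext k = (\<lambda>q. if q \<in> U \<and> x q \<in> ?B then \<eta> (x q) *\<^sub>R k (x q) else 0)" for k :: "'e \<Rightarrow> complex"
  have \<eta>B: "smooth_on ?B \<eta>" by (rule smooth_on_subset[OF \<eta>(1)]) auto
  have ext: "smooth_map A (ext k)" if "smooth_on ?B k" for k
    unfolding ext_def
  proof (rule smooth_map_chart_extend[OF c _ R(2) _ _ \<eta>(4)])
    show "smooth_on ?B (\<lambda>y. \<eta> y *\<^sub>R k y)"
      by (rule smooth_on_bounded_bilinear[OF _ bounded_bilinear_scaleR \<eta>B that]) auto
    show "\<eta> y *\<^sub>R k y = 0" if "y \<in> ?B - cball (x p) r" for y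
      using \<eta>(5)[of y] that by (auto simp: dist_norm)
  qed auto
  have lin: "smooth_on ?B (\<lambda>y. complex_of_real ((y - x p) \<bullet> i))" for i
  proof -
    have "smooth_on ?B (\<lambda>y. complex_of_real ((y + - x p) \<bullet> i))"
      by (intro smooth_on_bounded_linear[OF _ bounded_linear_of_real]
          smooth_on_bounded_linear[OF _ bounded_linear_inner_left] smooth_on_add smooth_on_id smooth_on_const) auto
    then show ?thesis by simp
  qed
  define \<xi> where "\<xi> i = ext (\<lambda>y. of_real ((y - x p) \<bullet> i))" for i
  have smooth_\<xi>: "smooth_map A (\<xi> i)" for i unfolding \<xi>_def by (rule ext[OF lin])
  have xp: "x p \<in> ?B" using R by simp
  have \<eta>D: "(\<eta> has_derivative frechet_derivative \<eta> (at (x p))) (at (x p))"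
    by (rule smooth_on_has_derivative[OF \<eta>(1)]) simp
  show thesis
  proof (rule that[of \<xi>, OF smooth_\<xi>])
    fix i a
    have "((\<lambda>y. \<eta> y *\<^sub>R complex_of_real ((y - x p) \<bullet> i)) has_derivative (\<lambda>a. of_real (a \<bullet> i))) (at (x p))"
      by (rule has_derivative_eq_rhs[OF has_derivative_scaleR[OF \<eta>D]])
        (auto intro!: derivative_eq_intros simp: \<eta>(2) fun_eq_iff inner_diff_left)
    then have "((\<lambda>y. \<xi> i (inv_into U x y)) has_derivative (\<lambda>a. of_real (a \<bullet> i))) (at (x p))"
    proof (rule has_derivative_transform_within_open[of _ _ _ UNIV "?B"])
      fix y assume y: "y \<in> ?B"
      then have "y \<in> x ` U" using R by blast
      then show "\<eta> y *\<^sub>R complex_of_real ((y - x p) \<bullet> i) = \<xi> i (inv_into U x y)"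
        using y by (simp add: \<xi>_def ext_def inv_into_into f_inv_into_f)
    qed (use R in auto)
    then show "cd (U, x) (\<xi> i) p a = of_real (a \<bullet> i)" by (simp add: cd_eq)
  next
    fix v and f :: "'a \<Rightarrow> complex" assume v: "v \<in> ctangent A p" and f: "smooth_map A f"
    define k where "k y = f (inv_into U x y)" for y
    have k: "smooth_on ?B k"
      unfolding k_def[abs_def] by (rule smooth_on_subset[OF smooth_mapD[OF f c] R(2)])
    obtain g where g: "\<And>i. smooth_on ?B (g i)" "\<And>i. g i (x p) = frechet_derivative k (at (x p)) i"
      "\<And>y. y \<in> ?B \<Longrightarrow> k y = k (x p) + (\<Sum>i\<in>Basis. ((y - x p) \<bullet> i) *\<^sub>R g i y)"
      by (rule hadamard[OF k R(1)]) blast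
    let ?h = "ext (\<lambda>y. 1)"
    have h: "smooth_map A ?h" by (rule ext) simp
    have sm: "smooth_map A (\<lambda>q. 1 - ?h q * ?h q)" "smooth_map A (\<lambda>q. f q - f p)"
      by (intro smooth_map_intros h f)+
    \<comment> \<open>\<open>?h\<close> is the cut-off itself. Both factors of each product carry
      it, so the sum reproduces \<open>f - f p\<close> multiplied by the square of
      \<open>?h\<close>. The remainder is a product of two functions vanishing at \<open>p\<close>,
      which every derivation at \<open>p\<close> kills.\<close>
    have eq: "f = (\<lambda>q. f p + ((\<Sum>i\<in>Basis. \<xi> i q * ext (g i) q) + (1 - ?h q * ?h q) * (f q - f p)))"
    proof
      fix q
      show "f q = f p + ((\<Sum>i\<in>Basis. \<xi> i q * ext (g i) q) + (1 - ?h q * ?h q) * (f q - f p))"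
      proof (cases "q \<in> U \<and> x q \<in> ?B")
        case True
        have "k (x q) = f q" "k (x p) = f p" using True p by (auto simp: k_def c)
        then have "f q - f p = (\<Sum>i\<in>Basis. ((x q - x p) \<bullet> i) *\<^sub>R g i (x q))"
          using g(3)[of "x q"] True by simp
        moreover have "(\<Sum>i\<in>Basis. \<xi> i q * ext (g i) q) =
            ?h q * ?h q * (\<Sum>i\<in>Basis. ((x q - x p) \<bullet> i) *\<^sub>R g i (x q))"
          using True by (simp add: \<xi>_def ext_def sum_distrib_left scaleR_conv_of_real mult_ac)
        ultimately show ?thesis by (simp add: algebra_simps)
      next
        case False
        then have "ext k q = 0" for k by (auto simp: ext_def)
        then show ?thesis by (simp add: \<xi>_def)
      qed
    qed
    have ext_p: "ext k p = k (x p)" for k using p xp by (simp add: ext_def \<eta>(2))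
    have "v f = v (\<lambda>q. f p + ((\<Sum>i\<in>Basis. \<xi> i q * ext (g i) q) + (1 - ?h q * ?h q) * (f q - f p)))"
      using eq by (rule arg_cong)
    also have "\<dots> = (\<Sum>i\<in>Basis. v (\<lambda>q. \<xi> i q * ext (g i) q)) + v (\<lambda>q. (1 - ?h q * ?h q) * (f q - f p))"
      using sm by (simp add: ctangent_add[OF v] ctangent_sum[OF v] ctangent_const[OF v] smooth_map_intros smooth_map_sum smooth_\<xi> ext g(1))
    finally have "v f = (\<Sum>i\<in>Basis. v (\<lambda>q. \<xi> i q * ext (g i) q)) + v (\<lambda>q. (1 - ?h q * ?h q) * (f q - f p))" .
    moreover have "v (\<lambda>q. (1 - ?h q * ?h q) * (f q - f p)) = 0"
      using ctangent_mult[OF v sm] by (simp add: ext_p)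
    moreover have "v (\<lambda>q. \<xi> i q * ext (g i) q) = v (\<xi> i) * cd (U, x) f p i" for i
    proof -
      have "ext (g i) p = cd (U, x) f p i"
        by (simp add: ext_p g(2) cd_def k_def[abs_def])
      moreover have "\<xi> i p = 0" by (simp add: \<xi>_def ext_p)
      ultimately show ?thesis using ctangent_mult[OF v smooth_\<xi> ext[OF g(1)], of i i] by simp
    qed
    ultimately show "v f = (\<Sum>i\<in>Basis. v (\<xi> i) * cd (U, x) f p i)" by simp
  qed
qed

lemma coord_vec_eq_0:
  assumes "(U, x) \<in> A" "p \<in> U" "coord_vec (U, x) p a = 0"
  shows "a = 0"
proof -
  obtain \<xi> where \<xi>: "\<And>i. smooth_map A (\<xi> i)" "\<And>i a. cd (U, x) (\<xi> i) p a = complex_of_real (a \<bullet> i)"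
    by (rule cutoff_coordinates[OF assms(1,2)]) blast
  have "a \<bullet> i = 0" for i
    using fun_cong[OF assms(3), of "\<xi> i"] by (simp add: coord_vec_def \<xi>)
  then show ?thesis by (metis inner_eq_zero_iff)
qed

text \<open>Real and imaginary parts of the coefficients \<open>v (\<xi> i)\<close> are the
  coordinates of two real vectors, so every abstract derivation is a complexified coordinate
  derivative.\<close>

lemma ctangent_coord:
  assumes "(U, x) \<in> A" "p \<in> U" "v \<in> ctangent A p"
  obtains a b where "\<And>f. smooth_map A f \<Longrightarrow> v f = cd (U, x) f p a + \<i> * cd (U, x) f p b"
proof -
  obtain \<xi> :: "'e \<Rightarrow> 'a \<Rightarrow> complex" where \<xi>:
    "\<And>f. smooth_map A f \<Longrightarrow> v f = (\<Sum>i\<in>Basis. v (\<xi> i) * cd (U, x) f p i)"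
    by (rule cutoff_coordinates[OF assms(1,2)]) (use assms(3) in blast)
  show thesis
  proof (rule that[of "\<Sum>i\<in>Basis. Re (v (\<xi> i)) *\<^sub>R i" "\<Sum>i\<in>Basis. Im (v (\<xi> i)) *\<^sub>R i"])
    fix f :: "'a \<Rightarrow> complex" assume f: "smooth_map A f"
    have lin: "cd (U, x) f p (\<Sum>i\<in>Basis. c i *\<^sub>R i) = (\<Sum>i\<in>Basis. of_real (c i) * cd (U, x) f p i)" for c
      using cd_linear[OF f assms(1,2)] by (simp add: linear_sum linear_scale scaleR_conv_of_real)
    have "v (\<xi> i) * cd (U, x) f p i =
      of_real (Re (v (\<xi> i))) * cd (U, x) f p i + \<i> * (of_real (Im (v (\<xi> i))) * cd (U, x) f p i)" for i
      by (subst (1) complex_eq[of "v (\<xi> i)"]) (simp add: algebra_simps)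
    then show "v f = cd (U, x) f p (\<Sum>i\<in>Basis. Re (v (\<xi> i)) *\<^sub>R i) +
        \<i> * cd (U, x) f p (\<Sum>i\<in>Basis. Im (v (\<xi> i)) *\<^sub>R i)"
      by (simp add: \<xi>[OF f] lin sum.distrib sum_distrib_left)
  qed
qed

lemma real_tangent_coord:
  assumes "(U, x) \<in> A" "p \<in> U" "v \<in> ctangent A p" "cconj v = v"
  obtains a where "v = coord_vec (U, x) p a"
proof -
  obtain a b where ab: "\<And>f. smooth_map A f \<Longrightarrow> v f = cd (U, x) f p a + \<i> * cd (U, x) f p b"
    by (rule ctangent_coord[OF assms(1-3)]) blast
  have "v = coord_vec (U, x) p a"
  proof (rule ctangent_eqI[OF assms(3) coord_vec_ctangent[OF assms(1,2)]])
    fix f :: "'a \<Rightarrow> complex" assume f: "smooth_map A f"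
    have "v f = cnj (v (\<lambda>q. cnj (f q)))" using assms(4) by (metis cconj_def)
    also have "\<dots> = cd (U, x) f p a - \<i> * cd (U, x) f p b"
      using f by (simp add: ab smooth_map_cnj cd_bounded_linear[OF assms(1,2) f bounded_linear_cnj])
    finally show "v f = coord_vec (U, x) p a f" using ab[OF f] f by (simp add: coord_vec_def)
  qed
  then show thesis by (rule that)
qed

text \<open>A derivation is only known to respect sums and products. The chain rule, used for
  exponentials and polynomials, comes from its form in a chart.\<close>

lemma ctangent_chain:
  fixes u :: "'a \<Rightarrow> real" and h :: "real \<Rightarrow> complex"
  assumes v: "v \<in> ctangent A p" and u: "smooth_map A u"
    and h: "(h has_vector_derivative D) (at (u p))" and hu: "smooth_map A (\<lambda>q. h (u q))"
  shows "v (\<lambda>q. h (u q)) = D * v (\<lambda>q. of_real (u q))"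
proof -
  obtain U x where c: "(U, x) \<in> A" "p \<in> U" by (rule chart_exists)
  obtain a b where ab: "\<And>f. smooth_map A f \<Longrightarrow> v f = cd (U, x) f p a + \<i> * cd (U, x) f p b"
    by (rule ctangent_coord[OF c v]) blast
  have "((\<lambda>y. h (u (inv_into U x y))) has_derivative (\<lambda>a. cd (U, x) u p a *\<^sub>R D)) (at (x p))"
    by (rule has_derivative_compose[OF cd_has_derivative[OF u c], of h])
      (use h c in \<open>simp add: has_vector_derivative_def\<close>)
  then have "cd (U, x) (\<lambda>q. h (u q)) p a = D * cd (U, x) (\<lambda>q. complex_of_real (u q)) p a" for a
    by (simp add: cd_eq cd_bounded_linear[OF c u bounded_linear_of_real] scaleR_conv_of_real)
  then show ?thesis by (simp add: ab hu smooth_map_of_real[OF u] algebra_simps)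
qed

end

section \<open>Transversal CR structures\<close>

lemma cconj_cconj [simp]: "cconj (cconj v) = v"
  by (simp add: cconj_def)

lemma cconj_add: "cconj (v + w) = cconj v + cconj w"
  by (simp add: cconj_def fun_eq_iff)

lemma cconj_diff: "cconj (v - w) = cconj v - cconj w"
  by (simp add: cconj_def fun_eq_iff)

lemma cconj_cscale: "cconj (cscale c v) = cscale (cnj c) (cconj v)"
  by (simp add: cconj_def cscale_def fun_eq_iff)

lemma cconj_zero [simp]: "cconj 0 = 0"
  by (simp add: cconj_def fun_eq_iff)

lemma cvec_cnj: "v (\<lambda>q. cnj (f q)) = cnj (cconj v f)"
  by (simp add: cconj_def)

lemma cscale_apply: "cscale c v f = c * v f"
  by (simp add: cscale_def)

context manifold
begin

lemma cvector_fieldI: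
  "(\<And>p. V p \<in> ctangent A p) \<Longrightarrow> (\<And>f. smooth_map A f \<Longrightarrow> smooth_map A (\<lambda>p. V p f)) \<Longrightarrow> cvector_field A V"
  by (simp add: cvector_field_def)

lemma cvector_field_ctangent: "cvector_field A V \<Longrightarrow> V p \<in> ctangent A p"
  by (simp add: cvector_field_def)

lemma cvector_field_smooth: "cvector_field A V \<Longrightarrow> smooth_map A f \<Longrightarrow> smooth_map A (\<lambda>p. V p f)"
  by (simp add: cvector_field_def)

lemma cvector_field_add:
  "cvector_field A V \<Longrightarrow> cvector_field A W \<Longrightarrow> cvector_field A (\<lambda>p. V p + W p)"
  by (rule cvector_fieldI) (auto intro: plus_ctangent cvector_field_ctangent smooth_map_add cvector_field_smooth)

lemma cvector_field_cscale: "cvector_field A V \<Longrightarrow> cvector_field A (\<lambda>p. cscale c (V p))"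
  by (rule cvector_fieldI)
    (auto simp: cscale_apply intro: cscale_ctangent cvector_field_ctangent smooth_map_cmult cvector_field_smooth)

lemma cvector_field_cconj:
  assumes V: "cvector_field A V"
  shows "cvector_field A (\<lambda>p. cconj (V p))"
proof (rule cvector_fieldI)
  show "cconj (V p) \<in> ctangent A p" for p
    by (rule cconj_ctangent[OF cvector_field_ctangent[OF V]])
  show "smooth_map A (\<lambda>p. cconj (V p) f)" if "smooth_map A f" for f
    unfolding cconj_def by (intro smooth_map_cnj cvector_field_smooth[OF V] that)
qed

lemma cvector_field_zero: "cvector_field A (\<lambda>p. 0)"
  by (rule cvector_fieldI) auto

end

text \<open>The pointwise linear algebra of a transversal CR structure, in a form that deformations
  inherit. \<open>E_extension\<close> allows single vectors to be inserted in Cartan's formula,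
  which quantifies over global fields.\<close>

locale cr = manifold A
  for A :: "('a::{t2_space,second_countable_topology}, 'e::euclidean_space) chart set" +
  fixes E :: "'a \<Rightarrow> 'a cvec set" and T :: "'a \<Rightarrow> 'a cvec"
  assumes E_ctangent: "Z \<in> E p \<Longrightarrow> Z \<in> ctangent A p"
    and E_subspace: "cvs.subspace (E p)"
    and T_real: "real_vector_field A T"
    and decomposition: "v \<in> ctangent A p \<Longrightarrow> \<exists>Z\<in>E p. \<exists>W\<in>E p. \<exists>c. v = Z + cconj W + cscale c (T p)"
    and independence: "Z \<in> E p \<Longrightarrow> W \<in> E p \<Longrightarrow> Z + cconj W + cscale c (T p) = 0 \<Longrightarrow> Z = 0 \<and> W = 0 \<and> c = 0"
    and E_extension: "Z \<in> E p \<Longrightarrow> \<exists>V. cvector_field A V \<and> V p = Z"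
begin

lemma T_field: "cvector_field A T" and T_ctangent: "T p \<in> ctangent A p" and cconj_T [simp]: "cconj (T p) = T p"
  using T_real by (auto simp: real_vector_field_def real_tangent_def cvector_field_def)

lemma real_decomposition:
  assumes "v \<in> ctangent A p" "cconj v = v"
  obtains Z c where "Z \<in> E p" "v = Z + cconj Z + cscale (complex_of_real c) (T p)"
proof -
  obtain Z W c where ZW: "Z \<in> E p" "W \<in> E p" "v = Z + cconj W + cscale c (T p)"
    using decomposition[OF assms(1)] by blast
  have "cconj v = cconj Z + W + cscale (cnj c) (T p)"
    by (simp add: ZW(3) cconj_add cconj_cscale)
  then have 0: "(Z - W) + cconj (W - Z) + cscale (c - cnj c) (T p) = 0"
    using assms(2) ZW(3) by (simp add: fun_eq_iff cconj_diff cscale_apply algebra_simps)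
  have mem: "Z - W \<in> E p" "W - Z \<in> E p"
    by (intro cvs.subspace_diff[OF E_subspace] ZW)+
  have "Z - W = 0" "c - cnj c = 0" using independence[OF mem 0] by blast+
  then have "Z = W" "cnj c = c" by simp_all
  then have *: "W = Z" "c = of_real (Re c)" by (simp_all add: complex_eq_iff)
  show thesis by (rule that[OF ZW(1), of "Re c"]) (use ZW(3) * in simp)
qed

lemma deformed_eq: "deformed E T \<phi> p = (\<lambda>Z. Z - cscale (\<i> * Z (\<lambda>q. of_real (\<phi> q))) (T p)) ` E p"
  by (auto simp: deformed_def)

text \<open>Passing to \<open>deformed\<close> changes a vector of \<open>E\<close> only in its
  \<open>T\<close> component, so the decomposition and its uniqueness carry over after correcting
  the coefficient \<open>c\<close>.\<close>

lemma cr_deformed: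
  assumes \<phi>: "smooth_map A \<phi>" "\<And>p. T p (\<lambda>q. of_real (\<phi> q)) = 0"
  shows "cr A (deformed E T \<phi>) T"
proof
  let ?\<phi> = "\<lambda>q. complex_of_real (\<phi> q)"
  let ?d = "\<lambda>p Z. Z - cscale (\<i> * Z ?\<phi>) (T p)"
  have d_add: "?d p (Z + W) = ?d p Z + ?d p W" and d_scale: "?d p (cscale c Z) = cscale c (?d p Z)" for p Z W c
    by (simp_all add: fun_eq_iff cscale_apply algebra_simps)
  have cd: "cconj (?d p W) = cconj W - cscale (cnj (\<i> * W ?\<phi>)) (T p)" for p W
    by (simp add: cconj_diff cconj_cscale)
  show "Z \<in> ctangent A p" if Z: "Z \<in> deformed E T \<phi> p" for Z p
  proof -
    obtain Z' where "Z' \<in> E p" "Z = ?d p Z'" using Z unfolding deformed_eq by blast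
    then show ?thesis using diff_ctangent[OF E_ctangent cscale_ctangent[OF T_ctangent]] by blast
  qed
  show "cvs.subspace (deformed E T \<phi> p)" for p
  proof (rule cvs.subspaceI)
    show "0 \<in> deformed E T \<phi> p"
      unfolding deformed_eq by (rule image_eqI[of _ _ 0]) (auto simp: fun_eq_iff cscale_apply cvs.subspace_0[OF E_subspace])
    show "x + y \<in> deformed E T \<phi> p" if xy: "x \<in> deformed E T \<phi> p" "y \<in> deformed E T \<phi> p" for x y
    proof -
      obtain Z W where Z: "Z \<in> E p" "x = ?d p Z" and W: "W \<in> E p" "y = ?d p W"
        using xy unfolding deformed_eq by blast
      show ?thesis unfolding deformed_eq
        by (rule image_eqI[of _ _ "Z + W"]) (simp_all only: d_add Z(2) W(2) cvs.subspace_add[OF E_subspace Z(1) W(1)])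
    qed
    show "cscale c x \<in> deformed E T \<phi> p" if x: "x \<in> deformed E T \<phi> p" for c x
    proof -
      obtain Z where Z: "Z \<in> E p" "x = ?d p Z" using x unfolding deformed_eq by blast
      show ?thesis unfolding deformed_eq
        by (rule image_eqI[of _ _ "cscale c Z"]) (simp_all only: d_scale Z(2) cvs.subspace_scale[OF E_subspace Z(1)])
    qed
  qed
  show "real_vector_field A T" by (rule T_real)
  show "\<exists>Z\<in>deformed E T \<phi> p. \<exists>W\<in>deformed E T \<phi> p. \<exists>c. v = Z + cconj W + cscale c (T p)"
    if v: "v \<in> ctangent A p" for v p
  proof -
    obtain Z W c where ZW: "Z \<in> E p" "W \<in> E p" "v = Z + cconj W + cscale c (T p)"
      using decomposition[OF v] by blast
    have "v = ?d p Z + cconj (?d p W) + cscale (c + \<i> * Z ?\<phi> + cnj (\<i> * W ?\<phi>)) (T p)"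
      unfolding cd ZW(3) by (simp add: fun_eq_iff cscale_apply algebra_simps)
    then show ?thesis using ZW(1,2) unfolding deformed_eq by blast
  qed
  show "Z = 0 \<and> W = 0 \<and> c = 0"
    if Z: "Z \<in> deformed E T \<phi> p" and W: "W \<in> deformed E T \<phi> p" and eq: "Z + cconj W + cscale c (T p) = 0" for Z W c p
  proof -
    obtain Z' where Z': "Z' \<in> E p" "Z = ?d p Z'" using Z unfolding deformed_eq by blast
    obtain W' where W': "W' \<in> E p" "W = ?d p W'" using W unfolding deformed_eq by blast
    have "Z' + cconj W' + cscale (c - \<i> * Z' ?\<phi> - cnj (\<i> * W' ?\<phi>)) (T p) = 0"
      using eq unfolding Z'(2) W'(2) cd by (simp add: fun_eq_iff cscale_apply algebra_simps)
    then have 0: "Z' = 0 \<and> W' = 0 \<and> c - \<i> * Z' ?\<phi> - cnj (\<i> * W' ?\<phi>) = 0"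
      by (rule independence[OF Z'(1) W'(1)])
    then have "Z = 0" "W = 0" unfolding Z'(2) W'(2) by (auto simp: fun_eq_iff cscale_apply)
    then show ?thesis using 0 by auto
  qed
  show "\<exists>V. cvector_field A V \<and> V p = Z" if Z: "Z \<in> deformed E T \<phi> p" for Z p
  proof -
    obtain Z' where Z': "Z' \<in> E p" "Z = ?d p Z'" using Z unfolding deformed_eq by blast
    obtain V where V: "cvector_field A V" "V p = Z'" using E_extension[OF Z'(1)] by blast
    have "cvector_field A (\<lambda>q. V q + cscale (- (\<i> * Z' ?\<phi>)) (T q))"
      by (intro cvector_field_add V cvector_field_cscale T_field)
    moreover have "V p + cscale (- (\<i> * Z' ?\<phi>)) (T p) = Z"
      unfolding Z'(2) V(2) by (simp add: fun_eq_iff cscale_apply)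
    ultimately show ?thesis by blast
  qed
qed

end

lemma (in manifold) sasakian_cr:
  assumes "sasakian A n E T"
  shows "cr A E T"
proof
  have sub: "complex_subbundle A n E" and T: "real_vector_field A T" and tr: "transversal A E T"
    using assms by (auto simp: sasakian_def CR_structure_def)
  have subE: "E p \<subseteq> ctangent A p \<and> cvs.subspace (E p)" for p
    using sub by (simp add: complex_subbundle_def)
  have frame: "\<exists>U Z. open U \<and> p \<in> U \<and> (\<forall>i<n. cvector_field A (Z i)) \<and>
      (\<forall>q\<in>U. cvs.span ((\<lambda>i. Z i q) ` {..<n}) = E q)" for p
    using sub by (simp add: complex_subbundle_def)
  show "real_vector_field A T" by (rule T)
  show E: "Z \<in> ctangent A p" if "Z \<in> E p" for Z p
    using subE[of p] that by blast
  show sE: "cvs.subspace (E p)" for p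
    using subE by simp
  have tr': "\<exists>!(Z, W, c). Z \<in> E p \<and> W \<in> cconj ` E p \<and> v = Z + W + cscale c (T p)"
    if "v \<in> ctangent A p" for v p
    using tr that by (simp add: transversal_def)
  show "\<exists>Z\<in>E p. \<exists>W\<in>E p. \<exists>c. v = Z + cconj W + cscale c (T p)" if "v \<in> ctangent A p" for v p
    using ex1_implies_ex[OF tr'[OF that]] by auto
  show "Z = 0 \<and> W = 0 \<and> c = 0"
    if Z: "Z \<in> E p" and W: "W \<in> E p" and eq: "Z + cconj W + cscale c (T p) = 0" for Z W c p
  proof -
    \<comment> \<open>Uniqueness in \<open>transversal\<close> is applied to the zero
      vector.\<close>
    let ?P = "\<lambda>(Z, W, c). Z \<in> E p \<and> W \<in> cconj ` E p \<and> 0 = Z + W + cscale c (T p)"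
    have "?P (Z, cconj W, c)" using Z W eq by simp
    moreover have "0 \<in> cconj ` E p" by (rule image_eqI[of _ _ 0]) (auto simp: cvs.subspace_0[OF sE])
    then have "?P (0, 0, 0)" by (simp add: cvs.subspace_0[OF sE])
    ultimately have "(Z, cconj W, c) = (0, 0, 0)"
      using tr'[OF zero_ctangent, of p] by (metis (no_types, lifting))
    then show ?thesis using cconj_cconj[of W] by auto
  qed
  show "\<exists>V. cvector_field A V \<and> V p = Z" if "Z \<in> E p" for Z p
  proof -
    obtain U Zs where Zs: "\<forall>i<n. cvector_field A (Zs i)" "p \<in> U"
      "\<forall>q\<in>U. cvs.span ((\<lambda>i. Zs i q) ` {..<n}) = E q"
      using frame[of p] by blast
    \<comment> \<open>The values at \<open>p\<close> of global fields form a subspace; it contains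
      the frame at \<open>p\<close> and hence its span \<open>E p\<close>.\<close>
    let ?S = "{v. \<exists>V. cvector_field A V \<and> V p = v}"
    have "cvs.subspace ?S"
    proof (rule cvs.subspaceI)
      show "0 \<in> ?S" using cvector_field_zero by blast
      show "x + y \<in> ?S" if "x \<in> ?S" "y \<in> ?S" for x y
        using that cvector_field_add by fast
      show "cscale c x \<in> ?S" if "x \<in> ?S" for c x
        using that cvector_field_cscale by fast
    qed
    then have "cvs.span ((\<lambda>i. Zs i p) ` {..<n}) \<subseteq> ?S"
      by (rule cvs.span_minimal[rotated]) (use Zs(1) in auto)
    then show ?thesis using Zs(2,3) that by blast
  qed
qed

context cr
begin

text \<open>\<open>Z (\<lambda>q. cnj (f q))\<close> is the conjugate of \<open>cconj Z f\<close>,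
  so the last condition is the tangential Cauchy-Riemann equation. The middle one says that
  \<open>f\<close> rotates with speed \<open>b\<close> along integral curves of
  \<open>T\<close>.\<close>

definition cr_weight :: "real \<Rightarrow> ('a \<Rightarrow> complex) \<Rightarrow> bool" where
  "cr_weight b f \<longleftrightarrow> smooth_map A f \<and> (\<forall>p. T p f = \<i> * b * f p) \<and> (\<forall>p. \<forall>Z\<in>E p. Z (\<lambda>q. cnj (f q)) = 0)"

lemma cr_weight_smooth: "cr_weight b f \<Longrightarrow> smooth_map A f"
  and cr_weight_T: "cr_weight b f \<Longrightarrow> T p f = \<i> * b * f p"
  and cr_weight_E: "cr_weight b f \<Longrightarrow> Z \<in> E p \<Longrightarrow> Z (\<lambda>q. cnj (f q)) = 0"
  by (auto simp: cr_weight_def)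

lemma cr_weight_T_cnj: "cr_weight b f \<Longrightarrow> T p (\<lambda>q. cnj (f q)) = - \<i> * b * cnj (f p)"
  by (simp add: cvec_cnj cr_weight_T)

lemma cr_weight_cconj_E: "cr_weight b f \<Longrightarrow> Z \<in> E p \<Longrightarrow> cconj Z f = 0"
  using cr_weight_E[of b f Z p] by (simp add: cvec_cnj)

end

subsection \<open>Complex tangent vectors of Euclidean space\<close>

lemma smooth_atlas_std: "smooth_atlas (std_atlas :: ('b::euclidean_space, 'b) chart set)"
proof -
  have "homeomorphism UNIV UNIV (id :: 'b \<Rightarrow> 'b) id" by (simp add: homeomorphism_def)
  moreover have "smooth_on UNIV (id \<circ> inv_into UNIV (id :: 'b \<Rightarrow> 'b))"
    using smooth_on_id[OF open_UNIV, where ?'a = 'b] by (simp add: inv_id o_def id_def)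
  ultimately show ?thesis by (auto simp: smooth_atlas_def std_atlas_def)
qed

interpretation std: manifold "std_atlas :: ('b::euclidean_space, 'b) chart set"
  by unfold_locales (rule smooth_atlas_std)

lemma std_chart: "(UNIV, id) \<in> std_atlas"
  by (simp add: std_atlas_def)

lemma smooth_map_std: "smooth_map std_atlas g \<longleftrightarrow> smooth_on UNIV g"
  by (simp add: smooth_map_def std_atlas_def inv_id)

lemma std_cd: "std.cd (UNIV, id) g z = frechet_derivative g (at z)"
  by (simp add: std.cd_def inv_id)

lemma smooth_map_std_linear: "bounded_linear g \<Longrightarrow> smooth_map std_atlas g"
  by (simp add: smooth_map_std smooth_on_linear)

lemma bounded_linear_vec_nth_cnj: "bounded_linear (\<lambda>z :: complex ^ 'N. cnj (z $ j))"
  by (rule bounded_linear_compose[OF bounded_linear_cnj bounded_linear_vec_nth])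

lemma frechet_derivative_linear: "bounded_linear g \<Longrightarrow> frechet_derivative g (at z) = g"
  using frechet_derivative_at[OF bounded_linear_imp_has_derivative] by metis

lemma d_z_eq: "d_z j z = cscale (1/2) (std.coord_vec (UNIV, id) z (axis j 1) +
    cscale (- \<i>) (std.coord_vec (UNIV, id) z (axis j \<i>)))"
  by (simp add: d_z_def std.coord_vec_def std_cd fun_eq_iff cscale_apply)

lemma d_zbar_eq: "d_zbar j z = cscale (1/2) (std.coord_vec (UNIV, id) z (axis j 1) +
    cscale \<i> (std.coord_vec (UNIV, id) z (axis j \<i>)))"
  by (simp add: d_zbar_def std.coord_vec_def std_cd fun_eq_iff cscale_apply)

lemma d_z_ctangent: "d_z j z \<in> ctangent std_atlas z"
  unfolding d_z_eq by (intro std.cscale_ctangent std.plus_ctangent std.coord_vec_ctangent std_chart UNIV_I)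

lemma d_zbar_ctangent: "d_zbar j z \<in> ctangent std_atlas z"
  unfolding d_zbar_eq by (intro std.cscale_ctangent std.plus_ctangent std.coord_vec_ctangent std_chart UNIV_I)

lemma d_z_coord:
  "d_z k z (\<lambda>w. w $ j) = (if k = j then 1 else 0)" "d_z k z (\<lambda>w. cnj (w $ j)) = 0"
  "d_zbar k z (\<lambda>w. w $ j) = 0" "d_zbar k z (\<lambda>w. cnj (w $ j)) = (if k = j then 1 else 0)"
  by (auto simp: d_z_def d_zbar_def smooth_map_std_linear bounded_linear_vec_nth bounded_linear_vec_nth_cnj
      frechet_derivative_linear axis_def)

lemma std_ctangent_zero:
  fixes z :: "complex ^ 'N"
  assumes w: "w \<in> ctangent std_atlas z"
    and 0: "\<And>j. w (\<lambda>z. z $ j) = 0" "\<And>j. w (\<lambda>z. cnj (z $ j)) = 0"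
  shows "w = 0"
proof -
  obtain a b where ab: "\<And>f. smooth_map std_atlas f \<Longrightarrow>
      w f = std.cd (UNIV, id) f z a + \<i> * std.cd (UNIV, id) f z b"
    by (rule std.ctangent_coord[OF std_chart UNIV_I w]) blast
  have "a $ j = 0 \<and> b $ j = 0" for j
  proof -
    have 1: "a $ j + \<i> * b $ j = 0"
      using 0(1)[of j] ab[OF smooth_map_std_linear[OF bounded_linear_vec_nth[of j]]]
      by (simp add: std_cd frechet_derivative_linear[OF bounded_linear_vec_nth])
    have "cnj (a $ j) + \<i> * cnj (b $ j) = 0"
      using 0(2)[of j] ab[OF smooth_map_std_linear[OF bounded_linear_vec_nth_cnj[of j]]]
      by (simp add: std_cd frechet_derivative_linear[OF bounded_linear_vec_nth_cnj])
    then have "cnj (cnj (a $ j) + \<i> * cnj (b $ j)) = 0" by simp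
    then have 2: "a $ j - \<i> * b $ j = 0" by simp
    from 1 2 show ?thesis by (auto simp: complex_eq_iff)
  qed
  then have "a = 0" "b = 0" by (auto simp: vec_eq_iff)
  show ?thesis
  proof (rule std.ctangent_eqI[OF w std.zero_ctangent])
    fix f :: "complex ^ 'N \<Rightarrow> complex" assume f: "smooth_map std_atlas f"
    have "std.cd (UNIV, id) f z 0 = 0"
      using std.cd_linear[OF f std_chart UNIV_I] linear_0 by blast
    then show "w f = 0 f" using ab[OF f] \<open>a = 0\<close> \<open>b = 0\<close> by simp
  qed
qed

lemma std_ctangent_eqI:
  fixes z :: "complex ^ 'N"
  assumes "w \<in> ctangent std_atlas z" "w' \<in> ctangent std_atlas z"
    and "\<And>j. w (\<lambda>z. z $ j) = w' (\<lambda>z. z $ j)" "\<And>j. w (\<lambda>z. cnj (z $ j)) = w' (\<lambda>z. cnj (z $ j))"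
  shows "w = w'"
  using std_ctangent_zero[OF std.diff_ctangent[OF assms(1,2)]] assms(3,4) by simp

lemma sum_cvec_apply: "(\<Sum>i\<in>I. v i) f = (\<Sum>i\<in>I. (v i :: 'a cvec) f)"
  by (induction I rule: infinite_finite_induct) auto

lemma weighted_field_ctangent: "weighted_field \<beta> z \<in> ctangent std_atlas z"
  unfolding weighted_field_def
  by (intro std.cscale_ctangent std.sum_ctangent std.diff_ctangent d_z_ctangent d_zbar_ctangent)

lemma weighted_field_coord:
  "weighted_field \<beta> z (\<lambda>w. w $ j) = \<i> * \<beta> $ j * z $ j"
  "weighted_field \<beta> z (\<lambda>w. cnj (w $ j)) = - \<i> * \<beta> $ j * cnj (z $ j)"
  by (simp_all add: weighted_field_def sum_cvec_apply cscale_apply d_z_coord if_distrib sum.If_cases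
      if_distribR cong: if_cong)

text \<open>\<open>d_z\<close> and \<open>d_zbar\<close> are dual to the coordinates and their
  conjugates. The criterion turns a CR embedding into Cauchy-Riemann equations for the single
  components.\<close>

lemma T10_CN_iff:
  fixes z :: "complex ^ 'N"
  assumes w: "w \<in> ctangent std_atlas z"
  shows "w \<in> T10_CN z \<longleftrightarrow> (\<forall>j. w (\<lambda>z. cnj (z $ j)) = 0)"
proof
  have "cvs.subspace {w :: (complex ^ 'N) cvec. \<forall>j. w (\<lambda>z. cnj (z $ j)) = 0}"
    by (rule cvs.subspaceI) (auto simp: cscale_apply)
  then have "T10_CN z \<subseteq> {w. \<forall>j. w (\<lambda>z. cnj (z $ j)) = 0}"
    unfolding T10_CN_def by (rule cvs.span_minimal[rotated]) (auto simp: d_z_coord)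
  then show "\<forall>j. w (\<lambda>z. cnj (z $ j)) = 0" if "w \<in> T10_CN z" using that by blast
next
  assume 0: "\<forall>j. w (\<lambda>z. cnj (z $ j)) = 0"
  have "w = (\<Sum>j\<in>UNIV. cscale (w (\<lambda>z. z $ j)) (d_z j z))"
    by (rule std_ctangent_eqI[OF w])
      (use 0 in \<open>auto intro!: std.sum_ctangent std.cscale_ctangent d_z_ctangent
        simp: sum_cvec_apply cscale_apply d_z_coord if_distrib cong: if_cong\<close>)
  moreover have "(\<Sum>j\<in>UNIV. cscale (w (\<lambda>z. z $ j)) (d_z j z)) \<in> T10_CN z"
    unfolding T10_CN_def by (intro cvs.span_sum cvs.span_scale cvs.span_base) auto
  ultimately show "w \<in> T10_CN z" by simp
qed

section \<open>Weighted sphere maps\<close>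

lemma (in manifold) pushforward_ctangent:
  fixes F :: "'a \<Rightarrow> 'b::euclidean_space"
  assumes F: "smooth_map A F" and v: "v \<in> ctangent A p"
  shows "pushforward std_atlas F v \<in> ctangent std_atlas (F p)"
proof -
  have sm: "smooth_map A (\<lambda>q. g (F q))" if "smooth_map std_atlas g" for g :: "'b \<Rightarrow> complex"
    using that smooth_map_compose[OF open_UNIV _ F, of g] by (simp add: smooth_map_std)
  show ?thesis
  proof (rule std.ctangentI)
    fix f g :: "'b \<Rightarrow> complex" and c
    assume f: "smooth_map std_atlas f"
    show "pushforward std_atlas F v (\<lambda>q. c * f q) = c * pushforward std_atlas F v f"
      using f std.smooth_map_cmult[OF f, of c] ctangent_cmult[OF v sm[OF f], of c] by (simp add: pushforward_def o_def)
    assume g: "smooth_map std_atlas g"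
    show "pushforward std_atlas F v (\<lambda>q. f q + g q) = pushforward std_atlas F v f + pushforward std_atlas F v g"
      using f g std.smooth_map_add[OF f g] ctangent_add[OF v sm[OF f] sm[OF g]] by (simp add: pushforward_def o_def)
    show "pushforward std_atlas F v (\<lambda>q. f q * g q) = f (F p) * pushforward std_atlas F v g + pushforward std_atlas F v f * g (F p)"
      using f g std.smooth_map_mult[OF f g] ctangent_mult[OF v sm[OF f] sm[OF g]] by (simp add: pushforward_def o_def)
  qed (simp add: pushforward_def)
qed

lemma pushforward_coord:
  "pushforward std_atlas F v (\<lambda>z :: complex ^ 'N. z $ j) = v (\<lambda>q. F q $ j)"
  "pushforward std_atlas F v (\<lambda>z :: complex ^ 'N. cnj (z $ j)) = v (\<lambda>q. cnj (F q $ j))"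
  by (simp_all add: pushforward_def o_def smooth_map_std_linear bounded_linear_vec_nth bounded_linear_vec_nth_cnj)

text \<open>An embedding in terms of its components: \<open>immersion\<close> expresses that the
  pushforward has no kernel, \<open>separates\<close> that the map is injective.\<close>

locale cr_sphere = cr A E T
  for A :: "('a::{t2_space,second_countable_topology}, 'e::euclidean_space) chart set"
    and E :: "'a \<Rightarrow> 'a cvec set" and T :: "'a \<Rightarrow> 'a cvec" +
  fixes f :: "'N::finite \<Rightarrow> 'a \<Rightarrow> complex" and \<beta> :: "real ^ 'N"
  assumes \<beta>_pos: "\<beta> $ j > 0"
    and weight: "cr_weight (\<beta> $ j) (f j)"
    and unit: "(\<Sum>j\<in>UNIV. (cmod (f j p))\<^sup>2) = 1"
    and immersion: "v \<in> ctangent A p \<Longrightarrow> (\<And>j. v (f j) = 0) \<Longrightarrow> (\<And>j. v (\<lambda>q. cnj (f j q)) = 0) \<Longrightarrow> v = 0"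
    and separates: "(\<And>j. f j p = f j q) \<Longrightarrow> p = q"

lemma (in cr) cr_sphere_if_induced:
  fixes \<beta> :: "real ^ 'N"
  assumes "induced_by_weighted_sphere A \<beta> E T" and \<beta>: "\<And>j. \<beta> $ j > 0"
  obtains f where "cr_sphere A E T f \<beta>"
proof -
  obtain F :: "'a \<Rightarrow> complex ^ 'N" where emb: "CR_embedding A E F" and sph: "range F \<subseteq> sphere 0 1"
    and FT: "\<And>p. pushforward std_atlas F (T p) = weighted_field \<beta> (F p)"
    using assms(1) unfolding induced_by_weighted_sphere_def by blast
  have F: "smooth_map A F" and inj: "\<And>p. inj_on (pushforward std_atlas F) (ctangent A p)"
    and hom: "\<exists>G. homeomorphism UNIV (range F) F G"
    and CR: "\<And>p. pushforward std_atlas F ` E p = pushforward std_atlas F ` ctangent A p \<inter> T10_CN (F p)"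
    using emb by (auto simp: CR_embedding_def smooth_embedding_def)
  define f where "f j p = F p $ j" for j p
  have sm: "smooth_map A (f j)" for j
    using smooth_map_bounded_linear[OF bounded_linear_vec_nth[of j] F] by (simp add: f_def[abs_def])
  have "cr_sphere A E T f \<beta>"
  proof (unfold_locales)
    fix j show "\<beta> $ j > 0" by (rule \<beta>)
    show "cr_weight (\<beta> $ j) (f j)"
      unfolding cr_weight_def
    proof (intro conjI allI ballI sm)
      show "T p (f j) = \<i> * (\<beta> $ j) * f j p" for p
        using fun_cong[OF FT[of p], of "\<lambda>z. z $ j"]
        by (simp add: pushforward_coord weighted_field_coord f_def[abs_def])
      fix p Z assume Z: "Z \<in> E p"
      then have "pushforward std_atlas F Z \<in> T10_CN (F p)" using CR[of p] by blast
      then show "Z (\<lambda>q. cnj (f j q)) = 0"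
        using T10_CN_iff[OF pushforward_ctangent[OF F E_ctangent[OF Z]]]
        by (simp add: pushforward_coord f_def[abs_def])
    qed
  next
    fix p
    have "F p \<in> sphere 0 1" using sph by blast
    then have "(norm (F p))\<^sup>2 = 1" by (simp add: dist_norm)
    then show "(\<Sum>j\<in>UNIV. (cmod (f j p))\<^sup>2) = 1"
      by (simp add: norm_vec_def L2_set_def sum_nonneg f_def)
  next
    fix v p assume v: "v \<in> ctangent A p" and 0: "\<And>j. v (f j) = 0" "\<And>j. v (\<lambda>q. cnj (f j q)) = 0"
    have "pushforward std_atlas F v = 0"
      by (rule std_ctangent_zero[OF pushforward_ctangent[OF F v]])
        (use 0 in \<open>simp_all add: pushforward_coord f_def[abs_def]\<close>)
    moreover have "pushforward std_atlas F 0 = 0" by (simp add: pushforward_def fun_eq_iff)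
    ultimately show "v = 0" using inj_onD[OF inj[of p], of v 0] v by simp
  next
    fix p q assume "\<And>j. f j p = f j q"
    then have "F p = F q" by (simp add: f_def vec_eq_iff)
    then show "p = q" using hom by (auto simp: homeomorphism_def) metis
  qed
  then show thesis by (rule that)
qed

section \<open>Squared moduli of the components, and the way back to an embedding\<close>

context cr_sphere
begin

lemma f_smooth: "smooth_map A (f j)" and f_cnj_smooth: "smooth_map A (\<lambda>q. cnj (f j q))"
  using cr_weight_smooth[OF weight[of j]] by (simp_all add: smooth_map_cnj)

lemma T_f: "T p (f j) = \<i> * \<beta> $ j * f j p" and T_f_cnj: "T p (\<lambda>q. cnj (f j q)) = - \<i> * \<beta> $ j * cnj (f j p)"
  using cr_weight_T[OF weight] cr_weight_T_cnj[OF weight] by auto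

lemma E_f_cnj: "Z \<in> E p \<Longrightarrow> Z (\<lambda>q. cnj (f j q)) = 0"
  using cr_weight_E[OF weight] .

definition x :: "'N \<Rightarrow> 'a \<Rightarrow> real" where "x j p = (cmod (f j p))\<^sup>2"

lemma of_real_x: "complex_of_real (x j p) = f j p * cnj (f j p)"
  unfolding x_def by (rule complex_norm_square)

lemma x_smooth: "smooth_map A (x j)"
proof -
  have "smooth_map A (\<lambda>q. Re (f j q * cnj (f j q)))"
    by (intro smooth_map_Re smooth_map_mult f_smooth f_cnj_smooth)
  then show ?thesis by (simp add: of_real_x[symmetric])
qed

lemma x_nonneg: "x j p \<ge> 0" by (simp add: x_def)

lemma x_sum: "(\<Sum>j\<in>UNIV. x j p) = 1" using unit by (simp add: x_def)

lemma x_le_1: "x j p \<le> 1"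
  using member_le_sum[of j UNIV "\<lambda>j. x j p"] x_sum[of p] x_nonneg by simp

lemma f_le_1: "cmod (f j p) \<le> 1"
  using x_le_1[of j p] by (simp add: x_def power2_le_iff_abs_le power_le_one_iff abs_le_square_iff)

lemma ctangent_x: "v \<in> ctangent A p \<Longrightarrow>
    v (\<lambda>q. complex_of_real (x j q)) = v (f j) * cnj (f j p) + f j p * v (\<lambda>q. cnj (f j q))"
  unfolding of_real_x by (subst ctangent_mult) (auto simp: f_smooth f_cnj_smooth)

lemma T_x: "T p (\<lambda>q. complex_of_real (x j q)) = 0"
  by (simp add: ctangent_x[OF T_ctangent] T_f T_f_cnj)

lemma E_x: "Z \<in> E p \<Longrightarrow> Z (\<lambda>q. complex_of_real (x j q)) = cnj (f j p) * Z (f j)"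
  by (simp add: ctangent_x[OF E_ctangent] E_f_cnj)

lemma ctangent_sum_x:
  assumes "v \<in> ctangent A p"
  shows "(\<Sum>j\<in>UNIV. v (\<lambda>q. complex_of_real (x j q))) = 0"
proof -
  have "(\<Sum>j\<in>UNIV. v (\<lambda>q. complex_of_real (x j q))) = v (\<lambda>q. \<Sum>j\<in>UNIV. complex_of_real (x j q))"
    by (rule ctangent_sum[OF assms, symmetric]) (auto intro: smooth_map_of_real x_smooth)
  also have "(\<lambda>q. \<Sum>j\<in>UNIV. complex_of_real (x j q)) = (\<lambda>q. 1)"
    by (simp only: of_real_sum[symmetric] x_sum of_real_1)
  finally show ?thesis using ctangent_const[OF assms] by simp
qed

text \<open>The value on \<open>T\<close> of the standard contact form pulled back from the
  sphere.\<close>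

definition B :: "'a \<Rightarrow> real" where "B p = (\<Sum>j\<in>UNIV. \<beta> $ j * x j p)"

lemma B_smooth: "smooth_map A B"
  unfolding B_def[abs_def] by (intro smooth_map_sum smooth_map_cmult x_smooth) auto

lemma B_pos: "B p > 0"
proof -
  obtain j where "x j p \<noteq> 0" using x_sum[of p] by (metis sum.neutral zero_neq_one)
  then have "\<beta> $ j * x j p > 0" using x_nonneg[of j p] \<beta>_pos[of j] by simp
  then show ?thesis unfolding B_def
    using x_nonneg \<beta>_pos by (intro sum_pos2[of UNIV j]) (simp_all add: less_imp_le)
qed

text \<open>Such a vector would change each \<open>x j\<close> by
  \<open>c * \<beta> $ j * x j\<close>, hence their sum, which is constantly 1, by
  \<open>c * B p\<close> with \<open>B p > 0\<close>.\<close>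

lemma T_coefficient_zero:
  fixes c :: complex
  assumes v: "v \<in> ctangent A p" and c: "\<And>j. v (f j) = c * \<beta> $ j * f j p" "\<And>j. v (\<lambda>q. cnj (f j q)) = 0"
  shows "c = 0"
proof -
  have "0 = (\<Sum>j\<in>UNIV. c * (complex_of_real (\<beta> $ j) * of_real (x j p)))"
    using ctangent_sum_x[OF v] unfolding ctangent_x[OF v] c by (simp add: of_real_x mult_ac)
  also have "\<dots> = c * of_real (B p)" by (simp add: B_def sum_distrib_left)
  finally show ?thesis using B_pos[of p] by simp
qed

text \<open>Compactness turns the injective continuous map into a homeomorphism onto its image; the
  point that takes work is that only vectors of \<open>E\<close> are mapped to type (1,0).\<close>

lemma induced:
  assumes "compact (UNIV :: 'a set)"
  shows "induced_by_weighted_sphere A \<beta> E T"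
proof -
  define F :: "'a \<Rightarrow> complex ^ 'N" where "F p = (\<chi> j. f j p)" for p
  have F: "smooth_map A F"
  proof -
    have "bounded_linear (axis j :: complex \<Rightarrow> complex ^ 'N)" for j
      unfolding linear_conv_bounded_linear[symmetric]
      by (rule linearI) (simp_all add: axis_def vec_eq_iff)
    then have "smooth_map A (\<lambda>p. \<Sum>j\<in>UNIV. axis j (f j p))"
      by (intro smooth_map_sum smooth_map_bounded_linear[OF _ f_smooth]) simp_all
    moreover have "F = (\<lambda>p. \<Sum>j\<in>UNIV. axis j (f j p))"
      by (simp add: fun_eq_iff F_def vec_eq_iff axis_def)
    ultimately show ?thesis by simp
  qed
  have push: "pushforward std_atlas F v (\<lambda>z. z $ j) = v (f j)"
    "pushforward std_atlas F v (\<lambda>z. cnj (z $ j)) = v (\<lambda>q. cnj (f j q))" for v j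
    by (simp_all add: pushforward_coord F_def)
  have inj: "inj_on (pushforward std_atlas F) (ctangent A p)" for p
  proof (rule inj_onI)
    fix v w assume vw: "v \<in> ctangent A p" "w \<in> ctangent A p" "pushforward std_atlas F v = pushforward std_atlas F w"
    have "v (f j) = w (f j)" "v (\<lambda>q. cnj (f j q)) = w (\<lambda>q. cnj (f j q))" for j
      unfolding push[symmetric] vw(3) by (rule refl)+
    then have "v - w = 0"
      by (intro immersion[OF diff_ctangent[OF vw(1,2)]])
        simp_all
    then show "v = w" by simp
  qed
  have injF: "inj F" using separates by (auto simp: inj_on_def F_def vec_eq_iff)
  have hom: "\<exists>G. homeomorphism UNIV (range F) F G"
    using homeomorphism_compact[OF assms smooth_map_continuous[OF F] _ injF] by auto
  have CR: "pushforward std_atlas F ` E p = pushforward std_atlas F ` ctangent A p \<inter> T10_CN (F p)" for p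
  proof (intro equalityI subsetI)
    fix w assume "w \<in> pushforward std_atlas F ` E p"
    then obtain Z where Z: "Z \<in> E p" "w = pushforward std_atlas F Z" by blast
    then show "w \<in> pushforward std_atlas F ` ctangent A p \<inter> T10_CN (F p)"
      using T10_CN_iff[OF pushforward_ctangent[OF F E_ctangent[OF Z(1)]]] E_ctangent[OF Z(1)] E_f_cnj[OF Z(1)]
      by (auto simp: push)
  next
    fix w assume "w \<in> pushforward std_atlas F ` ctangent A p \<inter> T10_CN (F p)"
    then obtain v where v: "v \<in> ctangent A p" "w = pushforward std_atlas F v" "w \<in> T10_CN (F p)" by blast
    then have 0: "v (\<lambda>q. cnj (f j q)) = 0" for j
      using T10_CN_iff[OF pushforward_ctangent[OF F v(1)]] by (simp add: push)
    obtain Z W c where ZW: "Z \<in> E p" "W \<in> E p" "v = Z + cconj W + cscale c (T p)"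
      using decomposition[OF v(1)] by blast
    \<comment> \<open>\<open>Z\<close> is already mapped to a (1,0) vector, so the rest of
      \<open>v\<close> has to vanish. It annihilates all conjugated components and multiplies
      \<open>f j\<close> by a constant times \<open>\<beta> $ j\<close>;
      \<open>T_coefficient_zero\<close> gives \<open>c = 0\<close>, and the immersion property does
      the rest.\<close>
    have u: "cconj W + cscale c (T p) \<in> ctangent A p"
      by (intro plus_ctangent cconj_ctangent cscale_ctangent T_ctangent E_ctangent[OF ZW(2)])
    have u0: "(cconj W + cscale c (T p)) (\<lambda>q. cnj (f j q)) = 0" for j
      using 0[of j] E_f_cnj[OF ZW(1)] unfolding ZW(3) by simp
    have u1: "(cconj W + cscale c (T p)) (f j) = (c * \<i>) * \<beta> $ j * f j p" for j
      using cr_weight_cconj_E[OF weight ZW(2)] by (simp add: cscale_apply T_f)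
    have c: "c = 0" using T_coefficient_zero[OF u u1 u0] by simp
    have "cconj W + cscale c (T p) = 0"
      by (rule immersion[OF u _ u0]) (use u1 c in simp)
    then have "v = Z" using ZW(3) by (simp add: add.assoc)
    then show "w \<in> pushforward std_atlas F ` E p" using v(2) ZW(1) by blast
  qed
  have "norm (F p) = 1" for p
    using unit[of p] by (simp add: norm_vec_def L2_set_def F_def)
  moreover have "pushforward std_atlas F (T p) = weighted_field \<beta> (F p)" for p
    by (rule std_ctangent_eqI[OF pushforward_ctangent[OF F T_ctangent] weighted_field_ctangent])
      (simp_all add: push T_f T_f_cnj weighted_field_coord F_def)
  ultimately show ?thesis
    unfolding induced_by_weighted_sphere_def CR_embedding_def smooth_embedding_def
    using F inj hom CR by (intro exI[of _ F]) auto
qed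

end

section \<open>Strict pseudoconvexity\<close>

lemma diff_cnj: "w - cnj w = 2 * \<i> * of_real (Im w)"
  by (simp add: complex_eq_iff)

text \<open>The Levi form of the deformed structure, as computed in \<open>ext_deriv_one_form\<close> below, in terms of the values
  \<open>z j = Z (f j)\<close>, \<open>F j = f j p\<close>, \<open>d j = Z (a j)\<close> and \<open>s = Z (h)\<close>.\<close>
lemma levi_estimate:
  fixes z F d e :: "'N::finite \<Rightarrow> complex" and a \<beta> :: "'N \<Rightarrow> real" and s :: complex and b \<delta> N :: real
  assumes \<beta>: "\<And>j. 0 \<le> \<beta> j" "b = (\<Sum>j\<in>UNIV. \<beta> j)" and F: "\<And>j. cmod (F j) \<le> 1"
    and N: "N > 0" "N\<^sup>2 = (\<Sum>j\<in>UNIV. (cmod (z j))\<^sup>2)"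
    and \<delta>: "\<delta> \<ge> 0" "\<delta> \<le> 1" "\<delta> * (b + CARD('N) * (6 * b * (1/2 + b) + (1 + 2 * b) * b)) < 1/2"
    and s: "cmod s \<le> \<delta> * N" and d: "\<And>j. cmod (d j) \<le> 6 * b * \<delta> * N"
    and a: "\<And>j. \<bar>a j - 1\<bar> \<le> 2 * b * \<delta>"
    and e: "\<And>j. e j = (cnj (F j) * z j + 2 * s * \<beta> j * (F j * cnj (F j))) / (2 * \<i>)"
  shows "\<exists>L>0. 1 / (2 * \<i>) * (\<Sum>j\<in>UNIV. d j * cnj (e j) - cnj (d j) * e j
      + a j * ((- s * \<beta> j * cnj (F j)) * cnj (- s * \<beta> j * cnj (F j))
      - (z j + s * \<beta> j * F j) * cnj (z j + s * \<beta> j * F j)) / \<i>) = complex_of_real L"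
proof -
  define l where "l j = Im (d j * cnj (e j)) + a j * ((cmod (z j))\<^sup>2 / 2 + Re (cnj s * \<beta> j * cnj (F j) * z j))" for j
  have summand: "1 / (2 * \<i>) * (d j * cnj (e j) - cnj (d j) * e j
      + a j * ((- s * \<beta> j * cnj (F j)) * cnj (- s * \<beta> j * cnj (F j))
      - (z j + s * \<beta> j * F j) * cnj (z j + s * \<beta> j * F j)) / \<i>) = complex_of_real (l j)" for j
  proof -
    have 1: "d j * cnj (e j) - cnj (d j) * e j = 2 * \<i> * of_real (Im (d j * cnj (e j)))"
      using diff_cnj[of "d j * cnj (e j)"] by simp
    \<comment> \<open>The squares of \<open>s * \<beta> j * F j\<close> cancel, so besides the
      square of \<open>z j\<close> only a term of first order in \<open>s\<close> remains.\<close>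
    have 2: "(- s * \<beta> j * cnj (F j)) * cnj (- s * \<beta> j * cnj (F j))
      - (z j + s * \<beta> j * F j) * cnj (z j + s * \<beta> j * F j)
      = - (z j * cnj (z j) + (cnj s * \<beta> j * cnj (F j) * z j + cnj (cnj s * \<beta> j * cnj (F j) * z j)))"
      by (simp add: algebra_simps)
    have 3: "z j * cnj (z j) + (cnj s * \<beta> j * cnj (F j) * z j + cnj (cnj s * \<beta> j * cnj (F j) * z j))
      = complex_of_real ((cmod (z j))\<^sup>2 + 2 * Re (cnj s * \<beta> j * cnj (F j) * z j))"
      by (simp only: complex_norm_square[symmetric] complex_add_cnj of_real_add)
    show ?thesis unfolding 1 2 3 l_def by (simp add: field_simps)
  qed
  have b: "b \<ge> 0" unfolding \<beta>(2) by (rule sum_nonneg) (rule \<beta>(1))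
  have \<beta>b: "\<beta> j \<le> b" for j unfolding \<beta>(2) by (rule member_le_sum) (auto simp: \<beta>(1))
  have zN: "cmod (z j) \<le> N" for j
  proof -
    have "(cmod (z j))\<^sup>2 \<le> N\<^sup>2" unfolding N(2) by (rule member_le_sum) auto
    then show ?thesis using N(1) by (simp add: power2_le_iff_abs_le)
  qed
  have eN: "cmod (e j) \<le> (1/2 + b) * N" for j
  proof -
    have "cmod (2 * s * \<beta> j * (F j * cnj (F j))) = 2 * (cmod s * \<beta> j * (cmod (F j) * cmod (F j)))"
      using \<beta>(1) by (simp add: norm_mult)
    also have "\<dots> \<le> 2 * ((1 * N) * b * (1 * 1))"
    proof -
      have "cmod s \<le> 1 * N" using s \<delta> N(1) by (meson less_imp_le mult_right_mono order_trans)
      then show ?thesis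
        by (intro mult_left_mono mult_mono \<beta>b F) (use \<beta>(1) b N(1) in \<open>auto\<close>)
    qed
    finally have 1: "cmod (2 * s * \<beta> j * (F j * cnj (F j))) \<le> 2 * (N * b)" by simp
    have 2: "cmod (cnj (F j) * z j) \<le> 1 * N"
      unfolding norm_mult complex_mod_cnj by (intro mult_mono F zN) auto
    have "cmod (e j) \<le> (N + 2 * (N * b)) / 2"
      unfolding e norm_divide using 1 2 norm_triangle_ineq[of "cnj (F j) * z j" "2 * s * \<beta> j * (F j * cnj (F j))"]
      by (simp add: norm_mult)
    then show ?thesis by (simp add: algebra_simps)
  qed
  \<comment> \<open>The factor of the square is the lower bound for \<open>a j\<close>. The error
    collects two products: \<open>d j\<close> against \<open>e j\<close>, giving
    \<open>6 * b\<close> times \<open>1/2 + b\<close>, and \<open>a j\<close>, at most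
    \<open>1 + 2 * b\<close>, against the mixed term with its factor \<open>b\<close>.\<close>
  have lj: "l j \<ge> (1 - 2 * b * \<delta>) * ((cmod (z j))\<^sup>2 / 2) - (6 * b * (1/2 + b) + (1 + 2 * b) * b) * \<delta> * N\<^sup>2" for j
  proof -
    have "\<bar>Im (d j * cnj (e j))\<bar> \<le> cmod (d j) * cmod (e j)"
      using abs_Im_le_cmod[of "d j * cnj (e j)"] by (simp add: norm_mult)
    also have "\<dots> \<le> (6 * b * \<delta> * N) * ((1/2 + b) * N)"
      by (intro mult_mono d eN) (use b \<delta> N(1) in auto)
    finally have 1: "\<bar>Im (d j * cnj (e j))\<bar> \<le> 6 * b * (1/2 + b) * \<delta> * N\<^sup>2"
      by (simp add: power2_eq_square mult_ac)
    have "\<bar>Re (cnj s * \<beta> j * cnj (F j) * z j)\<bar> \<le> cmod s * \<beta> j * cmod (F j) * cmod (z j)"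
      using abs_Re_le_cmod[of "cnj s * \<beta> j * cnj (F j) * z j"] \<beta>(1) by (simp add: norm_mult)
    also have "\<dots> \<le> (\<delta> * N) * b * 1 * N"
      by (intro mult_mono s \<beta>b F zN) (use b \<delta> N(1) \<beta>(1) in auto)
    finally have 2: "\<bar>Re (cnj s * \<beta> j * cnj (F j) * z j)\<bar> \<le> b * \<delta> * N\<^sup>2"
      by (simp add: power2_eq_square mult_ac)
    have "\<bar>a j\<bar> \<le> 1 + 2 * b"
      using a[of j] mult_left_mono[OF \<delta>(2), of "2 * b"] b by simp
    then have "\<bar>a j * Re (cnj s * \<beta> j * cnj (F j) * z j)\<bar> \<le> (1 + 2 * b) * (b * \<delta> * N\<^sup>2)"
      unfolding abs_mult by (intro mult_mono 2) (use b in auto)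
    moreover have "a j * ((cmod (z j))\<^sup>2 / 2) \<ge> (1 - 2 * b * \<delta>) * ((cmod (z j))\<^sup>2 / 2)"
      by (rule mult_right_mono) (use a[of j] in auto)
    ultimately show ?thesis using 1 unfolding l_def by (simp add: distrib_left distrib_right)
  qed
  have "(\<Sum>j\<in>UNIV. l j) \<ge> (\<Sum>j\<in>(UNIV :: 'N set). (1 - 2 * b * \<delta>) * ((cmod (z j))\<^sup>2 / 2) - (6 * b * (1/2 + b) + (1 + 2 * b) * b) * \<delta> * N\<^sup>2)"
    by (rule sum_mono) (rule lj)
  also have "(\<Sum>j\<in>(UNIV :: 'N set). (1 - 2 * b * \<delta>) * ((cmod (z j))\<^sup>2 / 2) - (6 * b * (1/2 + b) + (1 + 2 * b) * b) * \<delta> * N\<^sup>2)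
      = (1 - 2 * b * \<delta>) * (N\<^sup>2 / 2) - CARD('N) * ((6 * b * (1/2 + b) + (1 + 2 * b) * b) * \<delta> * N\<^sup>2)"
    by (simp add: sum_subtractf sum_distrib_left[symmetric] sum_divide_distrib[symmetric] N(2))
  also have "\<dots> = N\<^sup>2 * (1/2 - \<delta> * (b + CARD('N) * (6 * b * (1/2 + b) + (1 + 2 * b) * b)))"
    by (simp add: field_simps)
  finally have "(\<Sum>j\<in>UNIV. l j) > 0"
    using N(1) \<delta>(3) by (smt (verit) mult_pos_pos zero_less_power)
  moreover have "1 / (2 * \<i>) * (\<Sum>j\<in>UNIV. d j * cnj (e j) - cnj (d j) * e j
      + a j * ((- s * \<beta> j * cnj (F j)) * cnj (- s * \<beta> j * cnj (F j))
      - (z j + s * \<beta> j * F j) * cnj (z j + s * \<beta> j * F j)) / \<i>) = complex_of_real (\<Sum>j\<in>UNIV. l j)"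
    unfolding sum_distrib_left of_real_sum by (rule sum.cong[OF refl]) (rule summand)
  ultimately show ?thesis by blast
qed

section \<open>Contact forms built from a sphere map, and their Levi forms\<close>

context cr_sphere
begin

text \<open>On real vectors this is the imaginary part of \<open>cnj (f j p) * v (f j)\<close>, that
  is \<open>x j\<close> times the differential of the argument of \<open>f j\<close> where
  \<open>f j\<close> is not 0. The sum over \<open>j\<close> is the pullback of the standard contact
  form of the sphere.\<close>

definition eta :: "'N \<Rightarrow> 'a \<Rightarrow> 'a cvec \<Rightarrow> complex" where
  "eta j p v = (1 / (2 * \<i>)) * (cnj (f j p) * v (f j) - f j p * v (\<lambda>q. cnj (f j q)))"

definition one_form :: "('N \<Rightarrow> 'a \<Rightarrow> real) \<Rightarrow> 'a \<Rightarrow> 'a cvec \<Rightarrow> complex" where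
  "one_form a p v = (\<Sum>j\<in>UNIV. of_real (a j p) * eta j p v)"

lemma eta_add: "eta j p (v + w) = eta j p v + eta j p w"
  by (simp add: eta_def algebra_simps)

lemma eta_cscale: "eta j p (cscale c v) = c * eta j p v"
  by (simp add: eta_def cscale_apply algebra_simps)

lemma eta_cconj: "eta j p (cconj v) = cnj (eta j p v)"
  by (simp add: eta_def cconj_def algebra_simps)

lemma eta_smooth:
  assumes V: "cvector_field A V"
  shows "smooth_map A (\<lambda>p. eta j p (V p))"
  unfolding eta_def
  by (rule smooth_map_cmult, rule smooth_map_diff)
    (rule smooth_map_mult[OF f_cnj_smooth cvector_field_smooth[OF V f_smooth]],
     rule smooth_map_mult[OF f_smooth cvector_field_smooth[OF V f_cnj_smooth]])

lemma one_form_add: "one_form a p (v + w) = one_form a p v + one_form a p w"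
  by (simp add: one_form_def eta_add algebra_simps sum.distrib)

lemma one_form_cscale: "one_form a p (cscale c v) = c * one_form a p v"
  by (simp add: one_form_def eta_cscale sum_distrib_left mult_ac)

lemma one_form_cconj: "one_form a p (cconj v) = cnj (one_form a p v)"
  by (simp add: one_form_def eta_cconj)

lemma real_one_form_one_form:
  assumes "\<And>j. smooth_map A (a j)"
  shows "real_one_form A (one_form a)"
proof -
  have "smooth_map A (\<lambda>p. one_form a p (V p))" if "cvector_field A V" for V
    unfolding one_form_def
    by (intro smooth_map_sum smooth_map_mult smooth_map_of_real assms eta_smooth that) auto
  then show ?thesis
    unfolding real_one_form_def by (simp add: one_form_add one_form_cscale one_form_cconj)
qed

lemma one_form_derivative:
  assumes a: "\<And>j. smooth_map A (a j)" and v: "v \<in> ctangent A p" and W: "cvector_field A W"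
  shows "v (\<lambda>q. one_form a q (W q)) = (\<Sum>j\<in>UNIV. v (\<lambda>q. of_real (a j q)) * eta j p (W p)
    + of_real (a j p) * ((v (\<lambda>q. cnj (f j q)) * W p (f j) + cnj (f j p) * v (\<lambda>q. W q (f j))
      - v (f j) * W p (\<lambda>q. cnj (f j q)) - f j p * v (\<lambda>q. W q (\<lambda>q. cnj (f j q)))) / (2 * \<i>)))"
proof -
  have sW: "smooth_map A (\<lambda>q. W q (f j))" "smooth_map A (\<lambda>q. W q (\<lambda>q. cnj (f j q)))" for j
    by (rule cvector_field_smooth[OF W f_smooth], rule cvector_field_smooth[OF W f_cnj_smooth])
  have sa: "smooth_map A (\<lambda>q. complex_of_real (a j q))" for j by (rule smooth_map_of_real[OF a])
  have p1: "smooth_map A (\<lambda>q. cnj (f j q) * W q (f j))" "smooth_map A (\<lambda>q. f j q * W q (\<lambda>q. cnj (f j q)))" for j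
    by (rule smooth_map_mult[OF f_cnj_smooth sW(1)], rule smooth_map_mult[OF f_smooth sW(2)])
  have "v (\<lambda>q. eta j q (W q)) = (v (\<lambda>q. cnj (f j q)) * W p (f j) + cnj (f j p) * v (\<lambda>q. W q (f j))
      - v (f j) * W p (\<lambda>q. cnj (f j q)) - f j p * v (\<lambda>q. W q (\<lambda>q. cnj (f j q)))) / (2 * \<i>)" for j
    unfolding eta_def ctangent_cmult[OF v smooth_map_diff[OF p1]] ctangent_diff[OF v p1]
      ctangent_mult[OF v f_cnj_smooth sW(1)] ctangent_mult[OF v f_smooth sW(2)]
    by (simp add: field_simps)
  then show ?thesis
    unfolding one_form_def
    by (subst ctangent_sum[OF v])
      (simp_all add: smooth_map_mult[OF sa eta_smooth[OF W]] ctangent_mult[OF v sa eta_smooth[OF W]] add.commute)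
qed

text \<open>Second order terms cancel against the bracket, so Cartan's expression depends only on
  the values \<open>v\<close> and \<open>w\<close>; this satisfies the description by
  \<open>THE\<close>, and the given fields \<open>V\<close>, \<open>W\<close> make it unique. The
  result is \<open>da j\<close> wedge \<open>eta j\<close> plus \<open>a j\<close> times the
  differential of \<open>eta j\<close>, summed over \<open>j\<close>.\<close>

lemma ext_deriv_one_form:
  assumes a: "\<And>j. smooth_map A (a j)" and V: "cvector_field A V" "V p = v" and W: "cvector_field A W" "W p = w"
  shows "ext_deriv A (one_form a) p v w = (\<Sum>j\<in>UNIV. v (\<lambda>q. of_real (a j q)) * eta j p w - w (\<lambda>q. of_real (a j q)) * eta j p v
    + of_real (a j p) * (v (\<lambda>q. cnj (f j q)) * w (f j) - v (f j) * w (\<lambda>q. cnj (f j q))) / \<i>)" (is "_ = ?R v w")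
proof -
  have eq: "V p (\<lambda>q. one_form a q (W q)) - W p (\<lambda>q. one_form a q (V q)) - one_form a p (lie_bracket V W p) = ?R (V p) (W p)"
    if VW: "cvector_field A V" "cvector_field A W" for V W
    unfolding one_form_derivative[OF a cvector_field_ctangent[OF VW(1)] VW(2)]
      one_form_derivative[OF a cvector_field_ctangent[OF VW(2)] VW(1)]
    unfolding one_form_def sum_subtractf[symmetric]
    by (rule sum.cong[OF refl]) (simp add: eta_def lie_bracket_def field_simps)
  show ?thesis
    unfolding ext_deriv_def
  proof (rule the_equality)
    show "\<forall>V W. cvector_field A V \<and> cvector_field A W \<and> V p = v \<and> W p = w \<longrightarrow>
      ?R v w = V p (\<lambda>q. one_form a q (W q)) - W p (\<lambda>q. one_form a q (V q)) - one_form a p (lie_bracket V W p)"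
    proof (intro allI impI, elim conjE)
      fix V W assume VW: "cvector_field A V" "cvector_field A W" "V p = v" "W p = w"
      show "?R v w = V p (\<lambda>q. one_form a q (W q)) - W p (\<lambda>q. one_form a q (V q)) - one_form a p (lie_bracket V W p)"
        using eq[OF VW(1,2)] unfolding VW(3,4) by (rule sym)
    qed
    show "c = ?R v w" if "\<forall>V W. cvector_field A V \<and> cvector_field A W \<and> V p = v \<and> W p = w \<longrightarrow>
      c = V p (\<lambda>q. one_form a q (W q)) - W p (\<lambda>q. one_form a q (V q)) - one_form a p (lie_bracket V W p)" for c
    proof -
      have "c = V p (\<lambda>q. one_form a q (W q)) - W p (\<lambda>q. one_form a q (V q)) - one_form a p (lie_bracket V W p)"
        using that V W by blast
      then show ?thesis using eq[OF V(1) W(1)] unfolding V(2) W(2) by (rule trans)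
    qed
  qed
qed

lemma ctangent_poly_x:
  assumes "v \<in> ctangent A p"
  shows "v (\<lambda>q. complex_of_real (poly P (x k q))) = of_real (poly (pderiv P) (x k p)) * v (\<lambda>q. of_real (x k q))"
proof (rule ctangent_chain[OF assms x_smooth])
  have "(poly P has_vector_derivative poly (pderiv P) (x k p)) (at (x k p))"
    using poly_DERIV[of P "x k p"] by (simp add: has_real_derivative_iff_has_vector_derivative)
  then show "((\<lambda>t. complex_of_real (poly P t)) has_vector_derivative of_real (poly (pderiv P) (x k p))) (at (x k p))"
    by (rule bounded_linear.has_vector_derivative[OF bounded_linear_of_real])
  show "smooth_map A (\<lambda>q. complex_of_real (poly P (x k q)))"
    by (intro smooth_map_of_real smooth_map_poly x_smooth)
qed

lemma T_poly_x: "T p (\<lambda>q. complex_of_real (poly P (x k q))) = 0"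
  by (simp only: ctangent_poly_x[OF T_ctangent] T_x mult_zero_right)

lemma poly_x_smooth: "smooth_map A (\<lambda>q. poly P (x k q))"
  by (intro smooth_map_poly x_smooth)

text \<open>All errors are measured against \<open>N\<close>, the length of the vector of the
  \<open>Z (f j)\<close>, so that \<open>\<delta>\<close> depends on \<open>\<beta>\<close> alone.
  Since \<open>x k\<close> takes values in \<open>{0..1}\<close>, bounds for \<open>P\<close> on
  this interval control every derivative that occurs.\<close>

lemma strictly_pseudoconvex_deformed_poly:
  obtains \<delta> where "\<delta> > 0"
    "\<And>P. (\<And>t. t \<in> {0..1} \<Longrightarrow> \<bar>poly (pderiv P) t\<bar> \<le> \<delta> \<and> \<bar>poly (pderiv (pderiv P)) t\<bar> \<le> \<delta>) \<Longrightarrow>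
      strictly_pseudoconvex A (deformed E T (\<lambda>q. poly P (x k q)))"
proof -
  define b where "b = (\<Sum>j\<in>UNIV. \<beta> $ j)"
  have \<beta>0: "0 \<le> \<beta> $ j" for j using \<beta>_pos[of j] by simp
  have b: "b \<ge> 0" unfolding b_def by (rule sum_nonneg) (rule \<beta>0)
  have \<beta>b: "\<beta> $ j \<le> b" for j unfolding b_def by (rule member_le_sum) (auto simp: \<beta>0)
  have Bb: "B q \<le> b" for q
    unfolding B_def b_def by (rule sum_mono) (use \<beta>0 x_le_1 in \<open>simp add: mult_left_le\<close>)
  \<comment> \<open>The bracket in \<open>levi_estimate\<close>: \<open>b\<close> is the loss from
    \<open>a j \<ge> 1 - 2 * b * \<delta>\<close>, the rest the error per component. The choice of
    \<open>\<delta>\<close> below makes \<open>\<delta> * K < 1/2\<close>, where \<open>1/2\<close>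
    is the coefficient of the undeformed Levi form.\<close>
  define K where "K = b + CARD('N) * (6 * b * (1/2 + b) + (1 + 2 * b) * b)"
  have K: "K \<ge> 0" using b by (simp add: K_def)
  define \<delta> where "\<delta> = 1 / (2 * K + 2)"
  have \<delta>: "\<delta> > 0" "\<delta> \<le> 1" "\<delta> * K < 1/2" using K by (auto simp: \<delta>_def field_simps)
  show thesis
  proof (rule that[OF \<delta>(1)])
    fix P assume P: "\<And>t. t \<in> {0..1} \<Longrightarrow> \<bar>poly (pderiv P) t\<bar> \<le> \<delta> \<and> \<bar>poly (pderiv (pderiv P)) t\<bar> \<le> \<delta>"
    let ?h = "\<lambda>q. poly P (x k q)"
    let ?E = "deformed E T ?h"
    text \<open>With these coefficients \<open>one_form a\<close> is \<open>B\<close> times the real form that is \<open>1\<close> on \<open>T\<close> and vanishes on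
      the deformed structure; the factor \<open>B\<close> avoids a division.\<close>
    define c where "c j q = 2 * \<beta> $ k * x k q - (if j = k then 2 * B q else 0)" for j q
    define a where "a j q = 1 + poly (pderiv P) (x k q) * c j q" for j q
    have c_smooth: "smooth_map A (c j)" for j
      unfolding c_def[abs_def] by (cases "j = k") (auto intro!: smooth_map_diff smooth_map_cmult x_smooth B_smooth)
    have a_smooth: "smooth_map A (a j)" for j
      unfolding a_def[abs_def] by (intro smooth_map_add smooth_map_const smooth_map_mult poly_x_smooth c_smooth)
    interpret D: cr A ?E T
      by (rule cr_deformed[OF poly_x_smooth T_poly_x])
    let ?P = "\<lambda>q. poly (pderiv P) (x k q)" and ?Q = "\<lambda>q. poly (pderiv (pderiv P)) (x k q)"
    have P': "\<bar>?P q\<bar> \<le> \<delta>" "\<bar>?Q q\<bar> \<le> \<delta>" for q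
      using P[of "x k q"] x_nonneg x_le_1 by auto
    have c_bound: "\<bar>c j q\<bar> \<le> 2 * b" for j q
    proof -
      have "\<beta> $ k * x k q \<le> b * 1" by (rule mult_mono) (use \<beta>b x_le_1 b x_nonneg in auto)
      moreover have "0 \<le> \<beta> $ k * x k q" using \<beta>0 x_nonneg by simp
      ultimately show ?thesis using Bb[of q] B_pos[of q] b by (auto simp: c_def)
    qed
    \<comment> \<open>Origin of \<open>c\<close>: vanishing on the deformed vectors asks that the
      sum of \<open>c j q * (cnj (f j q) * Z (f j))\<close> be \<open>- 2 * B q\<close> times the
      \<open>k\<close>-th product, and the value \<open>B\<close> on \<open>T\<close> asks that the
      sum of \<open>c j q * (\<beta> $ j * x j q)\<close> be 0. The products
      \<open>cnj (f j q) * Z (f j)\<close> sum to 0, so a common summand of all \<open>c j\<close>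
      is free in the first condition; the second fixes it as
      \<open>2 * \<beta> $ k * x k q\<close>.\<close>
    have T_form: "one_form a p (T p) = of_real (B p)" for p
    proof -
      have "eta j p (T p) = of_real (\<beta> $ j * x j p)" for j
        by (simp add: eta_def T_f T_f_cnj of_real_x field_simps)
      then have "one_form a p (T p) = of_real (\<Sum>j\<in>UNIV. a j p * (\<beta> $ j * x j p))"
        by (simp add: one_form_def)
      also have "(\<Sum>j\<in>UNIV. a j p * (\<beta> $ j * x j p)) = (\<Sum>j\<in>UNIV. \<beta> $ j * x j p)
          + ?P p * (2 * \<beta> $ k * x k p * (\<Sum>j\<in>UNIV. \<beta> $ j * x j p) - (\<Sum>j\<in>UNIV. if j = k then 2 * B p * (\<beta> $ j * x j p) else 0))"
        unfolding sum_distrib_left sum_subtractf[symmetric] sum.distrib[symmetric]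
        by (rule sum.cong) (auto simp: a_def c_def algebra_simps)
      also have "\<dots> = B p" by (simp add: B_def[symmetric])
      finally show ?thesis .
    qed
    have deformed_vec: "\<exists>Z s. Z \<in> E p \<and> s = of_real (?P p) * (cnj (f k p) * Z (f k)) \<and> Z' = Z - cscale (\<i> * s) (T p)"
      if "Z' \<in> ?E p" for Z' p
    proof -
      obtain Z where Z: "Z \<in> E p" "Z' = Z - cscale (\<i> * Z (\<lambda>q. of_real (?h q))) (T p)"
        using \<open>Z' \<in> ?E p\<close> unfolding deformed_eq by blast
      then show ?thesis using ctangent_poly_x[OF E_ctangent[OF Z(1)], of P k] E_x[OF Z(1), of k] by auto
    qed
    have Z'_f: "Z' (f j) = Z (f j) + s * \<beta> $ j * f j p" "Z' (\<lambda>q. cnj (f j q)) = - s * \<beta> $ j * cnj (f j p)"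
      "eta j p Z' = (cnj (f j p) * Z (f j) + 2 * s * \<beta> $ j * (f j p * cnj (f j p))) / (2 * \<i>)"
      if Z: "Z \<in> E p" and Z': "Z' = Z - cscale (\<i> * s) (T p)" for Z Z' s p j
      using E_f_cnj[OF Z] unfolding eta_def Z' by (simp_all add: cscale_apply T_f T_f_cnj field_simps)
    have sum_fz: "(\<Sum>j\<in>UNIV. cnj (f j p) * Z (f j)) = 0" if "Z \<in> E p" for Z p
      using ctangent_sum_x[OF E_ctangent[OF that]] by (simp add: E_x[OF that])
    have E_form: "one_form a p Z' = 0" if Z': "Z' \<in> ?E p" for Z' p
    proof -
      obtain Z s where Z: "Z \<in> E p" and s: "s = of_real (?P p) * (cnj (f k p) * Z (f k))"
        and Z'_eq: "Z' = Z - cscale (\<i> * s) (T p)" using deformed_vec[OF Z'] by blast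
      have etaZ': "eta j p Z' = (cnj (f j p) * Z (f j)) / (2 * \<i>) - \<i> * s * eta j p (T p)" for j
        using E_f_cnj[OF Z] unfolding Z'_eq by (simp add: eta_def cscale_apply algebra_simps)
      have "one_form a p Z' = (\<Sum>j\<in>UNIV. a j p * (cnj (f j p) * Z (f j))) / (2 * \<i>) - \<i> * s * one_form a p (T p)"
        unfolding one_form_def etaZ' sum_distrib_left sum_divide_distrib sum_subtractf[symmetric]
        by (rule sum.cong) (simp_all add: algebra_simps)
      also have "(\<Sum>j\<in>UNIV. a j p * (cnj (f j p) * Z (f j))) =
          (1 + ?P p * (2 * \<beta> $ k * x k p)) * (\<Sum>j\<in>UNIV. cnj (f j p) * Z (f j))
          - (\<Sum>j\<in>UNIV. if j = k then ?P p * (2 * B p) * (cnj (f j p) * Z (f j)) else 0)"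
        unfolding sum_distrib_left sum_subtractf[symmetric]
        by (rule sum.cong) (auto simp: a_def c_def algebra_simps)
      also have "\<dots> = - 2 * of_real (B p) * s" unfolding sum_fz[OF Z] s by simp
      finally show ?thesis unfolding T_form by (simp add: field_simps)
    qed
    have ker: "form_kernel A (one_form a) p = real_part ?E p" for p
    proof (intro equalityI subsetI)
      fix v assume "v \<in> form_kernel A (one_form a) p"
      then have v: "v \<in> ctangent A p" "cconj v = v" "one_form a p v = 0"
        by (auto simp: form_kernel_def real_tangent_def)
      obtain Z c where Z: "Z \<in> ?E p" "v = Z + cconj Z + cscale (complex_of_real c) (T p)"
        by (rule D.real_decomposition[OF v(1,2)])
      have "of_real (c * B p) = (0::complex)"
        using v(3) unfolding Z(2) by (simp add: one_form_add one_form_cscale one_form_cconj E_form[OF Z(1)] T_form)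
      then have "c = 0" using B_pos[of p] by (simp del: of_real_mult)
      then have "v = cscale (1/2) (cscale 2 Z + cconj (cscale 2 Z))"
        unfolding Z(2) by (simp add: fun_eq_iff cscale_apply cconj_cscale)
      then show "v \<in> real_part ?E p"
        unfolding real_part_def using cvs.subspace_scale[OF D.E_subspace Z(1), of 2] by blast
    next
      fix v assume "v \<in> real_part ?E p"
      then obtain Z where Z: "Z \<in> ?E p" "v = cscale (1/2) (Z + cconj Z)" by (auto simp: real_part_def)
      have "v \<in> ctangent A p"
        unfolding Z(2) by (intro cscale_ctangent plus_ctangent cconj_ctangent D.E_ctangent[OF Z(1)])
      moreover have "cconj v = v" unfolding Z(2) by (simp add: cconj_cscale cconj_add add.commute)
      moreover have "one_form a p v = 0"
        unfolding Z(2) by (simp add: one_form_add one_form_cscale one_form_cconj E_form[OF Z(1)])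
      ultimately show "v \<in> form_kernel A (one_form a) p" by (simp add: form_kernel_def real_tangent_def)
    qed
    have levi: "\<exists>L>0. 1 / (2 * \<i>) * ext_deriv A (one_form a) p Z' (cconj Z') = complex_of_real L"
      if Z': "Z' \<in> ?E p" "Z' \<noteq> 0" for Z' p
    proof -
      obtain Z s where Z: "Z \<in> E p" and s: "s = of_real (?P p) * (cnj (f k p) * Z (f k))"
        and Z'_eq: "Z' = Z - cscale (\<i> * s) (T p)" using deformed_vec[OF Z'(1)] by blast
      note Zct = E_ctangent[OF Z] and Z'ct = D.E_ctangent[OF Z'(1)]
      obtain V where V: "cvector_field A V" "V p = Z'" using D.E_extension[OF Z'(1)] by blast
      let ?d = "\<lambda>j. Z (\<lambda>q. complex_of_real (a j q))"
      define N where "N = sqrt (\<Sum>j\<in>UNIV. (cmod (Z (f j)))\<^sup>2)"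
      have N2: "N\<^sup>2 = (\<Sum>j\<in>UNIV. (cmod (Z (f j)))\<^sup>2)" by (simp add: N_def sum_nonneg)
      have "Z \<noteq> 0"
      proof
        assume 0: "Z = 0"
        then have "s = 0" by (simp add: s)
        then show False using Z'(2) 0 Z'_eq by (simp add: fun_eq_iff cscale_apply)
      qed
      then obtain j where "Z (f j) \<noteq> 0" using immersion[OF Zct] E_f_cnj[OF Z] by blast
      then have "N\<^sup>2 > 0" unfolding N2 by (intro sum_pos2[of UNIV j]) auto
      moreover have "N \<ge> 0" by (simp add: N_def sum_nonneg)
      ultimately have N: "N > 0" by (cases "N = 0") auto
      have zN: "cmod (Z (f j)) \<le> N" for j
      proof -
        have "(cmod (Z (f j)))\<^sup>2 \<le> N\<^sup>2" unfolding N2 by (rule member_le_sum) auto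
        then show ?thesis using N by (simp add: power2_le_iff_abs_le)
      qed
      have xN: "cmod (Z (\<lambda>q. complex_of_real (x j q))) \<le> N" for j
        unfolding E_x[OF Z] norm_mult complex_mod_cnj
        using mult_mono[OF f_le_1 zN[of j] _ norm_ge_zero, of j p] by simp
      have sN: "cmod s \<le> \<delta> * N"
        using mult_mono[OF P'(1)[of p] xN[of k]] \<delta>(1)
        unfolding s E_x[OF Z, symmetric] norm_mult norm_of_real by simp
      have c_deriv: "cmod (Z (\<lambda>q. complex_of_real (c j q))) \<le> 4 * b * N" for j
      proof -
        have sB: "smooth_map A (\<lambda>q. complex_of_real (2 * B q))" "smooth_map A (\<lambda>q. complex_of_real (2 * \<beta> $ k * x k q))"
          by (intro smooth_map_of_real smooth_map_cmult B_smooth x_smooth)+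
        have "Z (\<lambda>q. complex_of_real (2 * \<beta> $ k * x k q)) = 2 * \<beta> $ k * Z (\<lambda>q. of_real (x k q))"
          using ctangent_cmult[OF Zct smooth_map_of_real[OF x_smooth], of "2 * \<beta> $ k" k] by simp
        then have 1: "cmod (Z (\<lambda>q. complex_of_real (2 * \<beta> $ k * x k q))) \<le> 2 * b * N"
          using mult_mono[OF \<beta>b[of k] xN[of k] b norm_ge_zero] \<beta>0[of k] by (simp add: norm_mult mult_ac)
        have "Z (\<lambda>q. complex_of_real (2 * B q)) = 2 * (\<Sum>j\<in>UNIV. \<beta> $ j * Z (\<lambda>q. of_real (x j q)))"
        proof -
          have "Z (\<lambda>q. complex_of_real (2 * B q)) = Z (\<lambda>q. 2 * (\<Sum>j\<in>UNIV. complex_of_real (\<beta> $ j) * of_real (x j q)))"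
            by (simp add: B_def)
          also have "\<dots> = 2 * (\<Sum>j\<in>UNIV. \<beta> $ j * Z (\<lambda>q. of_real (x j q)))"
            by (subst ctangent_cmult[OF Zct], intro smooth_map_sum smooth_map_cmult smooth_map_of_real x_smooth, simp)
              (subst ctangent_sum[OF Zct], auto intro!: smooth_map_cmult smooth_map_of_real x_smooth
                simp: ctangent_cmult[OF Zct smooth_map_of_real[OF x_smooth]])
          finally show ?thesis .
        qed
        then have "cmod (Z (\<lambda>q. complex_of_real (2 * B q))) \<le> 2 * (\<Sum>j\<in>UNIV. cmod (\<beta> $ j * Z (\<lambda>q. of_real (x j q))))"
          by (simp add: norm_mult[of 2] norm_sum)
        also have "\<dots> \<le> 2 * (\<Sum>j\<in>UNIV. \<beta> $ j * N)"
          by (intro mult_left_mono sum_mono) (use xN \<beta>0 in \<open>auto simp: norm_mult intro!: mult_left_mono\<close>)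
        also have "\<dots> = 2 * b * N" by (simp add: b_def sum_distrib_right)
        finally have 2: "cmod (Z (\<lambda>q. complex_of_real (2 * B q))) \<le> 2 * b * N" .
        show ?thesis
        proof (cases "j = k")
          case True
          have eq: "Z (\<lambda>q. complex_of_real (c j q)) = Z (\<lambda>q. complex_of_real (2 * \<beta> $ k * x k q)) - Z (\<lambda>q. complex_of_real (2 * B q))"
            using ctangent_diff[OF Zct sB(2,1)] True by (simp add: c_def)
          show ?thesis
            unfolding eq using 1 2
              norm_triangle_ineq4[of "Z (\<lambda>q. complex_of_real (2 * \<beta> $ k * x k q))" "Z (\<lambda>q. complex_of_real (2 * B q))"]
            by linarith
        next
          case False
          have eq: "(\<lambda>q. complex_of_real (c j q)) = (\<lambda>q. complex_of_real (2 * \<beta> $ k * x k q))"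
            using False by (simp add: c_def)
          have "0 \<le> b * N" using b N by simp
          then show ?thesis unfolding eq using 1 by linarith
        qed
      qed
      \<comment> \<open>Product rule: \<open>?P\<close> is at most \<open>\<delta>\<close> and meets
        \<open>4 * b * N\<close>, its derivative is at most \<open>\<delta> * N\<close> and meets
        \<open>2 * b\<close>; hence the constant 6.\<close>
      have dN: "cmod (?d j) \<le> 6 * b * \<delta> * N" for j
      proof -
        have "?d j = Z (\<lambda>q. 1 + complex_of_real (?P q) * complex_of_real (c j q))" by (simp add: a_def)
        also have "\<dots> = of_real (?P p) * Z (\<lambda>q. of_real (c j q)) + (of_real (?Q p) * Z (\<lambda>q. of_real (x k q))) * of_real (c j p)"
          by (simp only: ctangent_add[OF Zct smooth_map_const smooth_map_mult[OF smooth_map_of_real[OF poly_x_smooth] smooth_map_of_real[OF c_smooth]]]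
              ctangent_mult[OF Zct smooth_map_of_real[OF poly_x_smooth] smooth_map_of_real[OF c_smooth]]
              ctangent_const[OF Zct] ctangent_poly_x[OF Zct] add_0_left)
        also have "cmod \<dots> \<le> \<bar>?P p\<bar> * cmod (Z (\<lambda>q. of_real (c j q))) + (\<bar>?Q p\<bar> * cmod (Z (\<lambda>q. of_real (x k q)))) * \<bar>c j p\<bar>"
          by (rule order_trans[OF norm_triangle_ineq]) (simp add: norm_mult)
        also have "\<dots> \<le> \<delta> * (4 * b * N) + (\<delta> * N) * (2 * b)"
          by (intro add_mono mult_mono P' c_deriv xN c_bound) (use \<delta> b N in auto)
        finally show ?thesis by (simp add: algebra_simps)
      qed
      have aN: "\<bar>a j p - 1\<bar> \<le> 2 * b * \<delta>" for j
        using mult_mono[OF P'(1)[of p] c_bound[of j p]] \<delta>(1) by (simp add: a_def abs_mult mult_ac)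
      have "cconj Z' (\<lambda>q. complex_of_real (a j q)) = cnj (?d j)" "Z' (\<lambda>q. complex_of_real (a j q)) = ?d j" for j
      proof -
        have "T p (\<lambda>q. complex_of_real (a j q)) = 0"
        proof -
          have Tx: "T p (\<lambda>q. \<Sum>j\<in>UNIV. complex_of_real (\<beta> $ j) * of_real (x j q)) = 0"
            by (subst ctangent_sum[OF T_ctangent], auto intro!: smooth_map_cmult smooth_map_of_real x_smooth
                simp: ctangent_cmult[OF T_ctangent smooth_map_of_real[OF x_smooth]] T_x)
          have TB: "T p (\<lambda>q. complex_of_real (B q)) = 0" using Tx by (simp add: B_def)
          have Tc: "T p (\<lambda>q. complex_of_real (c j q)) = 0"
          proof (cases "j = k")
            case True
            have "T p (\<lambda>q. (2 * \<beta> $ k) * complex_of_real (x k q) - 2 * complex_of_real (B q)) = 0"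
              by (simp only: ctangent_diff[OF T_ctangent smooth_map_cmult[OF smooth_map_of_real[OF x_smooth]] smooth_map_cmult[OF smooth_map_of_real[OF B_smooth]]]
                  ctangent_cmult[OF T_ctangent smooth_map_of_real[OF x_smooth]] ctangent_cmult[OF T_ctangent smooth_map_of_real[OF B_smooth]] T_x TB)
                simp
            then show ?thesis using True by (simp add: c_def)
          next
            case False
            then show ?thesis
              using ctangent_cmult[OF T_ctangent smooth_map_of_real[OF x_smooth], of p "2 * \<beta> $ k" k] T_x by (simp add: c_def)
          qed
          have "T p (\<lambda>q. complex_of_real (a j q)) = T p (\<lambda>q. 1 + complex_of_real (?P q) * complex_of_real (c j q))" by (simp add: a_def)
          also have "\<dots> = 0"
            by (simp only: ctangent_add[OF T_ctangent smooth_map_const smooth_map_mult[OF smooth_map_of_real[OF poly_x_smooth] smooth_map_of_real[OF c_smooth]]]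
                ctangent_mult[OF T_ctangent smooth_map_of_real[OF poly_x_smooth] smooth_map_of_real[OF c_smooth]]
                ctangent_const[OF T_ctangent] ctangent_poly_x[OF T_ctangent] T_x Tc) simp
          finally show ?thesis .
        qed
        then show "Z' (\<lambda>q. complex_of_real (a j q)) = ?d j" by (simp add: Z'_eq cscale_apply)
        then show "cconj Z' (\<lambda>q. complex_of_real (a j q)) = cnj (?d j)" by (simp add: cconj_def)
      qed
      note da = this
      have cc: "cconj Z' (f j) = cnj (Z' (\<lambda>q. cnj (f j q)))" "cconj Z' (\<lambda>q. cnj (f j q)) = cnj (Z' (f j))" for j
        by (simp_all add: cconj_def)
      have cV: "cconj (V p) = cconj Z'" by (simp add: V(2))
      have ext: "ext_deriv A (one_form a) p Z' (cconj Z') = (\<Sum>j\<in>UNIV. ?d j * cnj (eta j p Z') - cnj (?d j) * eta j p Z'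
        + of_real (a j p) * ((- s * \<beta> $ j * cnj (f j p)) * cnj (- s * \<beta> $ j * cnj (f j p))
        - (Z (f j) + s * \<beta> $ j * f j p) * cnj (Z (f j) + s * \<beta> $ j * f j p)) / \<i>)"
        unfolding ext_deriv_one_form[OF a_smooth V cvector_field_cconj[OF V(1)] cV]
          da eta_cconj cc Z'_f(1,2)[OF Z Z'_eq] by (rule refl)
      show ?thesis
        unfolding ext
        by (rule levi_estimate[where b = b and \<delta> = \<delta> and N = N])
          (use \<beta>0 f_le_1 N N2 \<delta> sN dN aN Z'_f(3)[OF Z Z'_eq] in \<open>auto simp: b_def K_def\<close>)
    qed
    show "strictly_pseudoconvex A ?E"
      unfolding strictly_pseudoconvex_def
    proof (intro exI[of _ "one_form a"] conjI allI)
      show "real_one_form A (one_form a)" by (rule real_one_form_one_form[OF a_smooth])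
      show "\<exists>v\<in>real_tangent A p. one_form a p v \<noteq> 0" for p
        using T_form[of p] B_pos[of p] T_ctangent[of p] by (intro bexI[of _ "T p"]) (auto simp: real_tangent_def)
      show "form_kernel A (one_form a) p = real_part ?E p" for p by (rule ker)
      show "positive_levi_form A ?E (one_form a)"
        unfolding positive_levi_form_def
      proof (intro allI ballI)
        fix p Z' assume "Z' \<in> ?E p - {0}"
        then obtain L where "L > 0" "1 / (2 * \<i>) * ext_deriv A (one_form a) p Z' (cconj Z') = complex_of_real L"
          using levi[of Z' p] by blast
        then show "1 / (2 * \<i>) * ext_deriv A (one_form a) p Z' (cconj Z') \<in> \<real> \<and>
            Re (1 / (2 * \<i>) * ext_deriv A (one_form a) p Z' (cconj Z')) > 0"
          by (simp only: Reals_of_real Re_complex_of_real)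
      qed
    qed
  qed
qed

text \<open>The zero polynomial leaves the structure unchanged. Thus a sphere map certifies strict
  pseudoconvexity, and solutions of the equation are admissible without further estimates.\<close>

lemma strictly_pseudoconvex: "strictly_pseudoconvex A E"
proof -
  obtain \<delta> where \<delta>: "\<delta> > 0"
    "\<And>P. (\<And>t. t \<in> {0..1} \<Longrightarrow> \<bar>poly (pderiv P) t\<bar> \<le> \<delta> \<and> \<bar>poly (pderiv (pderiv P)) t\<bar> \<le> \<delta>) \<Longrightarrow>
      strictly_pseudoconvex A (deformed E T (\<lambda>q. poly P (x undefined q)))"
    by (rule strictly_pseudoconvex_deformed_poly) blast
  have "deformed E T (\<lambda>q. poly 0 (x undefined q)) = E"
  proof
    fix p
    let ?d = "\<lambda>Z. Z - cscale (\<i> * Z (\<lambda>q. of_real (poly 0 (x undefined q)))) (T p)"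
    have "?d Z = Z" if "Z \<in> E p" for Z
      using ctangent_const[OF E_ctangent[OF that], of 0] by (simp add: fun_eq_iff cscale_apply)
    then show "deformed E T (\<lambda>q. poly 0 (x undefined q)) p = E p"
      using image_cong[of "E p" "E p" ?d "\<lambda>Z. Z"] unfolding deformed_eq image_ident by blast
  qed
  then show ?thesis using \<delta>(2)[of 0] \<delta>(1) by simp
qed

end

section \<open>Finite determination of weighted CR functions\<close>

lemma has_derivative_holomorphic:
  fixes G :: "'v::euclidean_space \<Rightarrow> complex" and J :: "'v \<Rightarrow> 'v"
  assumes V: "open V" and G: "\<And>\<omega>. \<omega> \<in> V \<Longrightarrow> \<exists>D. (G has_derivative D) (at \<omega>) \<and> (\<forall>v. D (J v) = \<i> * D v)"
  shows "(\<lambda>\<zeta>. G (\<omega>0 + Re \<zeta> *\<^sub>R v + Im \<zeta> *\<^sub>R J v)) holomorphic_on {\<zeta>. \<omega>0 + Re \<zeta> *\<^sub>R v + Im \<zeta> *\<^sub>R J v \<in> V}"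
proof -
  let ?c = "\<lambda>\<zeta>. \<omega>0 + Re \<zeta> *\<^sub>R v + Im \<zeta> *\<^sub>R J v"
  have "(\<lambda>\<zeta>. G (?c \<zeta>)) field_differentiable (at \<zeta>)" if \<zeta>: "?c \<zeta> \<in> V" for \<zeta>
  proof -
    obtain D where D: "(G has_derivative D) (at (?c \<zeta>))" and J: "\<And>v. D (J v) = \<i> * D v"
      using G[OF \<zeta>] by blast
    have "(?c has_derivative (\<lambda>h. Re h *\<^sub>R v + Im h *\<^sub>R J v)) (at \<zeta>)"
      by (auto intro!: derivative_eq_intros)
    from has_derivative_compose[OF this D]
    have "((\<lambda>\<zeta>. G (?c \<zeta>)) has_derivative (\<lambda>h. D (Re h *\<^sub>R v + Im h *\<^sub>R J v))) (at \<zeta>)" .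
    moreover have "D (Re h *\<^sub>R v + Im h *\<^sub>R J v) = D v * h" for h
    proof -
      have lin: "linear D" using D has_derivative_linear by blast
      have "D (Re h *\<^sub>R v + Im h *\<^sub>R J v) = (of_real (Re h) + \<i> * of_real (Im h)) * D v"
        by (simp add: linear_add[OF lin] linear_scale[OF lin] J scaleR_conv_of_real algebra_simps)
      also have "\<dots> = D v * h" by (simp only: complex_eq[symmetric] mult.commute)
      finally show ?thesis .
    qed
    ultimately have "((\<lambda>\<zeta>. G (?c \<zeta>)) has_field_derivative D v) (at \<zeta>)"
      by (simp add: has_field_derivative_def)
    then show ?thesis using field_differentiable_def by blast
  qed
  then show ?thesis
    unfolding holomorphic_on_def using field_differentiable_at_within by blast
qed

text \<open>Cauchy's estimate on discs of radius \<open>r\<close> around the points of the unit disc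
  bounds the derivative there by \<open>M / r\<close>; the radius \<open>r + 2\<close> leaves room
  for these closed discs.\<close>

lemma holomorphic_increment_bound:
  assumes g: "g holomorphic_on ball 0 (r + 2)" and r: "r > 0" and M: "\<And>\<zeta>. \<zeta> \<in> ball 0 (r + 2) \<Longrightarrow> cmod (g \<zeta>) \<le> M"
  shows "cmod (g 1 - g 0) \<le> M / r"
proof -
  have d: "(g has_field_derivative deriv g \<zeta>) (at \<zeta> within cball 0 1)" if "\<zeta> \<in> cball 0 1" for \<zeta>
    using holomorphic_derivI[OF g open_ball, of \<zeta>] that r has_field_derivative_at_within by force
  have "cmod (deriv g \<zeta>) \<le> M / r" if "\<zeta> \<in> cball 0 1" for \<zeta>
  proof -
    have sub: "cball \<zeta> r \<subseteq> ball 0 (r + 2)"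
    proof
      fix y assume "y \<in> cball \<zeta> r"
      then have "norm (y - \<zeta>) \<le> r" by (simp add: dist_norm norm_minus_commute)
      then show "y \<in> ball 0 (r + 2)" using norm_triangle_ineq[of "y - \<zeta>" \<zeta>] that by simp
    qed
    have "cmod ((deriv ^^ 1) g \<zeta>) \<le> fact 1 * M / r ^ 1"
    proof (rule Cauchy_inequality)
      show "g holomorphic_on ball \<zeta> r"
        using g sub by (meson ball_subset_cball holomorphic_on_subset order_trans)
      show "continuous_on (cball \<zeta> r) g"
        using g sub holomorphic_on_imp_continuous_on holomorphic_on_subset by blast
      show "cmod (g x) \<le> M" if "cmod (\<zeta> - x) = r" for x
        using that sub by (intro M) (auto simp: dist_norm)
    qed (rule r)
    then show ?thesis by simp
  qed
  then have "cmod (g 1 - g 0) \<le> M / r * cmod (1 - 0)"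
    by (intro field_differentiable_bound[OF convex_cball d]) auto
  then show ?thesis by simp
qed

section \<open>The cone with its complex structure, and uniform estimates for weighted CR
  functions\<close>

context cr_sphere
begin

text \<open>The derivative at height 0 of the extension \<open>exp (b * \<rho>) * g\<close> of
  \<open>g\<close> to the cone; its second summand comes from the height variable.\<close>

definition dcone :: "('a, 'e) chart \<Rightarrow> 'a \<Rightarrow> real \<Rightarrow> ('a \<Rightarrow> complex) \<Rightarrow> 'e \<times> real \<Rightarrow> complex" where
  "dcone c q b g = (\<lambda>(a, \<rho>). cd c g q a + of_real (\<rho> * b) * g q)"

text \<open>The derivatives of the homogeneous extensions of weighted CR functions to the cone \<open>X \<times> \<real>\<close> are complex linear
  for one and the same complex structure on the cone.\<close>
lemma dcone_complex:
  assumes c: "(U, w) \<in> A" "q \<in> U"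
  obtains v' where "\<And>b g. cr_weight b g \<Longrightarrow> dcone (U, w) q b g v' = \<i> * dcone (U, w) q b g v"
proof -
  obtain a \<rho> where v: "v = (a, \<rho>)" by (cases v)
  obtain Z k where Z: "Z \<in> E q" "coord_vec (U, w) q a = Z + cconj Z + cscale (complex_of_real k) (T q)"
    by (rule real_decomposition[OF coord_vec_ctangent[OF c] cconj_coord_vec[OF c]])
  \<comment> \<open>\<open>?u\<close> and \<open>- k\<close> form the image of the cone vector under
    the complex structure that multiplies \<open>E\<close> by \<open>\<i>\<close>, takes the height
    direction to \<open>T\<close> and \<open>T\<close> to minus the height direction. It fits
    because \<open>T g\<close> is \<open>\<i>\<close> times the height derivative of the
    extension.\<close>
  let ?u = "cscale \<i> Z + cconj (cscale \<i> Z) + cscale (of_real \<rho>) (T q)"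
  have "?u \<in> ctangent A q"
    by (intro plus_ctangent cconj_ctangent cscale_ctangent T_ctangent E_ctangent[OF Z(1)])
  moreover have "cconj ?u = ?u" 
    by (simp only: cconj_add cconj_cconj cconj_cscale[of "of_real \<rho>"] cconj_T complex_cnj_complex_of_real add.commute)
  ultimately obtain a' where a': "?u = coord_vec (U, w) q a'" by (rule real_tangent_coord[OF c])
  show thesis
  proof (rule that[of "(a', - k)"])
    fix b g assume g: "cr_weight b g"
    note sm = cr_weight_smooth[OF g]
    have "cd (U, w) g q a = Z g + k * (\<i> * b * g q)"
      using fun_cong[OF Z(2), of g] sm cr_weight_cconj_E[OF g Z(1)] cr_weight_T[OF g, of q]
      by (simp add: coord_vec_def cscale_apply)
    moreover have "cd (U, w) g q a' = \<i> * Z g + \<rho> * (\<i> * b * g q)"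
      using fun_cong[OF a', of g] sm cr_weight_cconj_E[OF g Z(1)] cr_weight_T[OF g, of q]
      by (simp add: coord_vec_def cscale_apply cconj_cscale)
    ultimately show "dcone (U, w) q b g (a', - k) = \<i> * dcone (U, w) q b g v"
      by (simp add: dcone_def v algebra_simps)
  qed
qed

text \<open>If all derivatives vanish, \<open>Z (f j)\<close> is \<open>- Complex \<rho> k\<close>
  times \<open>\<beta> $ j * f j q\<close>. By \<open>T_coefficient_zero\<close> height and
  \<open>T\<close> part are 0, and then the immersion property removes \<open>Z\<close>.\<close>

lemma dcone_injective:
  assumes c: "(U, w) \<in> A" "q \<in> U" and 0: "\<And>j. dcone (U, w) q (\<beta> $ j) (f j) v = 0"
  shows "v = 0"
proof -
  obtain a \<rho> where v: "v = (a, \<rho>)" by (cases v)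
  obtain Z k where Z: "Z \<in> E q" "coord_vec (U, w) q a = Z + cconj Z + cscale (complex_of_real k) (T q)"
    by (rule real_decomposition[OF coord_vec_ctangent[OF c] cconj_coord_vec[OF c]])
  have Zf: "Z (f j) = - Complex \<rho> k * \<beta> $ j * f j q" for j
  proof -
    have "cd (U, w) (f j) q a = Z (f j) + k * (\<i> * \<beta> $ j * f j q)"
      using fun_cong[OF Z(2), of "f j"] f_smooth cr_weight_cconj_E[OF weight Z(1)]
      by (simp add: coord_vec_def cscale_apply T_f)
    then show ?thesis using 0[of j] by (simp add: dcone_def v Complex_eq algebra_simps eq_neg_iff_add_eq_0)
  qed
  have "- Complex \<rho> k = 0"
    by (rule T_coefficient_zero[OF E_ctangent[OF Z(1)] Zf E_f_cnj[OF Z(1)]])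
  then have \<rho>k: "\<rho> = 0" "k = 0" by (auto simp: complex_eq_iff)
  have "Z = 0"
    by (rule immersion[OF E_ctangent[OF Z(1)]]) (use Zf \<rho>k E_f_cnj[OF Z(1)] in \<open>auto simp: complex_eq_iff\<close>)
  then have "coord_vec (U, w) q a = 0" using Z(2) \<rho>k by simp
  then show ?thesis using coord_vec_eq_0[OF c] v \<rho>k by (simp add: zero_prod_def)
qed

lemma dcone_linear:
  assumes "(U, w) \<in> A" "q \<in> U" "smooth_map A g"
  shows "linear (dcone (U, w) q b g)"
  using cd_linear[OF assms(3,1,2)]
  by (intro linearI) (auto simp: dcone_def linear_add linear_scale scaleR_conv_of_real algebra_simps)

definition cone :: "('a, 'e) chart \<Rightarrow> real \<Rightarrow> ('a \<Rightarrow> complex) \<Rightarrow> 'e \<times> real \<Rightarrow> complex" where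
  "cone c b g z = of_real (exp (b * snd z)) * g (inv_into (fst c) (snd c) (fst z))"

lemma cone_derivative:
  assumes c: "(U, w) \<in> A" and z: "fst z \<in> w ` U" and g: "smooth_map A g"
  shows "(cone (U, w) b g has_derivative
    (\<lambda>v. of_real (exp (b * snd z)) * dcone (U, w) (inv_into U w (fst z)) b g v)) (at z)"
proof -
  let ?q = "inv_into U w (fst z)"
  have q: "?q \<in> U" "w ?q = fst z" using z by (auto simp: inv_into_into f_inv_into_f)
  have "((\<lambda>y. g (inv_into U w y)) has_derivative cd (U, w) g ?q) (at (fst z))"
    using cd_has_derivative[OF g c q(1)] q(2) by simp
  then have 1: "((\<lambda>z. g (inv_into U w (fst z))) has_derivative (\<lambda>v. cd (U, w) g ?q (fst v))) (at z)"
    by (rule has_derivative_compose[where f = fst, rotated]) (auto intro!: derivative_eq_intros)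
  have 2: "((\<lambda>z. complex_of_real (exp (b * snd z))) has_derivative (\<lambda>v. of_real (exp (b * snd z) * (b * snd v)))) (at z)"
    by (rule bounded_linear.has_derivative[OF bounded_linear_of_real]) (auto intro!: derivative_eq_intros)
  show ?thesis
    unfolding cone_def[abs_def] fst_conv snd_conv
    by (rule has_derivative_eq_rhs[OF has_derivative_mult[OF 2 1]])
      (auto simp: dcone_def fun_eq_iff algebra_simps)
qed

lemma cone_smooth:
  assumes c: "(U, w) \<in> A" and g: "smooth_map A g"
  shows "smooth_on (w ` U \<times> UNIV) (cone (U, w) b g)"
proof -
  have o: "open (w ` U \<times> (UNIV :: real set))" using chart_open(2)[OF c] by (simp add: open_Times)
  have "smooth_on (w ` U \<times> (UNIV :: real set)) (\<lambda>z. b * snd z)"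
    by (intro smooth_on_linear o bounded_linear_compose[OF bounded_linear_mult_right] bounded_linear_snd)
  then have "smooth_on (w ` U \<times> (UNIV :: real set)) (\<lambda>z. complex_of_real (exp (b * snd z)))"
    by (intro smooth_on_bounded_linear[OF o bounded_linear_of_real] smooth_on_real_exp[OF o])
  moreover have "smooth_on (w ` U \<times> (UNIV :: real set)) (\<lambda>z. g (inv_into U w (fst z)))"
    by (rule smooth_on_compose[OF o chart_open(2)[OF c] smooth_mapD[OF g c] smooth_on_linear[OF o bounded_linear_fst]]) auto
  ultimately show ?thesis
    unfolding cone_def[abs_def] fst_conv snd_conv by (rule smooth_on_mult[OF o])
qed

text \<open>The neighbourhood depends on \<open>b\<close> and \<open>\<epsilon>\<close> but not on
  \<open>g\<close>. In the chart \<open>\<Psi>\<close> of the cone, built from the sphere map and a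
  complex linear projection, the complex structure is the constant \<open>J\<close>, so all
  extensions \<open>cone\<close> are holomorphic along discs in the direction of
  \<open>\<Psi> (w q, 0) - \<Psi> z0\<close>. The closer \<open>q\<close> is to \<open>p\<close>,
  the larger these discs may be relative to this vector.\<close>

lemma cr_weight_equicontinuous:
  assumes \<epsilon>: "\<epsilon> > 0"
  obtains W where "open W" "p \<in> W"
    "\<And>g M q. cr_weight b g \<Longrightarrow> (\<And>q. cmod (g q) \<le> M) \<Longrightarrow> q \<in> W \<Longrightarrow> cmod (g q - g p) \<le> \<epsilon> * M"
proof -
  obtain U w where c: "(U, w) \<in> A" and p: "p \<in> U" by (rule chart_exists)
  define Om where "Om = w ` U \<times> (UNIV :: real set)"
  have Om: "open Om" using chart_open(2)[OF c] by (simp add: Om_def open_Times)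
  define z0 where "z0 = (w p, 0 :: real)"
  have z0: "z0 \<in> Om" using p by (simp add: z0_def Om_def)
  let ?q = "\<lambda>z :: 'e \<times> real. inv_into U w (fst z)"
  have qU: "?q z \<in> U" if "z \<in> Om" for z using that by (auto simp: Om_def inv_into_into)
  define mi where "mi z = (\<chi> j. \<i> * z $ j)" for z :: "complex ^ 'N"
  have mi: "linear mi" "mi (mi z) = - z" for z
    by (auto simp: mi_def vec_eq_iff algebra_simps intro!: linearI)
  define L where "L v = (\<chi> j. dcone (U, w) p (\<beta> $ j) (f j) v)" for v
  have L: "linear L"
    using linear_add[OF dcone_linear[OF c p f_smooth]] linear_scale[OF dcone_linear[OF c p f_smooth]]
    by (intro linearI) (simp_all add: L_def vec_eq_iff)
  have "inj L"
    unfolding linear_injective_0[OF L] using dcone_injective[OF c p] by (auto simp: L_def vec_eq_iff)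
  then obtain \<pi>0 where \<pi>0: "linear \<pi>0" "\<pi>0 \<circ> L = id"
    using linear_injective_left_inverse[OF L] by blast
  have \<pi>0L: "\<pi>0 (L v) = v" for v using \<pi>0(2) by (metis comp_apply id_apply)
  \<comment> \<open>By \<open>dcone_complex\<close>, multiplication by \<open>\<i>\<close> preserves
    the range of \<open>L\<close>; \<open>J\<close> is this multiplication pulled back to the cone
    directions.\<close>
  define J where "J v = \<pi>0 (mi (L v))" for v
  have linJ: "linear J"
    using linear_compose[OF linear_compose[OF L mi(1)] \<pi>0(1)] by (simp add: J_def[abs_def] o_def)
  have LJ: "L (J v) = mi (L v)" for v
  proof -
    obtain v' where "\<And>b g. cr_weight b g \<Longrightarrow> dcone (U, w) p b g v' = \<i> * dcone (U, w) p b g v"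
      by (rule dcone_complex[OF c p]) blast
    then have "mi (L v) = L v'" using weight by (simp add: mi_def L_def vec_eq_iff)
    then show ?thesis by (simp add: J_def \<pi>0L)
  qed
  have JJ: "J (J v) = - v" for v
    using \<pi>0L[of v] linear_neg[OF \<pi>0(1)] by (simp add: J_def[of "J v"] LJ mi(2))
  text \<open>Averaging makes the left inverse \<open>\<pi>0\<close> of \<open>L\<close> complex linear.\<close>
  define \<pi> where "\<pi> z = (1/2) *\<^sub>R (\<pi>0 z - J (\<pi>0 (mi z)))" for z
  have lin\<pi>: "linear \<pi>"
    using linear_compose[OF linear_compose[OF mi(1) \<pi>0(1)] linJ] \<pi>0(1)
    unfolding \<pi>_def[abs_def] by (intro linear_compose_scale_right linear_compose_sub) (simp_all add: o_def)
  have \<pi>mi: "\<pi> (mi z) = J (\<pi> z)" for z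
    by (simp add: \<pi>_def mi(2) linear_neg[OF \<pi>0(1)] linear_neg[OF linJ] linear_scale[OF linJ] linear_diff[OF linJ] JJ
        add.commute)
  have \<pi>L: "\<pi> (L v) = v" for v
    using JJ[of v] by (simp add: \<pi>_def \<pi>0L J_def[symmetric] scaleR_2[symmetric])
  define \<Phi> where "\<Phi> z = (\<chi> j. cone (U, w) (\<beta> $ j) (f j) z)" for z
  define D\<Phi> where "D\<Phi> z v = (\<chi> j. of_real (exp (\<beta> $ j * snd z)) * dcone (U, w) (?q z) (\<beta> $ j) (f j) v)" for z v
  define \<Psi> where "\<Psi> z = \<pi> (\<Phi> z)" for z
  have \<Phi>: "smooth_on Om \<Phi>"
  proof -
    have "bounded_linear (axis j :: complex \<Rightarrow> complex ^ 'N)" for j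
      unfolding linear_conv_bounded_linear[symmetric]
      by (rule linearI) (simp_all add: axis_def vec_eq_iff)
    then have "smooth_on Om (\<lambda>z. \<Sum>j\<in>UNIV. axis j (cone (U, w) (\<beta> $ j) (f j) z))"
      by (intro smooth_on_sum Om smooth_on_bounded_linear[OF Om _ cone_smooth[OF c f_smooth, folded Om_def]]) simp_all
    moreover have "\<Phi> = (\<lambda>z. \<Sum>j\<in>UNIV. axis j (cone (U, w) (\<beta> $ j) (f j) z))"
      by (simp add: fun_eq_iff \<Phi>_def vec_eq_iff axis_def)
    ultimately show ?thesis by simp
  qed
  have d\<Phi>: "(\<Phi> has_derivative D\<Phi> z) (at z)" if z: "z \<in> Om" for z
  proof -
    have "frechet_derivative \<Phi> (at z) = D\<Phi> z"
    proof
      fix v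
      have "(\<Phi> has_derivative frechet_derivative \<Phi> (at z)) (at z)"
        by (rule smooth_on_has_derivative[OF \<Phi> z])
      then have "((\<lambda>z. \<Phi> z $ j) has_derivative (\<lambda>v. frechet_derivative \<Phi> (at z) v $ j)) (at z)" for j
        by (rule bounded_linear.has_derivative[OF bounded_linear_vec_nth])
      moreover have "((\<lambda>z. \<Phi> z $ j) has_derivative (\<lambda>v. D\<Phi> z v $ j)) (at z)" for j
        using cone_derivative[OF c _ f_smooth, of z "\<beta> $ j" j] z by (simp add: \<Phi>_def D\<Phi>_def Om_def mem_Times_iff)
      ultimately have "(\<lambda>v. frechet_derivative \<Phi> (at z) v $ j) = (\<lambda>v. D\<Phi> z v $ j)" for j
        using has_derivative_unique by blast
      then show "frechet_derivative \<Phi> (at z) v = D\<Phi> z v" by (metis vec_eq_iff)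
    qed
    then show ?thesis using smooth_on_has_derivative[OF \<Phi> z] by simp
  qed
  have \<Psi>: "smooth_on Om \<Psi>"
    unfolding \<Psi>_def[abs_def] using lin\<pi>
    by (intro smooth_on_bounded_linear[OF Om _ \<Phi>]) (simp add: linear_conv_bounded_linear)
  have d\<Psi>: "(\<Psi> has_derivative (\<lambda>v. \<pi> (D\<Phi> z v))) (at z)" if "z \<in> Om" for z
    unfolding \<Psi>_def[abs_def] using lin\<pi>
    by (intro bounded_linear.has_derivative[OF _ d\<Phi>[OF that]]) (simp add: linear_conv_bounded_linear)
  define \<Psi>' where "\<Psi>' z = Blinfun (\<lambda>v. \<pi> (D\<Phi> z v))" for z
  have \<Psi>': "blinfun_apply (\<Psi>' z) = (\<lambda>v. \<pi> (D\<Phi> z v))" if "z \<in> Om" for z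
    unfolding \<Psi>'_def using has_derivative_bounded_linear[OF d\<Psi>[OF that]] by (rule bounded_linear_Blinfun_apply)
  have "L = D\<Phi> z0"
    using p by (simp add: fun_eq_iff L_def D\<Phi>_def z0_def c)
  then have "blinfun_apply (\<Psi>' z0) = (\<lambda>v. v)" using \<Psi>'[OF z0] \<pi>L by simp
  then have inv: "id_blinfun o\<^sub>L \<Psi>' z0 = id_blinfun" by (intro blinfun_eqI) simp
  have cont: "continuous_on Om \<Psi>'"
  proof (rule continuous_on_blinfun_componentwise)
    fix i :: "'e \<times> real"
    have "continuous_on Om (\<lambda>z. frechet_derivative \<Psi> (at z) i)"
      by (rule smooth_on_continuous_on[OF smooth_on_frechet_derivative[OF \<Psi>]])
    then show "continuous_on Om (\<lambda>z. blinfun_apply (\<Psi>' z) i)"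
      by (rule continuous_on_eq) (simp add: \<Psi>' frechet_derivative_at[OF d\<Psi>, symmetric])
  qed
  have der: "(\<Psi> has_derivative blinfun_apply (\<Psi>' z)) (at z)" if "z \<in> Om" for z
    using d\<Psi>[OF that] \<Psi>'[OF that] by simp
  obtain U' V \<sigma> \<sigma>' where inv_fun: "open U'" "U' \<subseteq> Om" "z0 \<in> U'" "open V" "\<Psi> z0 \<in> V" "homeomorphism U' V \<Psi> \<sigma>"
    "\<And>y. y \<in> V \<Longrightarrow> (\<sigma> has_derivative \<sigma>' y) (at y)"
    "\<And>y. y \<in> V \<Longrightarrow> \<sigma>' y = inv (blinfun_apply (\<Psi>' (\<sigma> y)))"
    "\<And>y. y \<in> V \<Longrightarrow> bij (blinfun_apply (\<Psi>' (\<sigma> y)))"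
  proof (rule inverse_function_theorem[OF Om der cont z0 inv])
    fix U' V \<sigma> \<sigma>' assume *: "open U'" "U' \<subseteq> Om" "z0 \<in> U'" "open V" "\<Psi> z0 \<in> V" "homeomorphism U' V \<Psi> \<sigma>"
    "\<And>y. y \<in> V \<Longrightarrow> (\<sigma> has_derivative \<sigma>' y) (at y)"
    "\<And>y. y \<in> V \<Longrightarrow> \<sigma>' y = inv (blinfun_apply (\<Psi>' (\<sigma> y)))"
    "\<And>y. y \<in> V \<Longrightarrow> bij (blinfun_apply (\<Psi>' (\<sigma> y)))"
    show thesis by (rule that[OF *])
  qed
  have \<sigma>U': "\<sigma> y \<in> U'" if "y \<in> V" for y
    using homeomorphism_image2[OF inv_fun(6)] that by blast
  have complex_lin: "\<exists>D. ((\<lambda>y. cone (U, w) b g (\<sigma> y)) has_derivative D) (at y) \<and> (\<forall>v. D (J v) = \<i> * D v)"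
    if g: "cr_weight b g" and y: "y \<in> V" for b g y
  proof -
    let ?z = "\<sigma> y"
    have zOm: "?z \<in> Om" using \<sigma>U'[OF y] inv_fun(2) by blast
    let ?D = "\<lambda>v. of_real (exp (b * snd ?z)) * dcone (U, w) (?q ?z) b g v"
    have "(cone (U, w) b g has_derivative ?D) (at ?z)"
      by (rule cone_derivative[OF c _ cr_weight_smooth[OF g]]) (use zOm in \<open>simp add: Om_def mem_Times_iff\<close>)
    from has_derivative_compose[OF inv_fun(7)[OF y] this]
    have "((\<lambda>y. cone (U, w) b g (\<sigma> y)) has_derivative (\<lambda>v. ?D (\<sigma>' y v))) (at y)" .
    \<comment> \<open>\<open>v'\<close> is the image of \<open>\<sigma>' y v\<close> under the
      complex structure of the cone. The derivative of \<open>\<Psi>\<close> sends it to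
      \<open>J v\<close>, so it equals \<open>\<sigma>' y (J v)\<close>. As it is the same vector
      for all weights and functions, the extension of \<open>g\<close> inherits complex linearity
      from the sphere components.\<close>
    moreover have "?D (\<sigma>' y (J v)) = \<i> * ?D (\<sigma>' y v)" for v
    proof -
      obtain v' where v': "\<And>b g. cr_weight b g \<Longrightarrow>
          dcone (U, w) (?q ?z) b g v' = \<i> * dcone (U, w) (?q ?z) b g (\<sigma>' y v)"
        by (rule dcone_complex[OF c qU[OF zOm]]) blast
      have "D\<Phi> ?z v' = mi (D\<Phi> ?z (\<sigma>' y v))"
        using v'[OF weight] by (simp add: D\<Phi>_def mi_def vec_eq_iff mult.left_commute)
      then have "blinfun_apply (\<Psi>' ?z) v' = J (blinfun_apply (\<Psi>' ?z) (\<sigma>' y v))"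
        by (simp add: \<Psi>'[OF zOm] \<pi>mi)
      also have "blinfun_apply (\<Psi>' ?z) (\<sigma>' y v) = v"
        unfolding inv_fun(8)[OF y] by (rule surj_f_inv_f[OF bij_is_surj[OF inv_fun(9)[OF y]]])
      finally have "\<sigma>' y (J v) = v'"
        unfolding inv_fun(8)[OF y] using inv_f_f[OF bij_is_inj[OF inv_fun(9)[OF y]]] by metis
      then show ?thesis using v'[OF g] by (simp add: mult.left_commute)
    qed
    ultimately show ?thesis by blast
  qed
  \<comment> \<open>In the region used below the height stays within 1, so extensions of
    \<open>g\<close> are at most \<open>exp \<bar>b\<bar> * M\<close>; this \<open>r\<close> turns
    Cauchy's bound into \<open>\<epsilon> * M\<close>.\<close>
  define r where "r = exp \<bar>b\<bar> / \<epsilon>"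
  have r: "r > 0" using \<epsilon> by (simp add: r_def)
  have "snd (\<sigma> (\<Psi> z0)) = 0"
    using homeomorphism_apply1[OF inv_fun(6,3)] by (simp add: z0_def)
  moreover have "continuous_on V (\<lambda>y. snd (\<sigma> y))"
    by (intro continuous_on_snd homeomorphism_cont2[OF inv_fun(6)])
  ultimately have "open (V \<inter> (\<lambda>y. snd (\<sigma> y)) -` ball 0 1)" "\<Psi> z0 \<in> V \<inter> (\<lambda>y. snd (\<sigma> y)) -` ball 0 1"
    using inv_fun(4,5) by (auto intro: continuous_open_preimage)
  then obtain R where R: "R > 0" "ball (\<Psi> z0) R \<subseteq> V \<inter> (\<lambda>y. snd (\<sigma> y)) -` ball 0 1"
    by (meson open_contains_ball)
  obtain K where K: "K > 0" "\<And>v. norm (J v) \<le> norm v * K"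
    using bounded_linear.pos_bounded[of J] linJ by (auto simp: linear_conv_bounded_linear)
  \<comment> \<open>A disc of radius \<open>r + 2\<close> in the direction of a vector shorter than
    \<open>R'\<close> stays in the ball of radius \<open>R\<close>; the factor \<open>1 + K\<close>
    accounts for the vector together with its image under \<open>J\<close>.\<close>
  define R' where "R' = R / ((1 + K) * (r + 2))"
  have R': "R' > 0" using R(1) K(1) r by (simp add: R'_def)
  define W where "W = {q \<in> U. (w q, 0) \<in> U' \<inter> \<Psi> -` ball (\<Psi> z0) R'}"
  show thesis
  proof (rule that[of W])
    have o1: "open (U' \<inter> \<Psi> -` ball (\<Psi> z0) R')"
      by (rule continuous_open_preimage[OF continuous_on_subset[OF smooth_on_continuous_on[OF \<Psi>] inv_fun(2)] inv_fun(1) open_ball])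
    have c1: "continuous_on U (\<lambda>q. (w q, 0 :: real))"
      by (intro continuous_on_Pair continuous_on_const homeomorphism_cont1[OF chart_homeomorphism[OF c]])
    have "open (U \<inter> (\<lambda>q. (w q, 0)) -` (U' \<inter> \<Psi> -` ball (\<Psi> z0) R'))"
      by (rule continuous_open_preimage[OF c1 chart_open(1)[OF c] o1])
    then show "open W" by (simp add: W_def vimage_def Int_def)
    show "p \<in> W" using p inv_fun(3) R' by (simp add: W_def z0_def)
    fix g M q assume g: "cr_weight b g" and M: "\<And>q. cmod (g q) \<le> M" and q: "q \<in> W"
    let ?G = "\<lambda>y. cone (U, w) b g (\<sigma> y)" and ?v = "\<Psi> (w q, 0) - \<Psi> z0"
    let ?c = "\<lambda>\<zeta>. \<Psi> z0 + Re \<zeta> *\<^sub>R ?v + Im \<zeta> *\<^sub>R J ?v"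
    have M0: "M \<ge> 0" using M[of p] norm_ge_zero order_trans by blast
    have v: "norm ?v < R'" using q by (simp add: W_def dist_norm norm_minus_commute)
    have c_ball: "?c \<zeta> \<in> ball (\<Psi> z0) R" if "\<zeta> \<in> ball 0 (r + 2)" for \<zeta>
    proof -
      have "norm (Re \<zeta> *\<^sub>R ?v + Im \<zeta> *\<^sub>R J ?v) \<le> norm (Re \<zeta> *\<^sub>R ?v) + norm (Im \<zeta> *\<^sub>R J ?v)"
        by (rule norm_triangle_ineq)
      also have "\<dots> \<le> cmod \<zeta> * norm ?v + cmod \<zeta> * (norm ?v * K)"
        unfolding norm_scaleR
        by (intro add_mono mult_mono K(2)) (auto simp: abs_Re_le_cmod abs_Im_le_cmod)
      also have "\<dots> = cmod \<zeta> * ((1 + K) * norm ?v)" by (simp add: algebra_simps)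
      also have "\<dots> \<le> (r + 2) * ((1 + K) * norm ?v)"
        by (rule mult_right_mono) (use that K(1) in auto)
      also have "\<dots> < (r + 2) * ((1 + K) * R')"
        using v r K(1) by (intro mult_strict_left_mono) auto
      also have "\<dots> = R' * ((1 + K) * (r + 2))" by (simp only: mult_ac)
      also have "\<dots> = R"
      proof -
        have "(1 + K) * (r + 2) \<noteq> 0" using r K(1) by (simp add: add_eq_0_iff)
        then show ?thesis unfolding R'_def by (rule nonzero_eq_divide_eq[THEN iffD1, OF _ refl])
      qed
      finally have "norm (Re \<zeta> *\<^sub>R ?v + Im \<zeta> *\<^sub>R J ?v) < R" .
      moreover have "dist (?c \<zeta>) (\<Psi> z0) = norm (Re \<zeta> *\<^sub>R ?v + Im \<zeta> *\<^sub>R J ?v)"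
        by (simp add: dist_norm add.assoc)
      ultimately show ?thesis unfolding mem_ball by (subst dist_commute) (simp only:)
    qed
    have "(\<lambda>\<zeta>. ?G (?c \<zeta>)) holomorphic_on ball 0 (r + 2)"
      by (rule holomorphic_on_subset[OF has_derivative_holomorphic[OF inv_fun(4) complex_lin[OF g]]])
        (use c_ball R(2) in auto)
    moreover have "cmod (?G (?c \<zeta>)) \<le> exp \<bar>b\<bar> * M" if "\<zeta> \<in> ball 0 (r + 2)" for \<zeta>
    proof -
      have "snd (\<sigma> (?c \<zeta>)) \<in> ball 0 1" using R(2) c_ball[OF that] by blast
      then have "\<bar>snd (\<sigma> (?c \<zeta>))\<bar> \<le> 1" by simp
      then have "\<bar>b * snd (\<sigma> (?c \<zeta>))\<bar> \<le> \<bar>b\<bar> * 1"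
        unfolding abs_mult by (rule mult_left_mono) simp
      then have "exp (b * snd (\<sigma> (?c \<zeta>))) \<le> exp \<bar>b\<bar>" by simp
      then show ?thesis unfolding cone_def norm_mult by (intro mult_mono) (auto simp: M)
    qed
    ultimately have "cmod (?G (?c 1) - ?G (?c 0)) \<le> exp \<bar>b\<bar> * M / r"
      by (rule holomorphic_increment_bound[OF _ r])
    moreover have "exp \<bar>b\<bar> * M / r = \<epsilon> * M" by (simp add: r_def)
    moreover have "?G (?c 1) = g q" "?G (?c 0) = g p"
      using q homeomorphism_apply1[OF inv_fun(6)] inv_fun(3) p by (auto simp: W_def cone_def c z0_def)
    ultimately show "cmod (g q - g p) \<le> \<epsilon> * M" by simp
  qed
qed

text \<open>Neighbourhoods with constant \<open>1/2\<close> cover the compact space. If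
  \<open>g\<close> vanishes at their centres, the maximum of its modulus is at most half of
  itself.\<close>

lemma cr_weight_determined:
  assumes X: "compact (UNIV :: 'a set)"
  shows "\<exists>S. finite S \<and> (\<forall>g q. cr_weight b g \<longrightarrow> (\<forall>p\<in>S. g p = 0) \<longrightarrow> g q = 0)"
proof -
  have "\<exists>W. open W \<and> p \<in> W \<and> (\<forall>g M q. cr_weight b g \<longrightarrow> (\<forall>q. cmod (g q) \<le> M) \<longrightarrow> q \<in> W \<longrightarrow>
      cmod (g q - g p) \<le> (1/2) * M)" for p
    by (rule cr_weight_equicontinuous[of "1/2" p b]) auto
  then obtain W where W: "\<And>p. open (W p)" "\<And>p. p \<in> W p"
    "\<And>p g M q. cr_weight b g \<Longrightarrow> (\<And>q. cmod (g q) \<le> M) \<Longrightarrow> q \<in> W p \<Longrightarrow> cmod (g q - g p) \<le> (1/2) * M"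
    by metis
  have "UNIV \<subseteq> (\<Union>p\<in>UNIV. W p)" using W(2) by blast
  then obtain S where S: "finite S" "UNIV \<subseteq> (\<Union>p\<in>S. W p)"
    by (rule compactE_image[OF X W(1)]) blast
  show ?thesis
  proof (intro exI[of _ S] conjI S(1) allI impI)
    fix g q assume g: "cr_weight b g" and 0: "\<forall>p\<in>S. g p = 0"
    have "continuous_on UNIV (\<lambda>q. cmod (g q))"
      by (intro continuous_on_norm smooth_map_continuous[OF cr_weight_smooth[OF g]])
    then obtain q0 where q0: "\<And>q. cmod (g q) \<le> cmod (g q0)"
      using continuous_attains_sup[OF X] by auto
    obtain p where "p \<in> S" "q0 \<in> W p" using S(2) by blast
    then have "cmod (g q0) \<le> (1/2) * cmod (g q0)" using W(3)[OF g q0, of q0 p] 0 by simp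
    then have "cmod (g q0) = 0" using norm_ge_zero[of "g q0"] by linarith
    then show "g q = 0" using q0[of q] by simp
  qed
qed

end

text \<open>Evaluation at \<open>q\<close> vanishes on the common kernel of the evaluations in
  \<open>S\<close>, hence is a combination of them. The induction splits off a point
  \<open>a\<close> using some \<open>h\<close> in \<open>H\<close> that is nonzero there;
  \<open>H\<close> stands for a vector space of functions.\<close>

lemma functional_combination:
  fixes H :: "('a \<Rightarrow> complex) set"
  assumes "finite S"
    and "\<And>c g h. g \<in> H \<Longrightarrow> h \<in> H \<Longrightarrow> (\<lambda>q. g q - c * h q) \<in> H"
    and "\<And>g. g \<in> H \<Longrightarrow> (\<And>p. p \<in> S \<Longrightarrow> g p = 0) \<Longrightarrow> g q = 0"
  shows "\<exists>e. \<forall>g\<in>H. g q = (\<Sum>p\<in>S. e p * g p)"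
  using assms
proof (induction S arbitrary: H rule: finite_induct)
  case empty
  then show ?case by auto
next
  case (insert a S)
  let ?H = "{g \<in> H. g a = 0}"
  have "\<exists>e. \<forall>g\<in>?H. g q = (\<Sum>p\<in>S. e p * g p)"
  proof (rule insert.IH)
    show "(\<lambda>q. g q - c * h q) \<in> ?H" if "g \<in> ?H" "h \<in> ?H" for c g h
      using that insert.prems(1) by simp
    show "g q = 0" if "g \<in> ?H" "\<And>p. p \<in> S \<Longrightarrow> g p = 0" for g
      by (rule insert.prems(2)) (use that in auto)
  qed
  then obtain e where e: "\<And>g. g \<in> H \<Longrightarrow> g a = 0 \<Longrightarrow> g q = (\<Sum>p\<in>S. e p * g p)" by blast
  show ?case
  proof (cases "\<exists>h\<in>H. h a \<noteq> 0")
    case False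
    then have "\<forall>g\<in>H. g q = (\<Sum>p\<in>insert a S. e p * g p)" using e insert.hyps by auto
    then show ?thesis by blast
  next
    case True
    then obtain h where h: "h \<in> H" "h a \<noteq> 0" by blast
    let ?e = "\<lambda>p. if p = a then (h q - (\<Sum>p\<in>S. e p * h p)) / h a else e p"
    have "g q = (\<Sum>p\<in>insert a S. ?e p * g p)" if "g \<in> H" for g
    proof -
      let ?k = "\<lambda>p. g p - (g a / h a) * h p"
      have "?k \<in> H" by (rule insert.prems(1)[OF that h(1)])
      moreover have "?k a = 0" using h(2) by simp
      ultimately have "?k q = (\<Sum>p\<in>S. e p * ?k p)" by (rule e)
      also have "\<dots> = (\<Sum>p\<in>S. e p * g p) - (g a / h a) * (\<Sum>p\<in>S. e p * h p)"
        unfolding right_diff_distrib sum_subtractf sum_distrib_left by (simp only: mult.left_commute)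
      finally have "g q = (g a / h a) * (h q - (\<Sum>p\<in>S. e p * h p)) + (\<Sum>p\<in>S. e p * g p)"
        by (simp only: right_diff_distrib) (simp add: diff_eq_eq)
      also have "(\<Sum>p\<in>S. e p * g p) = (\<Sum>p\<in>S. ?e p * g p)"
        by (rule sum.cong[OF refl]) (use insert.hyps(2) in auto)
      also have "(g a / h a) * (h q - (\<Sum>p\<in>S. e p * h p)) = ?e a * g a"
        by (simp only: if_True simp_thms times_divide_eq_left times_divide_eq_right mult.commute)
      finally show ?thesis by (simp only: sum.insert[OF insert.hyps])
    qed
    then show ?thesis by (intro exI[of _ ?e] ballI)
  qed
qed

section \<open>Smooth families of functions\<close>

lemma smooth_on_slice:
  fixes H :: "real \<times> 'e::euclidean_space \<Rightarrow> 'f::real_normed_vector"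
  assumes D: "open D" and Om: "open Om" and H: "smooth_on (D \<times> Om) H" and s: "s \<in> D"
  shows "smooth_on Om (\<lambda>y. H (s, y))"
    and "y \<in> Om \<Longrightarrow> iter_deriv vs (\<lambda>y. H (s, y)) y = iter_deriv (map (Pair 0) vs) H (s, y)"
proof -
  have d: "((\<lambda>y. H (s, y)) has_derivative (\<lambda>v. frechet_derivative H (at (s, y)) (0, v))) (at y)"
    if "smooth_on (D \<times> Om) H" "y \<in> Om" for H :: "real \<times> 'e \<Rightarrow> 'f" and y
    by (rule has_derivative_compose[where f = "\<lambda>y. (s, y)" and g = H])
      (auto intro!: derivative_eq_intros smooth_on_has_derivative[OF that(1)] simp: s that(2))
  show iter: "iter_deriv vs (\<lambda>y. H (s, y)) y = iter_deriv (map (Pair 0) vs) H (s, y)" if "y \<in> Om" for vs y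
    using H that
  proof (induction vs arbitrary: H y)
    case (Cons v vs)
    have "iter_deriv (v # vs) (\<lambda>y. H (s, y)) y = iter_deriv vs (\<lambda>y. frechet_derivative H (at (s, y)) (0, v)) y"
      unfolding iter_deriv.simps
      by (rule iter_deriv_cong[OF Om _ Cons.prems(2)]) (simp add: frechet_derivative_at[OF d[OF Cons.prems(1)], symmetric])
    also have "\<dots> = iter_deriv (map (Pair 0) vs) (\<lambda>z. frechet_derivative H (at z) (0, v)) (s, y)"
      by (rule Cons.IH[OF smooth_on_frechet_derivative[OF Cons.prems(1)] Cons.prems(2)])
    finally show ?case by simp
  qed simp
  have "iter_deriv vs (\<lambda>y. H (s, y)) differentiable (at y)" if y: "y \<in> Om" for vs y
  proof -
    have "(\<lambda>y. iter_deriv (map (Pair 0) vs) H (s, y)) differentiable (at y)"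
      using d[OF smooth_on_iter_deriv[OF H] y] by (rule differentiableI)
    then show ?thesis
      using differentiable_cong_open[OF Om y, of "iter_deriv vs (\<lambda>y. H (s, y))"
          "\<lambda>y. iter_deriv (map (Pair 0) vs) H (s, y)"] iter[of _ vs] by simp
  qed
  then show "smooth_on Om (\<lambda>y. H (s, y))" by (simp add: smooth_on_def)
qed

context manifold
begin

definition smooth_family :: "real set \<Rightarrow> (real \<Rightarrow> 'a \<Rightarrow> 'f::real_normed_vector) \<Rightarrow> bool" where
  "smooth_family D \<Phi> \<longleftrightarrow> (\<forall>(U, w)\<in>A. smooth_on (D \<times> w ` U) (\<lambda>z. \<Phi> (fst z) (inv_into U w (snd z))))"

lemma smooth_familyD:
  "smooth_family D \<Phi> \<Longrightarrow> (U, w) \<in> A \<Longrightarrow> smooth_on (D \<times> w ` U) (\<lambda>z. \<Phi> (fst z) (inv_into U w (snd z)))"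
  unfolding smooth_family_def by blast

lemma smooth_familyI:
  "(\<And>U w. (U, w) \<in> A \<Longrightarrow> smooth_on (D \<times> w ` U) (\<lambda>z. \<Phi> (fst z) (inv_into U w (snd z)))) \<Longrightarrow> smooth_family D \<Phi>"
  unfolding smooth_family_def by blast

lemma smooth_family_smooth_map:
  assumes D: "open D" and \<Phi>: "smooth_family D \<Phi>" and s: "s \<in> D"
  shows "smooth_map A (\<Phi> s)"
proof (rule smooth_mapI)
  fix U w assume c: "(U, w) \<in> A" "open (w ` U)"
  show "smooth_on (w ` U) (\<lambda>y. \<Phi> s (inv_into U w y))"
    using smooth_on_slice(1)[OF D c(2) smooth_familyD[OF \<Phi> c(1)] s] by simp
qed

lemma smooth_family_const:
  assumes D: "open D" and g: "smooth_map A g"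
  shows "smooth_family D (\<lambda>s. g)"
proof (rule smooth_familyI)
  fix U w assume c: "(U, w) \<in> A"
  have o: "open (D \<times> w ` U)" using D chart_open(2)[OF c] by (rule open_Times)
  show "smooth_on (D \<times> w ` U) (\<lambda>z. g (inv_into U w (snd z)))"
    by (rule smooth_on_compose[OF o chart_open(2)[OF c] smooth_mapD[OF g c] smooth_on_linear[OF o bounded_linear_snd]]) auto
qed

lemma smooth_family_param:
  assumes D: "open D"
  shows "smooth_family D (\<lambda>s p. s)"
proof (rule smooth_familyI)
  fix U w assume c: "(U, w) \<in> A"
  have o: "open (D \<times> w ` U)" using D chart_open(2)[OF c] by (rule open_Times)
  show "smooth_on (D \<times> w ` U) (\<lambda>z. fst z)" by (rule smooth_on_linear[OF o bounded_linear_fst])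
qed

lemma smooth_family_add:
  assumes D: "open D" and "smooth_family D \<Phi>" "smooth_family D \<Psi>"
  shows "smooth_family D (\<lambda>s p. \<Phi> s p + \<Psi> s p)"
  by (rule smooth_familyI) (intro smooth_on_add open_Times D chart_open(2) smooth_familyD assms(2,3))

lemma smooth_family_mult:
  fixes \<Phi> \<Psi> :: "real \<Rightarrow> 'a \<Rightarrow> real"
  assumes D: "open D" and "smooth_family D \<Phi>" "smooth_family D \<Psi>"
  shows "smooth_family D (\<lambda>s p. \<Phi> s p * \<Psi> s p)"
  by (rule smooth_familyI) (intro smooth_on_mult open_Times D chart_open(2) smooth_familyD assms(2,3))

text \<open>Derivatives on a slice are joint derivatives in directions \<open>(0, v)\<close>, hence
  continuous in parameter and point together. A strict bound on the compact set \<open>K\<close> at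
  one parameter then persists nearby by the tube lemma.\<close>

lemma smooth_family_continuous_map:
  fixes \<Phi> :: "real \<Rightarrow> 'a \<Rightarrow> real"
  assumes D: "open D" and \<Phi>: "smooth_family D \<Phi>" and J: "J \<subseteq> D" and "A \<noteq> {}"
  shows "continuous_map (top_of_set J) (smooth_topology A) \<Phi>"
  unfolding smooth_topology_def
proof (rule continuous_on_generated_topo)
  let ?\<B> = "{smooth_nbhd A (U, x) K vs \<epsilon> f | U x K vs \<epsilon> f.
        (U, x) \<in> A \<and> compact K \<and> K \<subseteq> x ` U \<and> \<epsilon> > 0 \<and> smooth_map A f}"
  have sm: "smooth_map A (\<Phi> s)" if "s \<in> J" for s
    using smooth_family_smooth_map[OF D \<Phi>] that J by blast
  show "\<Phi> ` topspace (top_of_set J) \<subseteq> \<Union>?\<B>"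
    using topspace_smooth_topology[OF \<open>A \<noteq> {}\<close>] sm
    by (auto simp: smooth_topology_def topology_generated_by_topspace)
  fix N assume "N \<in> ?\<B>"
  then obtain U w K vs \<epsilon> g where N: "N = smooth_nbhd A (U, w) K vs \<epsilon> g" and c: "(U, w) \<in> A"
    and K: "compact K" "K \<subseteq> w ` U" and \<epsilon>: "\<epsilon> > 0" and g: "smooth_map A g" by blast
  let ?O = "D \<times> w ` U"
  have o: "open ?O" using D chart_open(2)[OF c] by (rule open_Times)
  let ?f = "iter_deriv (map (Pair 0) vs) (\<lambda>z. \<Phi> (fst z) (inv_into U w (snd z)))"
  have s\<Phi>: "smooth_on ?O ?f" by (rule smooth_on_iter_deriv[OF smooth_familyD[OF \<Phi> c]])
  let ?g = "\<lambda>z. iter_deriv vs (\<lambda>y. g (inv_into U w y)) (snd z)"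
  have sg: "continuous_on ?O ?g"
    by (rule continuous_on_compose2[OF smooth_on_continuous_on[OF smooth_on_iter_deriv[OF smooth_mapD[OF g c]]]])
      (auto intro!: continuous_intros)
  have "open (?O \<inter> (\<lambda>z. \<bar>?f z - ?g z\<bar>) -` {..<\<epsilon>})"
    by (intro continuous_open_preimage o continuous_on_rabs continuous_on_diff smooth_on_continuous_on[OF s\<Phi>] sg open_lessThan)
  note W = this
  have mem: "\<Phi> s \<in> N \<longleftrightarrow> {s} \<times> K \<subseteq> ?O \<inter> (\<lambda>z. \<bar>?f z - ?g z\<bar>) -` {..<\<epsilon>}" if "s \<in> J" for s
  proof -
    have "s \<in> D" using that J by blast
    then have "iter_deriv vs (\<lambda>y. \<Phi> s (inv_into U w y)) y = ?f (s, y)" if "y \<in> K" for y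
      using smooth_on_slice(2)[OF D chart_open(2)[OF c] smooth_familyD[OF \<Phi> c], of s y vs] that K(2) by auto
    then show ?thesis using sm[OF \<open>s \<in> J\<close>] \<open>s \<in> D\<close> K(2)
      by (auto simp: N smooth_nbhd_def o_def)
  qed
  have "\<exists>X. open X \<and> s \<in> X \<and> J \<inter> X \<subseteq> \<Phi> -` N" if s: "s \<in> J" "\<Phi> s \<in> N" for s
  proof -
    obtain X where X: "s \<in> X" "open X" "X \<times> K \<subseteq> ?O \<inter> (\<lambda>z. \<bar>?f z - ?g z\<bar>) -` {..<\<epsilon>}"
      using Elementary_Topology.tube_lemma[OF K(1) W] mem[OF s(1)] s(2) by blast
    have "\<Phi> t \<in> N" if "t \<in> J" "t \<in> X" for t
      using X(3) that mem[OF that(1)] by blast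
    then show ?thesis using X by blast
  qed
  note claim = this
  let ?X = "\<Union>{X. open X \<and> J \<inter> X \<subseteq> \<Phi> -` N}"
  have "open ?X" by (rule open_Union) blast
  moreover have "\<Phi> -` N \<inter> J = J \<inter> ?X"
  proof (intro equalityI subsetI)
    show "s \<in> J \<inter> ?X" if "s \<in> \<Phi> -` N \<inter> J" for s using claim[of s] that by blast
    show "s \<in> \<Phi> -` N \<inter> J" if "s \<in> J \<inter> ?X" for s using that by blast
  qed
  ultimately show "openin (top_of_set J) (\<Phi> -` N \<inter> topspace (top_of_set J))"
    unfolding openin_open topspace_euclidean_subtopology by blast
qed

end

section \<open>Deforming sphere maps\<close>

text \<open>As \<open>T\<close> annihilates \<open>\<psi>\<close>, the second deformation does not
  see the \<open>T\<close> component added by the first.\<close>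

lemma (in cr) deformed_deformed:
  assumes "\<And>p. T p (\<lambda>q. of_real (\<psi> q)) = 0" "smooth_map A \<phi>" "smooth_map A \<psi>"
  shows "deformed (deformed E T \<phi>) T \<psi> = deformed E T (\<lambda>q. \<phi> q + \<psi> q)"
proof
  fix p
  let ?d = "\<lambda>\<phi> Z. Z - cscale (\<i> * Z (\<lambda>q. complex_of_real (\<phi> q))) (T p)"
  have im: "deformed E' T \<phi> p = ?d \<phi> ` E' p" for E' \<phi> by (auto simp: deformed_def)
  have "?d \<psi> (?d \<phi> Z) = ?d (\<lambda>q. \<phi> q + \<psi> q) Z" if Z: "Z \<in> E p" for Z
    using ctangent_add[OF E_ctangent[OF Z] smooth_map_of_real[OF assms(2)] smooth_map_of_real[OF assms(3)]]
    by (simp add: fun_eq_iff cscale_apply assms(1) algebra_simps)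
  then have "(\<lambda>Z. ?d \<psi> (?d \<phi> Z)) ` E p = ?d (\<lambda>q. \<phi> q + \<psi> q) ` E p" by (rule image_cong[OF refl])
  then show "deformed (deformed E T \<phi>) T \<psi> p = deformed E T (\<lambda>q. \<phi> q + \<psi> q) p"
    unfolding im image_image .
qed

lemma (in manifold) ctangent_exp:
  assumes v: "v \<in> ctangent A p" and u: "smooth_map A u"
  shows "v (\<lambda>q. complex_of_real (exp (b * u q))) = of_real (exp (b * u p)) * (of_real b * v (\<lambda>q. of_real (u q)))"
proof -
  have "((\<lambda>t. exp (b * t)) has_vector_derivative exp (b * u p) * b) (at (u p))"
    unfolding has_real_derivative_iff_has_vector_derivative[symmetric]
    by (auto intro!: derivative_eq_intros)
  then have h: "((\<lambda>t. complex_of_real (exp (b * t))) has_vector_derivative of_real (exp (b * u p) * b)) (at (u p))"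
    by (rule bounded_linear.has_vector_derivative[OF bounded_linear_of_real])
  have "smooth_map A (\<lambda>q. complex_of_real (exp (b * u q)))"
    by (intro smooth_map_of_real smooth_map_exp smooth_map_cmult u)
  from ctangent_chain[OF v u h this] show ?thesis by simp
qed

context cr_sphere
begin

lemma sum_\<beta>_pos:
  assumes "\<And>j. y j \<ge> 0" "(\<Sum>j\<in>UNIV. y j) = (1::real)"
  shows "(\<Sum>j\<in>UNIV. \<beta> $ j * y j) > 0"
proof -
  obtain j where "y j \<noteq> 0" using assms(2) by (metis sum.neutral zero_neq_one)
  then have "\<beta> $ j * y j > 0" using assms(1)[of j] \<beta>_pos[of j] by simp
  then show ?thesis
    using assms(1) \<beta>_pos by (intro sum_pos2[of UNIV j]) (simp_all add: less_imp_le)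
qed

text \<open>Differentiating the equation along \<open>T\<close>, which annihilates every
  \<open>x j\<close>, leaves a positive multiple of \<open>T u\<close>. The factor
  \<open>exp (\<beta> $ j * u q)\<close> compensates the \<open>T\<close> component that
  \<open>deformed\<close> adds. A vector killed by all new components sends \<open>f j\<close> to
  \<open>- \<beta> $ j * f j\<close> times its value on \<open>u\<close>, and likewise the
  conjugate; since the \<open>x j\<close> sum to 1, its value on \<open>u\<close> is 0 and the old
  immersion property applies.\<close>

lemma
  assumes u: "smooth_map A u" and k: "\<And>j. k j > 0"
    and eq: "\<And>p. (\<Sum>j\<in>UNIV. exp (2 * \<beta> $ j * u p) * (k j)\<^sup>2 * x j p) = 1"
  shows T_deformation: "T p (\<lambda>q. of_real (u q)) = 0"
    and cr_sphere_deformed: "cr_sphere A (deformed E T u) T (\<lambda>j q. of_real (k j) * of_real (exp (\<beta> $ j * u q)) * f j q) \<beta>"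
proof -
  let ?u = "\<lambda>q. complex_of_real (u q)"
  let ?e = "\<lambda>j q. complex_of_real (exp (\<beta> $ j * u q))"
  let ?f = "\<lambda>j q. of_real (k j) * ?e j q * f j q"
  have e_smooth: "smooth_map A (\<lambda>q. complex_of_real (exp (b * u q)))" for b
    by (intro smooth_map_of_real smooth_map_exp smooth_map_cmult u)
  have f'_smooth: "smooth_map A (?f j)" for j
    by (intro smooth_map_mult smooth_map_const e_smooth f_smooth)
  show Tu: "T p ?u = 0" for p
  proof -
    let ?y = "\<lambda>j. exp (2 * \<beta> $ j * u p) * (k j)\<^sup>2 * x j p"
    define S where "S = (\<Sum>j\<in>UNIV. \<beta> $ j * ?y j)"
    have S: "S > 0" unfolding S_def by (rule sum_\<beta>_pos[OF _ eq]) (simp add: x_nonneg)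
    have s: "smooth_map A (\<lambda>q. complex_of_real (exp ((2 * \<beta> $ j) * u q)))" "smooth_map A (\<lambda>q. (of_real (k j))\<^sup>2 * complex_of_real (x j q))" for j
      by (rule e_smooth) (intro smooth_map_cmult smooth_map_of_real x_smooth)
    have "0 = T p (\<lambda>q. complex_of_real (\<Sum>j\<in>UNIV. exp (2 * \<beta> $ j * u q) * (k j)\<^sup>2 * x j q))"
      using ctangent_const[OF T_ctangent] unfolding eq by simp
    also have "\<dots> = T p (\<lambda>q. \<Sum>j\<in>UNIV. of_real (exp ((2 * \<beta> $ j) * u q)) * ((of_real (k j))\<^sup>2 * of_real (x j q)))"
      by (simp add: mult.assoc)
    also have "\<dots> = (\<Sum>j\<in>UNIV. of_real (?y j) * (2 * of_real (\<beta> $ j) * T p ?u))"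
      unfolding ctangent_sum[OF T_ctangent finite smooth_map_mult[OF s]] ctangent_mult[OF T_ctangent s]
        ctangent_exp[OF T_ctangent u] ctangent_cmult[OF T_ctangent smooth_map_of_real[OF x_smooth]] T_x
      by (rule sum.cong[OF refl]) (simp add: algebra_simps)
    also have "\<dots> = 2 * T p ?u * of_real S"
      unfolding S_def of_real_sum sum_distrib_left by (rule sum.cong[OF refl]) (simp only: of_real_mult mult_ac)
    finally show ?thesis using S by simp
  qed
  have vf: "v (?f j) = of_real (k j) * (?e j p * (\<beta> $ j * v ?u * f j p + v (f j)))"
    "v (\<lambda>q. cnj (?f j q)) = of_real (k j) * (?e j p * (\<beta> $ j * v ?u * cnj (f j p) + v (\<lambda>q. cnj (f j q))))"
    if v: "v \<in> ctangent A p" for v :: "'a cvec" and p j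
  proof -
    have "v (\<lambda>q. of_real (k j) * (?e j q * g q)) = of_real (k j) * (?e j p * (\<beta> $ j * v ?u * g p + v g))"
      if g: "smooth_map A g" for g :: "'a \<Rightarrow> complex"
      unfolding ctangent_cmult[OF v smooth_map_mult[OF e_smooth g]] ctangent_mult[OF v e_smooth g] ctangent_exp[OF v u]
      by (simp add: algebra_simps)
    from this[OF f_smooth] this[OF f_cnj_smooth]
    show "v (?f j) = of_real (k j) * (?e j p * (\<beta> $ j * v ?u * f j p + v (f j)))"
      "v (\<lambda>q. cnj (?f j q)) = of_real (k j) * (?e j p * (\<beta> $ j * v ?u * cnj (f j p) + v (\<lambda>q. cnj (f j q))))"
      by (simp_all add: mult.assoc)
  qed
  have cr': "cr A (deformed E T u) T" by (rule cr_deformed[OF u Tu])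
  show "cr_sphere A (deformed E T u) T ?f \<beta>"
  proof (intro cr_sphere.intro[OF cr'] cr_sphere_axioms.intro)
    show "\<beta> $ j > 0" for j by (rule \<beta>_pos)
    show "cr.cr_weight A (deformed E T u) T (\<beta> $ j) (?f j)" for j
      unfolding cr.cr_weight_def[OF cr']
    proof (intro conjI allI ballI f'_smooth)
      show "T p (?f j) = \<i> * (\<beta> $ j) * ?f j p" for p
        unfolding vf[OF T_ctangent] Tu T_f by (simp add: algebra_simps)
      fix p Z' assume "Z' \<in> deformed E T u p"
      then obtain Z where Z: "Z \<in> E p" "Z' = Z - cscale (\<i> * Z ?u) (T p)" unfolding deformed_eq by blast
      have "Z' \<in> ctangent A p"
        unfolding Z(2) by (intro diff_ctangent cscale_ctangent T_ctangent E_ctangent[OF Z(1)])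
      note vf' = vf(2)[OF this]
      have "Z' ?u = Z ?u" "Z' (\<lambda>q. cnj (f j q)) = - \<beta> $ j * Z ?u * cnj (f j p)"
        using E_f_cnj[OF Z(1)] unfolding Z(2) by (simp_all add: cscale_apply Tu T_f_cnj algebra_simps)
      then show "Z' (\<lambda>q. cnj (?f j q)) = 0" unfolding vf' by simp
    qed
    have norm_f': "(cmod (?f j p))\<^sup>2 = exp (2 * \<beta> $ j * u p) * (k j)\<^sup>2 * x j p" for j p
    proof -
      have "(exp (\<beta> $ j * u p))\<^sup>2 = exp (2 * \<beta> $ j * u p)"
        by (simp add: power2_eq_square exp_add[symmetric] algebra_simps)
      then show ?thesis by (simp add: norm_mult power_mult_distrib x_def algebra_simps)
    qed
    show "(\<Sum>j\<in>UNIV. (cmod (?f j p))\<^sup>2) = 1" for p unfolding norm_f' by (rule eq)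
    show "v = 0" if v: "v \<in> ctangent A p" and 0: "\<And>j. v (?f j) = 0" "\<And>j. v (\<lambda>q. cnj (?f j q)) = 0" for v p
    proof -
      have nz: "of_real (k j) * ?e j p \<noteq> 0" for j using k[of j] by simp
      have 1: "\<beta> $ j * v ?u * f j p + v (f j) = 0" "\<beta> $ j * v ?u * cnj (f j p) + v (\<lambda>q. cnj (f j q)) = 0" for j
        using 0[of j] nz[of j] unfolding vf[OF v] mult.assoc[symmetric] by simp_all
      have "v (\<lambda>q. of_real (x j q)) + 2 * v ?u * (\<beta> $ j * of_real (x j p)) = 0" for j
      proof -
        have "v (\<lambda>q. of_real (x j q)) + 2 * v ?u * (\<beta> $ j * of_real (x j p)) =
            (\<beta> $ j * v ?u * f j p + v (f j)) * cnj (f j p) + f j p * (\<beta> $ j * v ?u * cnj (f j p) + v (\<lambda>q. cnj (f j q)))"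
          unfolding ctangent_x[OF v] by (simp add: algebra_simps of_real_x[of j p])
        then show ?thesis by (simp only: 1) simp
      qed
      then have "0 = (\<Sum>j\<in>UNIV. v (\<lambda>q. of_real (x j q)) + 2 * v ?u * (\<beta> $ j * of_real (x j p)))" by simp
      also have "\<dots> = 2 * v ?u * of_real (B p)"
        unfolding sum.distrib ctangent_sum_x[OF v] sum_distrib_left[symmetric] by (simp add: B_def)
      finally have "v ?u = 0" using B_pos[of p] by simp
      then show "v = 0" using 1 by (intro immersion[OF v]) simp_all
    qed
    show "p = q" if *: "\<And>j. ?f j p = ?f j q" for p q
    proof -
      \<comment> \<open>Equal images put the values of \<open>f\<close> at \<open>p\<close> and
        \<open>q\<close> on one orbit of the weighted real dilations. The squared norm is strictly
        monotone along it, so both norms being 1 forces \<open>t = 0\<close>.\<close>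
      define t where "t = u q - u p"
      have fj: "f j p = of_real (exp (\<beta> $ j * t)) * f j q" for j
      proof -
        have "?e j p * f j p = ?e j q * f j q" using *[of j] k[of j] by simp
        then have "f j p = inverse (?e j p) * ?e j q * f j q" by (simp add: field_simps)
        also have "inverse (?e j p) * ?e j q = of_real (exp (\<beta> $ j * t))"
          by (simp add: t_def exp_minus[symmetric] exp_add[symmetric] of_real_inverse[symmetric] of_real_mult[symmetric]
              algebra_simps del: of_real_mult of_real_inverse)
        finally show ?thesis .
      qed
      have xj: "x j p = exp (2 * (\<beta> $ j * t)) * x j q" for j
        unfolding x_def fj by (simp add: norm_mult power_mult_distrib exp_double)
      have "(\<Sum>j\<in>UNIV. (exp (2 * (\<beta> $ j * t)) - 1) * x j q) = 0"
        using x_sum[of p] x_sum[of q] by (simp add: xj left_diff_distrib sum_subtractf)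
      moreover obtain j where j: "x j q > 0"
        using x_sum[of q] x_nonneg by (metis less_eq_real_def sum.neutral zero_neq_one)
      moreover have "(\<Sum>j\<in>UNIV. (exp (2 * (\<beta> $ j * t)) - 1) * x j q) > 0" if "t > 0"
        using that \<beta>_pos x_nonneg j by (intro sum_pos2[of UNIV j]) (auto simp: less_imp_le)
      moreover have "(\<Sum>j\<in>UNIV. (1 - exp (2 * (\<beta> $ j * t))) * x j q) > 0" if "t < 0"
        using that \<beta>_pos x_nonneg j by (intro sum_pos2[of UNIV j]) (auto simp: less_imp_le mult_pos_neg)
      moreover have "(\<Sum>j\<in>UNIV. (1 - exp (2 * (\<beta> $ j * t))) * x j q) = - (\<Sum>j\<in>UNIV. (exp (2 * (\<beta> $ j * t)) - 1) * x j q)"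
        by (simp add: sum_negf[symmetric] algebra_simps)
      ultimately have "t = 0" by (cases t "0::real" rule: linorder_cases) auto
      then show ?thesis using fj by (intro separates) simp
    qed
  qed
qed

text \<open>If all \<open>x j\<close> were constant, \<open>E_x\<close> would give
  \<open>cnj (f j p) * Z (f j) = 0\<close>, hence \<open>Z (f j) = 0\<close>, because a component
  that vanishes at \<open>p\<close> would vanish everywhere. This contradicts the immersion
  property.\<close>

lemma nonconstant_x:
  assumes "Z \<in> E p" "Z \<noteq> 0"
  obtains k q q' where "x k q \<noteq> x k q'"
proof (rule ccontr)
  assume "\<not> thesis"
  then have const: "x j q = x j p" for j q using that by metis
  have "Z (f j) = 0" for j
  proof (cases "f j p = 0")
    case True
    then have "x j q = 0" for q using const[of j q] by (simp add: x_def)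
    then have "f j = (\<lambda>q. 0)" by (simp add: x_def fun_eq_iff)
    then show ?thesis using ctangent_const[OF E_ctangent[OF assms(1)]] by simp
  next
    case False
    have "(\<lambda>q. complex_of_real (x j q)) = (\<lambda>q. of_real (x j p))"
      by (rule ext, rule arg_cong[OF const])
    then have "Z (\<lambda>q. complex_of_real (x j q)) = 0"
      using ctangent_const[OF E_ctangent[OF assms(1)], of "of_real (x j p)"] by (simp only:)
    then show ?thesis using False by (simp add: E_x[OF assms(1)])
  qed
  then show False using immersion[OF E_ctangent[OF assms(1)] _ E_f_cnj[OF assms(1)]] assms(2) by blast
qed

text \<open>The ratios sum to \<open>1 / B\<close>. If all of them were constant, so would be
  \<open>B\<close> and then every \<open>x k\<close>.\<close>

lemma nonconstant_ratio:
  assumes "Z \<in> E p" "Z \<noteq> 0"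
  obtains k q q' where "x k q / B q \<noteq> x k q' / B q'"
proof (rule ccontr)
  assume "\<not> thesis"
  then have eq: "x j q / B q = x j q' / B q'" for j q q' using that by metis
  have "1 / B q = 1 / B q'" for q q'
  proof -
    have "(\<Sum>j\<in>UNIV. x j q / B q) = (\<Sum>j\<in>UNIV. x j q' / B q')"
      using eq by (intro sum.cong) auto
    then show ?thesis unfolding sum_divide_distrib[symmetric] x_sum .
  qed
  note inv = this
  have Beq: "B q = B q'" for q q'
    using inv[of q q'] B_pos[of q] B_pos[of q'] by (simp add: field_simps)
  have "x j q = x j q'" for j q q'
    using eq[of j q q'] Beq[of q q'] B_pos[of q'] by simp
  then show False using nonconstant_x[OF assms] by blast
qed

end

section \<open>Exponential sums\<close>

lemma exp_sum_mono:
  fixes b w :: "'N::finite \<Rightarrow> real"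
  assumes b: "\<And>j. b j > 0" and w: "\<And>j. w j \<ge> 0" "\<exists>j. w j > 0" and t: "s < t"
  shows "(\<Sum>j\<in>UNIV. exp (b j * s) * w j) < (\<Sum>j\<in>UNIV. exp (b j * t) * w j)"
proof -
  obtain j where j: "w j > 0" using w(2) by blast
  have "(\<Sum>j\<in>UNIV. (exp (b j * t) - exp (b j * s)) * w j) > 0"
    using b w(1) t j by (intro sum_pos2[of UNIV j]) (auto simp: less_imp_le)
  then show ?thesis by (simp add: left_diff_distrib sum_subtractf)
qed

lemma exp_sum_unique:
  fixes b w :: "'N::finite \<Rightarrow> real"
  assumes "\<And>j. b j > 0" "\<And>j. w j \<ge> 0" "\<exists>j. w j > 0"
    and "(\<Sum>j\<in>UNIV. exp (b j * s) * w j) = (\<Sum>j\<in>UNIV. exp (b j * t) * w j)"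
  shows "s = t"
  using exp_sum_mono[of b w s t] exp_sum_mono[of b w t s] assms
  by (cases s t rule: linorder_cases) auto

lemma exp_sum_solution:
  fixes b w :: "'N::finite \<Rightarrow> real"
  assumes b: "\<And>j. b j > 0" and w: "\<And>j. w j \<ge> 0" "\<exists>j. w j > 0"
  obtains t where "(\<Sum>j\<in>UNIV. exp (b j * t) * w j) = 1"
proof -
  define s where "s = (\<Sum>j\<in>UNIV. w j)"
  have s: "s > 0"
  proof -
    obtain j where "w j > 0" using w(2) by blast
    then show ?thesis unfolding s_def using w(1) by (intro sum_pos2[of UNIV j]) auto
  qed
  \<comment> \<open>The sum lies above \<open>exp (b0 * t) * s\<close> for \<open>t \<ge> 0\<close>
    and below it for \<open>t \<le> 0\<close>, so 0 and the point where this single exponential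
    equals 1 enclose a solution.\<close>
  define b0 where "b0 = Min (range b)"
  have b0: "b0 > 0" "\<And>j. b0 \<le> b j" using b by (auto simp: b0_def)
  define t where "t = - ln s / b0"
  have t: "exp (b0 * t) * s = 1" using b0 s by (simp add: t_def exp_minus)
  let ?g = "\<lambda>t. \<Sum>j\<in>UNIV. exp (b j * t) * w j"
  have cont: "continuous_on S ?g" for S by (intro continuous_intros)
  have g0: "?g 0 = s" by (simp add: s_def)
  show thesis
  proof (cases "s \<le> 1")
    case True
    then have "t \<ge> 0" using b0 s by (simp add: t_def divide_nonpos_pos)
    then have "(\<Sum>j\<in>UNIV. exp (b0 * t) * w j) \<le> ?g t"
      using b0 w(1) by (intro sum_mono mult_right_mono) (auto intro: mult_right_mono)
    then have "1 \<le> ?g t" using t by (simp add: s_def sum_distrib_left)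
    then show thesis using IVT'[of ?g 0 1 t] True g0 \<open>t \<ge> 0\<close> cont that by auto
  next
    case False
    then have "t \<le> 0" using b0 by (simp add: t_def)
    then have "?g t \<le> (\<Sum>j\<in>UNIV. exp (b0 * t) * w j)"
      using b0 w(1) by (intro sum_mono mult_right_mono) (auto intro: mult_right_mono_neg)
    then have "?g t \<le> 1" using t by (simp add: s_def sum_distrib_left)
    then show thesis using IVT'[of ?g t 1 0] False g0 \<open>t \<le> 0\<close> cont that by auto
  qed
qed

section \<open>The path of sphere maps through a given one\<close>

context cr_sphere
begin

lemma deformation_path:
  assumes Z: "Z \<in> E p" "Z \<noteq> 0"
  obtains \<Phi> :: "real \<Rightarrow> 'a \<Rightarrow> real" and \<epsilon> where "0 < \<epsilon>" "\<epsilon> \<le> 1" "smooth_family {-1<..<1} \<Phi>" "\<And>p. \<Phi> 0 p = 0"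
    "\<And>s p. s \<in> {-1<..<1} \<Longrightarrow> T p (\<lambda>q. of_real (\<Phi> s q)) = 0"
    "\<And>s. s \<in> {-1<..<1} \<Longrightarrow> \<exists>g. cr_sphere A (deformed E T (\<Phi> s)) T g \<beta>"
    "\<And>s. 0 < s \<Longrightarrow> s < \<epsilon> \<Longrightarrow> \<exists>q q'. \<Phi> s q \<noteq> \<Phi> s q'"
proof -
  obtain k q1 q2 where ratio: "x k q1 / B q1 \<noteq> x k q2 / B q2" by (rule nonconstant_ratio[OF Z])
  let ?D = "{-1<..<1::real}"
  \<comment> \<open>The factor of the squared modulus; the parameter is confined to
    \<open>?D\<close> so that it stays positive.\<close>
  define c where "c j s = 1 + (if j = k then 1 else 0) * s" for j and s :: real
  have c_pos: "c j s > 0" if "s \<in> ?D" for j s using that by (simp add: c_def)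
  have b_pos: "2 * \<beta> $ j > 0" for j using \<beta>_pos[of j] by simp
  have w: "c j s * x j p \<ge> 0" "\<exists>j. c j s * x j p > 0" if "s \<in> ?D" for j s p
  proof -
    show "c j s * x j p \<ge> 0" using c_pos[OF that, of j] x_nonneg[of j p] by simp
    obtain j where "x j p > 0"
      using x_sum[of p] x_nonneg by (metis less_eq_real_def sum.neutral zero_neq_one)
    then show "\<exists>j. c j s * x j p > 0" using c_pos[OF that, of j] by (intro exI[of _ j]) simp
  qed
  define \<Phi> where "\<Phi> s p = (SOME t. (\<Sum>j\<in>UNIV. exp (2 * \<beta> $ j * t) * (c j s * x j p)) = 1)" for s p
  have \<Phi>: "(\<Sum>j\<in>UNIV. exp (2 * \<beta> $ j * \<Phi> s p) * (c j s * x j p)) = 1" if "s \<in> ?D" for s p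
    unfolding \<Phi>_def
    by (rule someI_ex) (rule exp_sum_solution[of "\<lambda>j. 2 * \<beta> $ j" "\<lambda>j. c j s * x j p", OF b_pos w[OF that]], blast)
  have \<Phi>0: "\<Phi> 0 p = 0" for p
  proof -
    have "(\<Sum>j\<in>UNIV. exp (2 * \<beta> $ j * \<Phi> 0 p) * (c j 0 * x j p)) = (\<Sum>j\<in>UNIV. exp (2 * \<beta> $ j * 0) * (c j 0 * x j p))"
      using \<Phi>[of 0 p] x_sum[of p] by (simp add: c_def)
    then show ?thesis
      by (rule exp_sum_unique[of "\<lambda>j. 2 * \<beta> $ j" "\<lambda>j. c j 0 * x j p", OF b_pos w, rotated 2]) auto
  qed
  have family: "smooth_family ?D \<Phi>"
  proof (rule smooth_familyI)
    fix U w assume ch: "(U, w) \<in> A"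
    let ?O = "?D \<times> w ` U"
    let ?O' = "?O \<times> (UNIV :: real set)"
    have o: "open ?O" using chart_open(2)[OF ch] by (intro open_Times) auto
    have o': "open ?O'" by (rule open_Times[OF o open_UNIV])
    let ?w = "\<lambda>j z. c j (fst z) * x j (inv_into U w (snd z))"
    define Q where "Q z = (\<Sum>j\<in>UNIV. exp ((2 * \<beta> $ j) * snd z) * ?w j (fst z)) + - 1" for z :: "(real \<times> 'e) \<times> real"
    have lin: "smooth_on ?O' L" if "bounded_linear L" for L :: "(real \<times> 'e) \<times> real \<Rightarrow> real"
      by (rule smooth_on_linear[OF o' that])
    have sx: "smooth_on ?O' (\<lambda>z. x j (inv_into U w (snd (fst z))))" for j
      by (rule smooth_on_compose[OF o' chart_open(2)[OF ch] smooth_mapD[OF x_smooth ch]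
            smooth_on_linear[OF o' bounded_linear_compose[OF bounded_linear_snd bounded_linear_fst]]]) auto
    have sc: "smooth_on ?O' (\<lambda>z. c j (fst (fst z)))" for j
      unfolding c_def
      by (intro smooth_on_add[OF o'] smooth_on_const[OF o'] lin
          bounded_linear_compose[OF bounded_linear_mult_right bounded_linear_compose[OF bounded_linear_fst bounded_linear_fst]])
    have se: "smooth_on ?O' (\<lambda>z. exp ((2 * \<beta> $ j) * snd z))" for j
      by (intro smooth_on_real_exp[OF o'] lin bounded_linear_compose[OF bounded_linear_mult_right bounded_linear_snd])
    have sQ: "smooth_on ?O' Q"
      unfolding Q_def[abs_def]
      by (intro smooth_on_add[OF o'] smooth_on_const[OF o'] smooth_on_sum[OF o'] smooth_on_mult[OF o'] se sc sx) simp
    show "smooth_on ?O (\<lambda>z. \<Phi> (fst z) (inv_into U w (snd z)))"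
    proof (rule implicit_smooth_on[OF o sQ])
      fix z t assume z: "z \<in> ?O"
      have s: "fst z \<in> ?D" using z by auto
      have d1: "((\<lambda>t. Q (z, t)) has_derivative (\<lambda>h. frechet_derivative Q (at (z, t)) (0, h))) (at t)"
        by (rule has_derivative_compose[where f = "\<lambda>t. (z, t)" and g = Q])
          (use z in \<open>auto intro!: derivative_eq_intros smooth_on_has_derivative[OF sQ]\<close>)
      have d2: "((\<lambda>t. Q (z, t)) has_derivative
          (\<lambda>h. (\<Sum>j\<in>UNIV. (exp ((2 * \<beta> $ j) * t) * ((2 * \<beta> $ j) * h)) * ?w j z))) (at t)"
        unfolding Q_def snd_conv fst_conv
        by (auto intro!: derivative_eq_intros simp: mult_ac)
      have "frechet_derivative Q (at (z, t)) (0, 1) =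
          (\<Sum>j\<in>UNIV. (exp ((2 * \<beta> $ j) * t) * ((2 * \<beta> $ j) * 1)) * ?w j z)"
        by (rule fun_cong[OF has_derivative_unique[OF d1 d2]])
      also have "\<dots> > 0"
      proof -
        obtain j where "?w j z > 0" using w(2)[OF s] by blast
        then show ?thesis
          using w(1)[OF s] b_pos by (intro sum_pos2[of UNIV j]) (auto simp: less_imp_le)
      qed
      finally show "frechet_derivative Q (at (z, t)) (0, 1) > 0" .
    next
      fix z assume "z \<in> ?O"
      then have "fst z \<in> ?D" by auto
      then show "Q (z, \<Phi> (fst z) (inv_into U w (snd z))) = 0" using \<Phi> by (simp add: Q_def)
    qed
  qed
  have sm: "smooth_map A (\<Phi> s)" if "s \<in> ?D" for s
    by (rule smooth_family_smooth_map[OF _ family that]) simp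
  have eq: "(\<Sum>j\<in>UNIV. exp (2 * \<beta> $ j * \<Phi> s p) * (sqrt (c j s))\<^sup>2 * x j p) = 1" if "s \<in> ?D" for s p
    using \<Phi>[OF that, of p] c_pos[OF that] by (simp add: less_imp_le mult.assoc)
  have T0: "T p (\<lambda>q. of_real (\<Phi> s q)) = 0" if "s \<in> ?D" for s p
    by (rule T_deformation[OF sm[OF that] _ eq[OF that]]) (simp add: c_pos[OF that])
  have sph: "\<exists>g. cr_sphere A (deformed E T (\<Phi> s)) T g \<beta>" if "s \<in> ?D" for s
  proof -
    have "cr_sphere A (deformed E T (\<Phi> s)) T (\<lambda>j q. of_real (sqrt (c j s)) * of_real (exp (\<beta> $ j * \<Phi> s q)) * f j q) \<beta>"
      by (rule cr_sphere_deformed[OF sm[OF that] _ eq[OF that]]) (simp add: c_pos[OF that])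
    then show ?thesis by blast
  qed
  \<comment> \<open>Differentiability is inherited from the family. The value follows by
    differentiating the constant sum at 0, where all exponentials are 1:
    \<open>2 * d * B p + x k p = 0\<close>.\<close>
  have der: "((\<lambda>s. \<Phi> s p) has_real_derivative - (x k p / B p) / 2) (at 0)" for p
  proof -
    obtain U w where ch: "(U, w) \<in> A" and p: "p \<in> U" by (rule chart_exists)
    let ?H = "\<lambda>z. \<Phi> (fst z) (inv_into U w (snd z))"
    have "(?H has_derivative frechet_derivative ?H (at (0, w p))) (at (0, w p))"
      by (rule smooth_on_has_derivative[OF smooth_familyD[OF family ch]]) (use p in auto)
    then have "((\<lambda>s. ?H (s, w p)) has_derivative (\<lambda>h. frechet_derivative ?H (at (0, w p)) (h, 0))) (at 0)"
      by (intro has_derivative_compose[where f = "\<lambda>s. (s, w p)" and g = ?H]) (auto intro!: derivative_eq_intros)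
    then have "(\<lambda>s. \<Phi> s p) differentiable (at 0)" using ch p by (simp add: differentiableI)
    then obtain d where d: "((\<lambda>s. \<Phi> s p) has_real_derivative d) (at 0)"
      using real_differentiable_def by blast
    have "((\<lambda>s. \<Sum>j\<in>UNIV. exp (2 * \<beta> $ j * \<Phi> s p) * (c j s * x j p)) has_real_derivative
        (\<Sum>j\<in>UNIV. (2 * d) * (\<beta> $ j * x j p) + (if j = k then x k p else 0))) (at 0)"
      unfolding c_def
      by (auto intro!: derivative_eq_intros d sum.cong simp: \<Phi>0)
    then have "((\<lambda>s. 1) has_real_derivative
        (\<Sum>j\<in>UNIV. (2 * d) * (\<beta> $ j * x j p) + (if j = k then x k p else 0))) (at (0::real))"
      by (rule has_field_derivative_transform_within_open[of _ _ _ ?D]) (auto simp: \<Phi>)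
    then have "(\<Sum>j\<in>UNIV. (2 * d) * (\<beta> $ j * x j p) + (if j = k then x k p else 0)) = 0"
      by (rule DERIV_unique) simp
    then have "2 * d * B p + x k p = 0"
      by (simp add: sum.distrib B_def sum_distrib_left)
    then have "d = - (x k p / B p) / 2" using B_pos[of p] by (simp add: field_simps)
    then show ?thesis using d by simp
  qed
  have "((\<lambda>s. \<Phi> s q1 - \<Phi> s q2) has_real_derivative - (x k q1 / B q1) / 2 - - (x k q2 / B q2) / 2) (at 0)"
    by (intro DERIV_diff der)
  \<comment> \<open>Different derivatives at \<open>q1\<close> and \<open>q2\<close> make
    \<open>\<Phi> s\<close> nonconstant for small \<open>s\<close>, which is what separates classes
    modulo constants.\<close>
  then have lim: "((\<lambda>h. (\<Phi> h q1 - \<Phi> h q2) / h) \<longlongrightarrow> - (x k q1 / B q1) / 2 - - (x k q2 / B q2) / 2) (at 0)"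
    by (simp add: DERIV_def \<Phi>0)
  have "- (x k q1 / B q1) / 2 - - (x k q2 / B q2) / 2 \<noteq> 0" using ratio by simp
  from tendsto_imp_eventually_ne[OF lim this]
  obtain \<epsilon> where \<epsilon>: "\<epsilon> > 0" "\<And>s. s \<noteq> 0 \<Longrightarrow> dist s 0 < \<epsilon> \<Longrightarrow> (\<Phi> s q1 - \<Phi> s q2) / s \<noteq> 0"
    unfolding eventually_at by auto
  show thesis
  proof (rule that[of "min \<epsilon> 1" \<Phi>])
    show "\<exists>q q'. \<Phi> s q \<noteq> \<Phi> s q'" if "0 < s" "s < min \<epsilon> 1" for s
      using \<epsilon>(2)[of s] that by (intro exI[of _ q1] exI[of _ q2]) auto
  qed (use \<epsilon>(1) family \<Phi>0 T0 sph in auto)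
qed

end

section \<open>Linear algebra\<close>

text \<open>Gaussian elimination: the pivot \<open>v i0 k0\<close> removes one unknown together with
  one equation.\<close>

lemma homogeneous_system:
  fixes v :: "'i \<Rightarrow> 'k \<Rightarrow> complex"
  assumes "finite K" "finite J" "card K < card J"
  obtains c where "\<exists>i\<in>J. c i \<noteq> 0" "\<And>k. k \<in> K \<Longrightarrow> (\<Sum>i\<in>J. c i * v i k) = 0"
proof -
  have "\<exists>c. (\<exists>i\<in>J. c i \<noteq> 0) \<and> (\<forall>k\<in>K. (\<Sum>i\<in>J. c i * v i k) = 0)"
    using assms
  proof (induction K arbitrary: J v rule: finite_induct)
    case empty
    then have "J \<noteq> {}" by auto
    then show ?case by (intro exI[of _ "\<lambda>i. 1"]) auto
  next
    case (insert k0 K)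
    show ?case
    proof (cases "\<exists>i\<in>J. v i k0 \<noteq> 0")
      case False
      obtain c where "\<exists>i\<in>J. c i \<noteq> 0" "\<forall>k\<in>K. (\<Sum>i\<in>J. c i * v i k) = 0"
        using insert.IH[OF insert.prems(1), of v] insert.prems(2) insert.hyps by auto
      then show ?thesis using False by (intro exI[of _ c]) auto
    next
      case True
      then obtain i0 where i0: "i0 \<in> J" "v i0 k0 \<noteq> 0" by blast
      let ?J = "J - {i0}"
      let ?v = "\<lambda>i k. v i k - v i k0 / v i0 k0 * v i0 k"
      have "card K < card ?J"
        using insert.prems insert.hyps i0(1) by simp
      then obtain c where c: "\<exists>i\<in>?J. c i \<noteq> 0" "\<forall>k\<in>K. (\<Sum>i\<in>?J. c i * ?v i k) = 0"
        using insert.IH[of ?J ?v] insert.prems(1) by auto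
      let ?s = "\<Sum>i\<in>?J. c i * (v i k0 / v i0 k0)"
      let ?c = "\<lambda>i. if i = i0 then - ?s else c i"
      have sum: "(\<Sum>i\<in>J. ?c i * v i k) = (\<Sum>i\<in>?J. c i * ?v i k)" for k
      proof -
        have "(\<Sum>i\<in>J. ?c i * v i k) = - ?s * v i0 k + (\<Sum>i\<in>?J. ?c i * v i k)"
          using insert.prems(1) i0(1) by (subst sum.remove[of J i0]) auto
        also have "(\<Sum>i\<in>?J. ?c i * v i k) = (\<Sum>i\<in>?J. c i * v i k)"
          by (rule sum.cong) auto
        also have "- ?s * v i0 k + (\<Sum>i\<in>?J. c i * v i k) = (\<Sum>i\<in>?J. c i * v i k - c i * (v i k0 / v i0 k0) * v i0 k)"
          by (simp add: sum_subtractf sum_distrib_right)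
        also have "\<dots> = (\<Sum>i\<in>?J. c i * ?v i k)"
          by (rule sum.cong) (simp_all only: right_diff_distrib mult.assoc)
        finally show ?thesis .
      qed
      have "(\<Sum>i\<in>?J. c i * ?v i k0) = 0" using i0(2) by simp
      then have "\<forall>k\<in>insert k0 K. (\<Sum>i\<in>J. ?c i * v i k) = 0" unfolding sum using c(2) by blast
      moreover have "\<exists>i\<in>J. ?c i \<noteq> 0" using c(1) by auto
      ultimately show ?thesis by (intro exI[of _ ?c] conjI)
    qed
  qed
  then show thesis using that by blast
qed

text \<open>If no such relation existed, then for a maximal independent family of vectors \<open>a i k * y k ^ m i\<close> with \<open>i \<in> J\<close>
  and for \<open>p \<notin> J\<close> the coefficients expressing \<open>a p k * y k ^ l\<close> by this family would have sum \<open>1\<close> for all \<open>l\<close>.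
  Taking the combination over \<open>l\<close> given by the polynomial vanishing at all \<open>y k\<close> yields a contradiction at \<open>1\<close>.\<close>
lemma power_relation:
  fixes a :: "'i \<Rightarrow> 'k \<Rightarrow> complex" and y :: "'k \<Rightarrow> complex"
  assumes fin: "finite K" "finite I" and card: "card K < card I" and y: "\<And>k. k \<in> K \<Longrightarrow> y k \<noteq> 1"
  obtains m c where "\<And>i. m i \<le> card K" "(\<Sum>i\<in>I. c i) = 1"
    "\<And>k. k \<in> K \<Longrightarrow> (\<Sum>i\<in>I. c i * (a i k * y k ^ m i)) = 0"
proof (rule ccontr)
  assume contra: "\<not> thesis"
  note result = that
  have no: False if "\<And>i. m i \<le> card K" "(\<Sum>i\<in>I. c i) = 1"
    "\<And>k. k \<in> K \<Longrightarrow> (\<Sum>i\<in>I. c i * (a i k * y k ^ m i)) = 0" for m c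
    using contra result[OF that] by blast
  define ind where "ind J m \<longleftrightarrow> (\<forall>c. (\<forall>k\<in>K. (\<Sum>i\<in>J. c i * (a i k * y k ^ m i)) = 0) \<longrightarrow> (\<forall>i\<in>J. c i = 0))"
    for J :: "'i set" and m :: "'i \<Rightarrow> nat"
  define good where "good Jm \<longleftrightarrow> fst Jm \<subseteq> I \<and> (\<forall>i. snd Jm i \<le> card K) \<and> ind (fst Jm) (snd Jm)" for Jm
  have bound: "card (fst Jm) \<le> card K" if "good Jm" for Jm
  proof (rule ccontr)
    assume less: "\<not> card (fst Jm) \<le> card K"
    have "finite (fst Jm)" using that fin(2) finite_subset by (auto simp: good_def)
    then obtain c where "\<exists>i\<in>fst Jm. c i \<noteq> 0" "\<And>k. k \<in> K \<Longrightarrow> (\<Sum>i\<in>fst Jm. c i * (a i k * y k ^ snd Jm i)) = 0"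
      using homogeneous_system[OF fin(1), of "fst Jm" "\<lambda>i k. a i k * y k ^ snd Jm i"] less by auto
    then show False using that by (auto simp: good_def ind_def)
  qed
  \<comment> \<open>By \<open>bound\<close> the sizes are limited, so a largest good family exists.
    The pair records the exponents too, so the family is maximal over all exponents at once.\<close>
  have "good ({}, \<lambda>_. 0)" by (simp add: good_def ind_def)
  then have "\<exists>Jm. good Jm \<and> (\<forall>Jm'. good Jm' \<longrightarrow> card (fst Jm') \<le> card (fst Jm))"
    by (rule ex_has_greatest_nat[where b = "Suc (card K)"]) (intro allI impI le_imp_less_Suc bound)
  then obtain Jm where Jm: "good Jm" "\<And>Jm'. good Jm' \<Longrightarrow> card (fst Jm') \<le> card (fst Jm)"
    by blast
  obtain J m where Jm_eq: "Jm = (J, m)" by (cases Jm)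
  have J: "J \<subseteq> I" "\<And>i. m i \<le> card K" "ind J m" using Jm(1) by (auto simp: Jm_eq good_def)
  have finJ: "finite J" using J(1) fin(2) by (rule finite_subset)
  have "J \<noteq> I" using bound[OF Jm(1)] card by (auto simp: Jm_eq)
  then obtain p where p: "p \<in> I" "p \<notin> J" using J(1) by blast
  have "\<exists>d. (\<Sum>i\<in>J. d i) = 1 \<and> (\<forall>k\<in>K. a p k * y k ^ l = (\<Sum>i\<in>J. d i * (a i k * y k ^ m i)))" if l: "l \<le> card K" for l
  proof -
    let ?m = "m(p := l)"
    have "\<not> ind (insert p J) ?m"
    proof
      assume "ind (insert p J) ?m"
      then have "good (insert p J, ?m)" using p J l by (auto simp: good_def)
      from Jm(2)[OF this] show False using p(2) finJ by (simp add: Jm_eq)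
    qed
    then obtain c where c: "\<And>k. k \<in> K \<Longrightarrow> (\<Sum>i\<in>insert p J. c i * (a i k * y k ^ ?m i)) = 0" "\<exists>i\<in>insert p J. c i \<noteq> 0"
      unfolding ind_def by blast
    have "(\<Sum>i\<in>J. c i * (a i k * y k ^ ?m i)) = (\<Sum>i\<in>J. c i * (a i k * y k ^ m i))" for k
      by (rule sum.cong) (use p(2) in auto)
    then have rel: "c p * (a p k * y k ^ l) + (\<Sum>i\<in>J. c i * (a i k * y k ^ m i)) = 0" if "k \<in> K" for k
      using c(1)[OF that] p(2) finJ by simp
    have cp: "c p \<noteq> 0"
    proof
      assume 0: "c p = 0"
      then have "\<forall>i\<in>J. c i = 0" using rel J(3) unfolding ind_def by simp
      then show False using c(2) 0 by blast
    qed
    let ?d = "\<lambda>i. - (c i / c p)"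
    have eq: "a p k * y k ^ l = (\<Sum>i\<in>J. ?d i * (a i k * y k ^ m i))" if "k \<in> K" for k
    proof -
      have "(\<Sum>i\<in>J. ?d i * (a i k * y k ^ m i)) = - (1 / c p) * (\<Sum>i\<in>J. c i * (a i k * y k ^ m i))"
        unfolding sum_distrib_left by (rule sum.cong) auto
      also have "(\<Sum>i\<in>J. c i * (a i k * y k ^ m i)) = - (c p * (a p k * y k ^ l))"
        using rel[OF that] by (simp add: eq_neg_iff_add_eq_0 add.commute)
      finally show ?thesis using cp by simp
    qed
    \<comment> \<open>Otherwise moving everything to one side gives a relation with nonzero
      coefficient sum \<open>?n\<close>; divided by \<open>?n\<close> and extended by zero to
      \<open>I\<close> it is the relation assumed not to exist.\<close>
    have "(\<Sum>i\<in>J. ?d i) = 1"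
    proof (rule ccontr)
      assume ne: "(\<Sum>i\<in>J. ?d i) \<noteq> 1"
      let ?n = "1 - (\<Sum>i\<in>J. ?d i)"
      let ?c = "\<lambda>i. (if i = p then 1 else if i \<in> J then - ?d i else 0) / ?n"
      have sum_c: "(\<Sum>i\<in>I. ?c i * g i) = (g p - (\<Sum>i\<in>J. ?d i * g i)) / ?n" for g
      proof -
        have "(\<Sum>i\<in>I. ?c i * g i) = (\<Sum>i\<in>insert p J. ?c i * g i)"
          by (rule sum.mono_neutral_right[OF fin(2)]) (use p J in auto)
        also have "\<dots> = 1 / ?n * g p + (\<Sum>i\<in>J. ?c i * g i)"
          using p(2) finJ by simp
        also have "(\<Sum>i\<in>J. ?c i * g i) = (\<Sum>i\<in>J. - (?d i * g i) / ?n)"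
          by (rule sum.cong) (use p(2) in auto)
        also have "\<dots> = - (\<Sum>i\<in>J. ?d i * g i) / ?n"
          by (simp only: sum_divide_distrib[symmetric] sum_negf)
        finally show ?thesis by (simp only: diff_divide_distrib minus_divide_left[symmetric] mult_1 times_divide_eq_left) simp
      qed
      show False
      proof (rule no[of ?m ?c])
        show "?m i \<le> card K" for i using J(2) l by simp
        show "(\<Sum>i\<in>I. ?c i) = 1" using sum_c[of "\<lambda>i. 1"] ne by simp
        fix k assume k: "k \<in> K"
        have "(\<Sum>i\<in>J. ?d i * (a i k * y k ^ ?m i)) = (\<Sum>i\<in>J. ?d i * (a i k * y k ^ m i))"
          by (rule sum.cong) (use p(2) in auto)
        then show "(\<Sum>i\<in>I. ?c i * (a i k * y k ^ ?m i)) = 0"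
          using sum_c[of "\<lambda>i. a i k * y k ^ ?m i"] eq[OF k] by simp
      qed
    qed
    then show ?thesis using eq by (intro exI[of _ ?d]) blast
  qed
  then obtain d where d: "\<And>l. l \<le> card K \<Longrightarrow> (\<Sum>i\<in>J. d l i) = 1"
    "\<And>l k. l \<le> card K \<Longrightarrow> k \<in> K \<Longrightarrow> a p k * y k ^ l = (\<Sum>i\<in>J. d l i * (a i k * y k ^ m i))"
    by metis
  \<comment> \<open>Its degree is the reason why exponents up to \<open>card K\<close> are allowed.
    It vanishes at all \<open>y k\<close>, but not at 1, since no \<open>y k\<close> equals
    1.\<close>
  define P where "P = (\<Prod>k\<in>K. [:- y k, 1:])"
  have deg: "degree P \<le> card K"
    unfolding P_def using degree_prod_sum_le[OF fin(1), of "\<lambda>k. [:- y k, 1:]"] by (simp add: o_def)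
  have P: "poly P t = (\<Sum>l\<le>card K. coeff P l * t ^ l)" for t
    unfolding poly_altdef using deg by (intro sum.mono_neutral_left) (auto simp: coeff_eq_0)
  define e where "e i = (\<Sum>l\<le>card K. coeff P l * d l i)" for i
  have "(\<Sum>i\<in>J. e i * (a i k * y k ^ m i)) = 0" if k: "k \<in> K" for k
  proof -
    have "(\<Sum>i\<in>J. e i * (a i k * y k ^ m i)) = (\<Sum>l\<le>card K. coeff P l * (\<Sum>i\<in>J. d l i * (a i k * y k ^ m i)))"
      unfolding e_def sum_distrib_left sum_distrib_right by (subst sum.swap) (simp only: mult.assoc)
    also have "\<dots> = (\<Sum>l\<le>card K. coeff P l * (a p k * y k ^ l))"
      by (rule sum.cong) (use d(2) k in auto)
    also have "\<dots> = a p k * poly P (y k)"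
      unfolding P sum_distrib_left by (rule sum.cong) (simp_all only: mult.left_commute)
    also have "poly P (y k) = 0"
      unfolding P_def poly_prod using fin(1) k by (auto intro!: prod_zero)
    finally show ?thesis by simp
  qed
  then have e0: "e i = 0" if "i \<in> J" for i using J(3) that unfolding ind_def by blast
  have "poly P 1 = (\<Sum>l\<le>card K. coeff P l * (\<Sum>i\<in>J. d l i))"
    unfolding P by (rule sum.cong) (use d(1) in auto)
  also have "\<dots> = (\<Sum>i\<in>J. e i)"
    unfolding e_def sum_distrib_left by (rule sum.swap)
  also have "\<dots> = 0" using e0 by simp
  finally have "poly P 1 = 0" .
  then show False using y fin(1) by (simp add: P_def poly_prod)
qed

lemma interpolation_polynomial:
  fixes t :: "'v::field \<Rightarrow> 'v"
  assumes "finite I"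
  obtains L where "\<And>v. v \<in> I \<Longrightarrow> poly L v = t v"
proof -
  have "\<exists>L. \<forall>v\<in>I. poly L v = t v"
    using assms
  proof (induction I rule: finite_induct)
    case (insert a I)
    then obtain L where L: "\<forall>v\<in>I. poly L v = t v" by blast
    let ?q = "\<Prod>v\<in>I. [:- v, 1:]"
    have q: "poly ?q a \<noteq> 0" "\<And>v. v \<in> I \<Longrightarrow> poly ?q v = 0"
      using insert.hyps by (auto simp: poly_prod intro!: prod_zero)
    let ?L = "L + smult ((t a - poly L a) / poly ?q a) ?q"
    have "poly ?L v = t v" if "v \<in> insert a I" for v
      using that L q by auto
    then show ?case by blast
  qed simp
  then show thesis using that by blast
qed

section \<open>Weighted CR functions as a vector space, and under deformation\<close>

context cr
begin

lemma cr_weight_diff: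
  assumes g: "cr_weight b g" and h: "cr_weight b h"
  shows "cr_weight b (\<lambda>q. g q - c * h q)"
proof -
  note sg = cr_weight_smooth[OF g] and sh = smooth_map_cmult[OF cr_weight_smooth[OF h], of c]
  note sh' = smooth_map_cnj[OF cr_weight_smooth[OF h]]
  have "Z (\<lambda>q. cnj (g q - c * h q)) = 0" if Z: "Z \<in> E p" for Z p
  proof -
    have "Z (\<lambda>q. cnj (g q) - cnj c * cnj (h q)) = 0"
      unfolding ctangent_diff[OF E_ctangent[OF Z] smooth_map_cnj[OF sg] smooth_map_cmult[OF sh']]
        ctangent_cmult[OF E_ctangent[OF Z] sh'] cr_weight_E[OF g Z] cr_weight_E[OF h Z] by simp
    then show ?thesis by simp
  qed
  moreover have "T p (\<lambda>q. g q - c * h q) = \<i> * b * (g p - c * h p)" for p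
    unfolding ctangent_diff[OF T_ctangent sg sh] ctangent_cmult[OF T_ctangent cr_weight_smooth[OF h]]
      cr_weight_T[OF g] cr_weight_T[OF h] by (simp add: algebra_simps)
  ultimately show ?thesis
    unfolding cr_weight_def using smooth_map_diff[OF sg sh] by blast
qed

text \<open>The reverse of the passage in \<open>cr_sphere_deformed\<close>: CR functions of all the
  deformations become CR functions of one fixed structure, for which finite determination is
  available.\<close>

lemma cr_weight_transfer:
  assumes u: "smooth_map A u" and Tu: "\<And>p. T p (\<lambda>q. of_real (u q)) = 0"
    and g: "cr.cr_weight A (deformed E T u) T b g"
  shows "cr_weight b (\<lambda>q. of_real (exp (- b * u q)) * g q)"
proof -
  interpret D: cr A "deformed E T u" T by (rule cr_deformed[OF u Tu])
  note sg = D.cr_weight_smooth[OF g] and sg' = smooth_map_cnj[OF D.cr_weight_smooth[OF g]]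
  have se: "smooth_map A (\<lambda>q. complex_of_real (exp (- b * u q)))"
    by (intro smooth_map_of_real smooth_map_exp smooth_map_cmult u)
  have "T p (\<lambda>q. of_real (exp (- b * u q)) * g q) = \<i> * b * (of_real (exp (- b * u p)) * g p)" for p
    unfolding ctangent_mult[OF T_ctangent se sg] ctangent_exp[OF T_ctangent u] Tu D.cr_weight_T[OF g]
    by simp
  moreover have "Z (\<lambda>q. cnj (of_real (exp (- b * u q)) * g q)) = 0" if Z: "Z \<in> E p" for Z p
  proof -
    let ?Z = "Z - cscale (\<i> * Z (\<lambda>q. of_real (u q))) (T p)"
    have "?Z \<in> deformed E T u p" using Z unfolding deformed_eq by blast
    then have "?Z (\<lambda>q. cnj (g q)) = 0" by (rule D.cr_weight_E[OF g])
    then have eq: "Z (\<lambda>q. cnj (g q)) = b * Z (\<lambda>q. of_real (u q)) * cnj (g p)"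
      by (simp add: cscale_apply D.cr_weight_T_cnj[OF g] algebra_simps)
    have "Z (\<lambda>q. of_real (exp (- b * u q)) * cnj (g q)) = 0"
      unfolding ctangent_mult[OF E_ctangent[OF Z] se sg'] ctangent_exp[OF E_ctangent[OF Z] u] eq
      by (simp add: algebra_simps)
    then show ?thesis by simp
  qed
  ultimately show ?thesis
    unfolding cr_weight_def using smooth_map_mult[OF se sg] by blast
qed

end

section \<open>The moduli space\<close>

lemma (in manifold) atlas_nonempty: "A \<noteq> {}"
  using chart_exists by (metis empty_iff)

text \<open>Uses neighbourhoods with a one-point compact set and the empty list of
  derivatives.\<close>

lemma (in manifold) continuous_map_evaluation:
  "continuous_map (smooth_topology A) euclideanreal (\<lambda>\<phi>. \<phi> p)"
proof -
  obtain U w where c: "(U, w) \<in> A" "p \<in> U" by (rule chart_exists)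
  have top: "topspace (smooth_topology A) = {f. smooth_map A f}"
    by (rule topspace_smooth_topology[OF atlas_nonempty])
  have "openin (smooth_topology A) {\<phi> \<in> topspace (smooth_topology A). \<phi> p \<in> V}" if V: "open V" for V
  proof (subst openin_subopen, intro ballI)
    fix \<phi> assume "\<phi> \<in> {\<phi> \<in> topspace (smooth_topology A). \<phi> p \<in> V}"
    then have \<phi>: "smooth_map A \<phi>" "\<phi> p \<in> V" using top by auto
    obtain \<epsilon> where \<epsilon>: "\<epsilon> > 0" "\<And>t. dist t (\<phi> p) < \<epsilon> \<Longrightarrow> t \<in> V"
      using V \<phi>(2) unfolding open_dist by blast
    let ?N = "smooth_nbhd A (U, w) {w p} [] \<epsilon> \<phi>"
    have N: "?N = {g. smooth_map A g \<and> \<bar>g p - \<phi> p\<bar> < \<epsilon>}"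
      using c by (auto simp: smooth_nbhd_def)
    have "openin (smooth_topology A) ?N"
      unfolding smooth_topology_def
      by (rule topology_generated_by_Basis, intro CollectI exI conjI, rule refl) (use c \<phi>(1) \<epsilon>(1) in auto)
    moreover have "\<phi> \<in> ?N" using \<phi>(1) \<epsilon>(1) by (simp add: N)
    moreover have "?N \<subseteq> {\<phi> \<in> topspace (smooth_topology A). \<phi> p \<in> V}"
      using \<epsilon>(2) by (auto simp: N top dist_real_def)
    ultimately show "\<exists>N. openin (smooth_topology A) N \<and> \<phi> \<in> N \<and>
        N \<subseteq> {\<phi> \<in> topspace (smooth_topology A). \<phi> p \<in> V}" by blast
  qed
  then show ?thesis by (simp add: continuous_map_def)
qed

context cr
begin

abbreviation "adm \<equiv> admissible A E T"

abbreviation cls :: "('a \<Rightarrow> real) \<Rightarrow> ('a \<Rightarrow> real) set" where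
  "cls \<phi> \<equiv> mod_const adm `` {\<phi>}"

abbreviation "adm_topology \<equiv> subtopology (smooth_topology A) adm"

lemma admissible_smooth: "\<phi> \<in> adm \<Longrightarrow> smooth_map A \<phi>"
  and admissible_T: "\<phi> \<in> adm \<Longrightarrow> T p (\<lambda>q. of_real (\<phi> q)) = 0"
  by (auto simp: admissible_def)

lemma topspace_adm: "topspace adm_topology = adm"
  unfolding topspace_subtopology topspace_smooth_topology[OF atlas_nonempty]
  using admissible_smooth by blast

lemma cls_eq_iff:
  assumes "\<phi> \<in> adm" "\<psi> \<in> adm"
  shows "cls \<phi> = cls \<psi> \<longleftrightarrow> (\<exists>c. \<forall>p. \<phi> p - \<psi> p = c)"
proof
  assume "cls \<phi> = cls \<psi>"
  moreover have "\<psi> \<in> cls \<psi>" using assms by (auto simp: mod_const_def)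
  ultimately have "\<psi> \<in> cls \<phi>" by simp
  then show "\<exists>c. \<forall>p. \<phi> p - \<psi> p = c" by (simp add: mod_const_def)
next
  assume "\<exists>c. \<forall>p. \<phi> p - \<psi> p = c"
  then obtain c where c: "\<And>p. \<phi> p = \<psi> p + c" by (metis diff_eq_eq add.commute)
  have "(\<exists>d. \<forall>p. \<phi> p - \<xi> p = d) \<longleftrightarrow> (\<exists>d. \<forall>p. \<psi> p - \<xi> p = d)" for \<xi>
  proof
    assume "\<exists>d. \<forall>p. \<phi> p - \<xi> p = d"
    then obtain d where "\<forall>p. \<phi> p - \<xi> p = d" by blast
    then have "\<forall>p. \<psi> p - \<xi> p = d - c" by (simp add: c algebra_simps)
    then show "\<exists>d. \<forall>p. \<psi> p - \<xi> p = d" by blast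
  next
    assume "\<exists>d. \<forall>p. \<psi> p - \<xi> p = d"
    then obtain d where "\<forall>p. \<psi> p - \<xi> p = d" by blast
    then have "\<forall>p. \<phi> p - \<xi> p = d + c" by (simp add: c algebra_simps)
    then show "\<exists>d. \<forall>p. \<phi> p - \<xi> p = d" by blast
  qed
  then show "cls \<phi> = cls \<psi>" using assms by (auto simp: mod_const_def)
qed

lemma openin_moduli_space:
  "openin (moduli_space A E T) V \<longleftrightarrow> V \<subseteq> cls ` adm \<and> openin adm_topology {\<phi> \<in> adm. cls \<phi> \<in> V}"
  unfolding moduli_space_def openin_quotient_topology topspace_adm ..

lemma continuous_map_cls: "continuous_map adm_topology (moduli_space A E T) cls"
  unfolding moduli_space_def by (rule quotient_imp_continuous_map[OF quotient_map_quotient_topology])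

lemma deformed_add_const:
  assumes "smooth_map A \<phi>"
  shows "deformed E T (\<lambda>q. \<phi> q + c) = deformed E T \<phi>"
proof
  fix p
  have "Z (\<lambda>q. of_real (\<phi> q + c)) = Z (\<lambda>q. of_real (\<phi> q))" if Z: "Z \<in> E p" for Z
    using ctangent_add[OF E_ctangent[OF Z] smooth_map_of_real[OF assms] smooth_map_const[of "of_real c"]]
      ctangent_const[OF E_ctangent[OF Z]] by simp
  then show "deformed E T (\<lambda>q. \<phi> q + c) p = deformed E T \<phi> p"
    unfolding deformed_eq by (intro image_cong) auto
qed

lemma admissible_if_cr_sphere:
  assumes "smooth_map A \<psi>" "\<And>p. T p (\<lambda>q. of_real (\<psi> q)) = 0" "cr_sphere A (deformed E T \<psi>) T g \<beta>"
  shows "\<psi> \<in> adm"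
  using assms cr_sphere.strictly_pseudoconvex[OF assms(3)] by (simp add: admissible_def)

text \<open>Classes only know functions up to constants. Hence the neighbourhood is cut out by
  differences \<open>\<xi> p - \<xi> p0\<close>, and the approximating function is afterwards
  shifted to agree with \<open>\<phi>\<close> at \<open>p0\<close>, which leaves its deformed
  structure unchanged.\<close>

lemma sphere_approximation:
  fixes \<beta> :: "real ^ 'N"
  assumes \<beta>: "\<And>j. \<beta> $ j > 0"
    and W: "openin (moduli_space A E T) W" "W \<subseteq> moduli_space A E T closure_of sphere_induced A E T \<beta>"
    and \<phi>: "\<phi> \<in> adm" "cls \<phi> \<in> W" and P: "finite P" and \<epsilon>: "\<epsilon> > 0"
  shows "\<exists>\<psi> g. smooth_map A \<psi> \<and> (\<forall>p. T p (\<lambda>q. of_real (\<psi> q)) = 0) \<and>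
    cr_sphere A (deformed E T \<psi>) T g \<beta> \<and> (\<forall>p\<in>P. \<bar>\<psi> p - \<phi> p\<bar> < \<epsilon>)"
proof -
  define p0 :: 'a where "p0 = undefined"
  let ?h = "\<lambda>p \<xi>. (\<xi> p - \<xi> p0) - (\<phi> p - \<phi> p0)"
  let ?B = "{\<xi> \<in> adm. cls \<xi> \<in> W \<and> (\<forall>p\<in>P. \<bar>?h p \<xi>\<bar> < \<epsilon>)}"
  have "openin adm_topology {\<xi> \<in> adm. \<forall>p\<in>P. \<bar>?h p \<xi>\<bar> < \<epsilon>}"
    using P
  proof (induction P rule: finite_induct)
    case empty
    then show ?case using openin_topspace[of adm_topology] unfolding topspace_adm by simp
  next
    case (insert p P)
    have "continuous_map adm_topology euclideanreal (\<lambda>\<xi>. \<bar>?h p \<xi>\<bar>)"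
      by (intro continuous_map_real_abs continuous_map_diff continuous_map_const[THEN iffD2] disjI2
          continuous_map_from_subtopology continuous_map_evaluation) simp
    then have "openin adm_topology {\<xi> \<in> topspace adm_topology. \<bar>?h p \<xi>\<bar> \<in> {..<\<epsilon>}}"
      by (rule openin_continuous_map_preimage) simp
    from openin_Int[OF this[unfolded topspace_adm] insert.IH] show ?case
      by (rule back_subst[of "openin adm_topology"]) auto
  qed
  moreover have "openin adm_topology {\<xi> \<in> adm. cls \<xi> \<in> W}" using W(1) by (simp add: openin_moduli_space)
  ultimately have "openin adm_topology ({\<xi> \<in> adm. cls \<xi> \<in> W} \<inter> {\<xi> \<in> adm. \<forall>p\<in>P. \<bar>?h p \<xi>\<bar> < \<epsilon>})"
    by (intro openin_Int)
  also have "{\<xi> \<in> adm. cls \<xi> \<in> W} \<inter> {\<xi> \<in> adm. \<forall>p\<in>P. \<bar>?h p \<xi>\<bar> < \<epsilon>} = ?B" by blast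
  finally have open_B: "openin adm_topology ?B" .
  \<comment> \<open>Saturation makes the image of \<open>?B\<close> under \<open>cls\<close> open in
    the quotient.\<close>
  have sat: "\<xi> \<in> ?B" if "\<xi> \<in> adm" "cls \<xi> = cls \<xi>'" "\<xi>' \<in> ?B" for \<xi> \<xi>'
  proof -
    have "\<xi>' \<in> adm" using that(3) by simp
    then have "\<exists>c. \<forall>p. \<xi> p - \<xi>' p = c" using cls_eq_iff that(1,2) by blast
    then obtain c where c: "\<forall>p. \<xi> p - \<xi>' p = c" by blast
    have "\<xi> p - \<xi> p0 = \<xi>' p - \<xi>' p0" for p
      using spec[OF c, of p] spec[OF c, of p0] by linarith
    then show ?thesis using that by auto
  qed
  have "{\<xi> \<in> adm. cls \<xi> \<in> cls ` ?B} = ?B" using sat by blast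
  moreover have "cls ` ?B \<subseteq> cls ` adm" by blast
  ultimately have op: "openin (moduli_space A E T) (cls ` ?B)" using open_B by (simp only: openin_moduli_space)
  have mem: "cls \<phi> \<in> cls ` ?B" using \<phi> \<epsilon> by (intro imageI) simp
  have cl: "cls \<phi> \<in> moduli_space A E T closure_of sphere_induced A E T \<beta>" using \<phi>(2) W(2) by blast
  from cl[unfolded in_closure_of, THEN conjunct2, rule_format, OF conjI[OF mem op]]
  obtain s where s: "s \<in> sphere_induced A E T \<beta>" "s \<in> cls ` ?B" by (elim exE conjE) (rule that)
  obtain \<xi> where \<xi>: "\<xi> \<in> adm" "s = cls \<xi>" "induced_by_weighted_sphere A \<beta> (deformed E T \<xi>) T"
    using s(1) unfolding sphere_induced_def by blast
  then have B: "\<xi> \<in> ?B" using s(2) sat by blast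
  define \<psi> where "\<psi> p = \<xi> p + (\<phi> p0 - \<xi> p0)" for p
  note sm = admissible_smooth[OF \<xi>(1)]
  have def: "deformed E T \<psi> = deformed E T \<xi>" unfolding \<psi>_def[abs_def] by (rule deformed_add_const[OF sm])
  interpret D: cr A "deformed E T \<xi>" T by (rule cr_deformed[OF sm admissible_T[OF \<xi>(1)]])
  obtain g where "cr_sphere A (deformed E T \<xi>) T g \<beta>" by (rule D.cr_sphere_if_induced[OF \<xi>(3) \<beta>])
  moreover have "smooth_map A \<psi>" unfolding \<psi>_def[abs_def] by (intro smooth_map_add sm smooth_map_const)
  moreover have "T p (\<lambda>q. of_real (\<psi> q)) = 0" for p
    using ctangent_add[OF T_ctangent smooth_map_of_real[OF sm] smooth_map_const[of "of_real (\<phi> p0 - \<xi> p0)"]]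
      ctangent_const[OF T_ctangent] admissible_T[OF \<xi>(1)] by (simp add: \<psi>_def)
  moreover have "\<forall>p\<in>P. \<bar>\<psi> p - \<phi> p\<bar> < \<epsilon>" using B by (auto simp: \<psi>_def algebra_simps)
  ultimately show ?thesis using def by metis
qed

lemma deformed_vector_nonzero:
  assumes "Z \<in> E p" "Z \<noteq> 0"
  shows "Z - cscale c (T p) \<noteq> 0"
proof
  assume "Z - cscale c (T p) = 0"
  then have "Z + cconj 0 + cscale (- c) (T p) = 0" by (simp add: fun_eq_iff cscale_apply)
  then show False using independence[OF assms(1) cvs.subspace_0[OF E_subspace]] assms(2) by blast
qed

text \<open>That \<open>\<gamma> t\<close> differs from \<open>s\<close> for all positive
  \<open>t\<close> serves both the limit points and the nonconstancy of the path.\<close>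

lemma sphere_path:
  fixes \<beta> :: "real ^ 'N"
  assumes X: "compact (UNIV :: 'a set)" and \<beta>: "\<And>j. \<beta> $ j > 0" and Z: "Z \<in> E p" "Z \<noteq> 0"
    and s: "s \<in> sphere_induced A E T \<beta>"
  obtains \<epsilon> :: real and \<gamma> where "\<epsilon> > 0" "continuous_map (top_of_set {0..<\<epsilon>}) (moduli_space A E T) \<gamma>" "\<gamma> 0 = s"
    "\<And>t. t \<in> {0..<\<epsilon>} \<Longrightarrow> \<gamma> t \<in> sphere_induced A E T \<beta>" "\<And>t. 0 < t \<Longrightarrow> t < \<epsilon> \<Longrightarrow> \<gamma> t \<noteq> s"
proof -
  obtain \<phi> where \<phi>: "\<phi> \<in> adm" "s = cls \<phi>" "induced_by_weighted_sphere A \<beta> (deformed E T \<phi>) T"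
    using s unfolding sphere_induced_def by blast
  note sm = admissible_smooth[OF \<phi>(1)] and T\<phi> = admissible_T[OF \<phi>(1)]
  interpret D: cr A "deformed E T \<phi>" T by (rule cr_deformed[OF sm T\<phi>])
  obtain f where "cr_sphere A (deformed E T \<phi>) T f \<beta>" by (rule D.cr_sphere_if_induced[OF \<phi>(3) \<beta>])
  then interpret S: cr_sphere A "deformed E T \<phi>" T f \<beta> .
  let ?Z = "Z - cscale (\<i> * Z (\<lambda>q. of_real (\<phi> q))) (T p)"
  have Z1: "?Z \<in> deformed E T \<phi> p" using Z(1) unfolding deformed_eq by blast
  have Z2: "?Z \<noteq> 0" using deformed_vector_nonzero[OF Z] by simp
  obtain \<Phi> \<epsilon> where \<epsilon>: "0 < \<epsilon>" "\<epsilon> \<le> 1" and \<Phi>: "smooth_family {-1<..<1} \<Phi>" "\<And>p. \<Phi> 0 p = 0"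
    "\<And>s p. s \<in> {-1<..<1} \<Longrightarrow> T p (\<lambda>q. of_real (\<Phi> s q)) = 0"
    "\<And>s. s \<in> {-1<..<1} \<Longrightarrow> \<exists>g. cr_sphere A (deformed (deformed E T \<phi>) T (\<Phi> s)) T g \<beta>"
    "\<And>s. 0 < s \<Longrightarrow> s < \<epsilon> \<Longrightarrow> \<exists>q q'. \<Phi> s q \<noteq> \<Phi> s q'"
    by (rule S.deformation_path[OF Z1 Z2]) blast
  define \<Psi> where "\<Psi> t p = \<phi> p + \<Phi> t p" for t p
  have fam: "smooth_family {-1<..<1} \<Psi>"
    unfolding \<Psi>_def[abs_def] by (intro smooth_family_add smooth_family_const sm \<Phi>(1)) auto
  have D: "t \<in> {-1<..<1}" if "t \<in> {0..<\<epsilon>}" for t using that \<epsilon> by auto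
  have \<Psi>: "\<Psi> t \<in> adm" "induced_by_weighted_sphere A \<beta> (deformed E T (\<Psi> t)) T" if t: "t \<in> {0..<\<epsilon>}" for t
  proof -
    have sm\<Phi>: "smooth_map A (\<Phi> t)" by (rule smooth_family_smooth_map[OF _ \<Phi>(1) D[OF t]]) simp
    have eq: "deformed (deformed E T \<phi>) T (\<Phi> t) = deformed E T (\<Psi> t)"
      unfolding \<Psi>_def by (rule deformed_deformed[OF \<Phi>(3)[OF D[OF t]] sm sm\<Phi>])
    obtain g where g: "cr_sphere A (deformed E T (\<Psi> t)) T g \<beta>" using \<Phi>(4)[OF D[OF t]] unfolding eq by blast
    have "T p (\<lambda>q. of_real (\<Psi> t q)) = 0" for p
      using ctangent_add[OF T_ctangent smooth_map_of_real[OF sm] smooth_map_of_real[OF sm\<Phi>]] T\<phi> \<Phi>(3)[OF D[OF t]]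
      by (simp add: \<Psi>_def)
    then show "\<Psi> t \<in> adm"
      by (rule admissible_if_cr_sphere[OF smooth_family_smooth_map[OF _ fam D[OF t]] _ g, rotated]) simp
    show "induced_by_weighted_sphere A \<beta> (deformed E T (\<Psi> t)) T" by (rule cr_sphere.induced[OF g X])
  qed
  have \<Psi>0: "\<Psi> 0 = \<phi>" by (simp add: \<Psi>_def[abs_def] \<Phi>(2))
  show thesis
  proof (rule that[of \<epsilon> "\<lambda>t. cls (\<Psi> t)"])
    have "continuous_map (top_of_set {0..<\<epsilon>}) (smooth_topology A) \<Psi>"
      by (rule smooth_family_continuous_map[OF _ fam _ atlas_nonempty]) (use D in auto)
    then have "continuous_map (top_of_set {0..<\<epsilon>}) adm_topology \<Psi>"
      using \<Psi>(1) by (auto simp: continuous_map_in_subtopology)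
    from continuous_map_compose[OF this continuous_map_cls]
    show "continuous_map (top_of_set {0..<\<epsilon>}) (moduli_space A E T) (\<lambda>t. cls (\<Psi> t))" by (simp add: o_def)
    show "cls (\<Psi> 0) = s" by (simp add: \<Psi>0 \<phi>(2))
    show "cls (\<Psi> t) \<in> sphere_induced A E T \<beta>" if "t \<in> {0..<\<epsilon>}" for t
      unfolding sphere_induced_def using \<Psi>[OF that] by blast
    show "cls (\<Psi> t) \<noteq> s" if t: "0 < t" "t < \<epsilon>" for t
    proof
      assume "cls (\<Psi> t) = s"
      then have "\<exists>c. \<forall>p. \<Psi> t p - \<phi> p = c" using cls_eq_iff[OF \<Psi>(1) \<phi>(1), of t] t by (simp add: \<phi>(2))
      then show False using \<Phi>(5)[OF t] by (auto simp: \<Psi>_def)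
    qed
  qed (rule \<epsilon>(1))
qed

text \<open>For small \<open>s\<close> admissibility comes from the explicit bound
  \<open>\<delta>\<close> on two derivatives of \<open>smult s L\<close>, and staying in
  \<open>W\<close> from continuity of the family in the smooth topology.\<close>

lemma admissible_perturbation:
  assumes \<phi>: "\<phi> \<in> adm" and S: "cr_sphere A (deformed E T \<phi>) T f \<beta>"
    and W: "openin (moduli_space A E T) W" "cls \<phi> \<in> W"
  shows "eventually (\<lambda>s. (\<lambda>q. \<phi> q + s * poly L ((cmod (f k q))\<^sup>2)) \<in> {\<psi> \<in> adm. cls \<psi> \<in> W}) (at_right 0)"
proof -
  interpret S: cr_sphere A "deformed E T \<phi>" T f \<beta> by (rule S)
  note sm = admissible_smooth[OF \<phi>] and T\<phi> = admissible_T[OF \<phi>]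
  let ?\<psi> = "\<lambda>s q. \<phi> q + s * poly L (S.x k q)"
  obtain \<delta> where \<delta>: "\<delta> > 0"
    "\<And>P. (\<And>t. t \<in> {0..1} \<Longrightarrow> \<bar>poly (pderiv P) t\<bar> \<le> \<delta> \<and> \<bar>poly (pderiv (pderiv P)) t\<bar> \<le> \<delta>) \<Longrightarrow>
      strictly_pseudoconvex A (deformed (deformed E T \<phi>) T (\<lambda>q. poly P (S.x k q)))"
    by (rule S.strictly_pseudoconvex_deformed_poly) blast
  have bdd: "\<exists>C>0. \<forall>t\<in>{0..1}. \<bar>poly P t\<bar> \<le> C" for P :: "real poly"
  proof -
    have "compact (poly P ` {0..1})" by (intro compact_continuous_image continuous_intros) auto
    then have "bounded (poly P ` {0..1})" by (rule compact_imp_bounded)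
    then show ?thesis unfolding bounded_pos by auto
  qed
  obtain C1 where C1: "C1 > 0" "\<And>t. t \<in> {0..1} \<Longrightarrow> \<bar>poly (pderiv L) t\<bar> \<le> C1" using bdd by blast
  obtain C2 where C2: "C2 > 0" "\<And>t. t \<in> {0..1} \<Longrightarrow> \<bar>poly (pderiv (pderiv L)) t\<bar> \<le> C2" using bdd by blast
  have adm: "?\<psi> s \<in> adm" if s: "0 < s" "s < min (\<delta> / C1) (\<delta> / C2)" for s
  proof -
    have s': "s * C1 \<le> \<delta>" "s * C2 \<le> \<delta>" using s C1(1) C2(1) by (auto simp: field_simps)
    have "strictly_pseudoconvex A (deformed (deformed E T \<phi>) T (\<lambda>q. poly (smult s L) (S.x k q)))"
    proof (rule \<delta>(2), intro conjI)
      fix t :: real assume t: "t \<in> {0..1}"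
      show "\<bar>poly (pderiv (smult s L)) t\<bar> \<le> \<delta>" "\<bar>poly (pderiv (pderiv (smult s L))) t\<bar> \<le> \<delta>"
        using order_trans[OF mult_left_mono[OF C1(2)[OF t] less_imp_le[OF s(1)]] s'(1)]
          order_trans[OF mult_left_mono[OF C2(2)[OF t] less_imp_le[OF s(1)]] s'(2)] s(1)
        by (simp_all add: pderiv_smult abs_mult)
    qed
    moreover have "deformed (deformed E T \<phi>) T (\<lambda>q. poly (smult s L) (S.x k q)) = deformed E T (\<lambda>q. \<phi> q + poly (smult s L) (S.x k q))"
      by (rule deformed_deformed[OF S.T_poly_x sm S.poly_x_smooth])
    moreover have "T p (\<lambda>q. of_real (\<phi> q) + complex_of_real (poly (smult s L) (S.x k q))) = 0" for p
      unfolding ctangent_add[OF T_ctangent smooth_map_of_real[OF sm] smooth_map_of_real[OF S.poly_x_smooth]] T\<phi> S.T_poly_x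
      by simp
    moreover have "smooth_map A (\<lambda>q. \<phi> q + poly (smult s L) (S.x k q))"
      by (rule smooth_map_add[OF sm S.poly_x_smooth])
    ultimately show ?thesis by (simp add: admissible_def)
  qed
  obtain Op where Op: "openin (smooth_topology A) Op" "{\<psi> \<in> adm. cls \<psi> \<in> W} = Op \<inter> adm"
    using W(1) unfolding openin_moduli_space openin_subtopology by blast
  have "smooth_family UNIV ?\<psi>"
    by (intro smooth_family_add smooth_family_mult smooth_family_const smooth_family_param sm S.poly_x_smooth open_UNIV)
  then have "continuous_map (top_of_set UNIV) (smooth_topology A) ?\<psi>"
    by (rule smooth_family_continuous_map[OF open_UNIV _ subset_UNIV atlas_nonempty])
  from openin_continuous_map_preimage[OF this Op(1)] have "open {s. ?\<psi> s \<in> Op}" by simp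
  moreover have "\<phi> \<in> Op" using Op(2) \<phi> W(2) by blast
  then have "0 \<in> {s. ?\<psi> s \<in> Op}" by simp
  ultimately have "eventually (\<lambda>s. s \<in> {s. ?\<psi> s \<in> Op}) (nhds 0)" by (rule eventually_nhds_in_open)
  then have "eventually (\<lambda>s. ?\<psi> s \<in> Op) (at_right 0)"
    by (simp add: eventually_at_filter eventually_mono)
  moreover have "eventually (\<lambda>s. s \<in> {0<..<min (\<delta> / C1) (\<delta> / C2)}) (at_right 0)"
    by (rule eventually_at_right_real) (use \<delta>(1) C1(1) C2(1) in simp)
  ultimately have "eventually (\<lambda>s. ?\<psi> s \<in> {\<psi> \<in> adm. cls \<psi> \<in> W}) (at_right 0)"
    by eventually_elim (use adm Op(2) in auto)
  then show ?thesis by (simp add: S.x_def)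
qed

end

section \<open>Nowhere density by an overdetermined system\<close>

context cr
begin

lemma sphere_induced_nowhere_dense:
  fixes \<beta> :: "real ^ 'N"
  assumes X: "compact (UNIV :: 'a set)" "connected (UNIV :: 'a set)" and \<beta>: "\<And>j. \<beta> $ j > 0"
    and Z: "Z \<in> E p" "Z \<noteq> 0"
  shows "moduli_space A E T interior_of (moduli_space A E T closure_of sphere_induced A E T \<beta>) = {}"
proof (rule ccontr)
  let ?M = "moduli_space A E T" and ?S = "sphere_induced A E T \<beta>"
  define W where "W = ?M interior_of (?M closure_of ?S)"
  assume "?M interior_of (?M closure_of ?S) \<noteq> {}"
  then obtain w where w: "w \<in> W" unfolding W_def by blast
  have W: "openin ?M W" "W \<subseteq> ?M closure_of ?S"
    unfolding W_def by (rule openin_interior_of, rule interior_of_subset)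
  \<comment> \<open>A nonempty open set inside the closure contains a point of the set itself. Its
    sphere map \<open>f\<close> supplies both the directions of perturbation and finite
    determination.\<close>
  have "w \<in> ?M closure_of ?S" using w W(2) by blast
  from this[unfolded in_closure_of, THEN conjunct2, rule_format, OF conjI[OF w W(1)]]
  obtain w1 where w1: "w1 \<in> ?S" "w1 \<in> W" by (elim exE conjE) (rule that)
  obtain \<phi> where \<phi>: "\<phi> \<in> adm" "w1 = cls \<phi>" "induced_by_weighted_sphere A \<beta> (deformed E T \<phi>) T"
    using w1(1) unfolding sphere_induced_def by blast
  note sm = admissible_smooth[OF \<phi>(1)] and T\<phi> = admissible_T[OF \<phi>(1)]
  interpret D: cr A "deformed E T \<phi>" T by (rule cr_deformed[OF sm T\<phi>])
  obtain f where f: "cr_sphere A (deformed E T \<phi>) T f \<beta>" by (rule D.cr_sphere_if_induced[OF \<phi>(3) \<beta>])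
  then interpret S: cr_sphere A "deformed E T \<phi>" T f \<beta> .
  let ?Z = "Z - cscale (\<i> * Z (\<lambda>q. of_real (\<phi> q))) (T p)"
  have Z1: "?Z \<in> deformed E T \<phi> p" using Z(1) unfolding deformed_eq by blast
  obtain k q1 q2 where kq: "S.x k q1 \<noteq> S.x k q2"
    by (rule S.nonconstant_x[OF Z1 deformed_vector_nonzero[OF Z]])
  \<comment> \<open>By connectedness the nonconstant function \<open>x k\<close> takes all values of
    an interval, so there are as many interpolation nodes as required.\<close>
  have "connected (range (S.x k))"
    by (rule connected_continuous_image[OF smooth_map_continuous[OF S.x_smooth] X(2)])
  then have "{min (S.x k q1) (S.x k q2)..max (S.x k q1) (S.x k q2)} \<subseteq> range (S.x k)"
    by (rule connected_contains_Icc) (auto simp: min_def max_def)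
  moreover have "infinite {min (S.x k q1) (S.x k q2)..max (S.x k q1) (S.x k q2)}"
    using kq by (intro infinite_Icc) auto
  ultimately have inf: "infinite (range (S.x k))" by (rule infinite_super)

  have "\<exists>S0. finite S0 \<and> (\<forall>g q. D.cr_weight (\<beta> $ j) g \<longrightarrow> (\<forall>p\<in>S0. g p = 0) \<longrightarrow> g q = 0)" for j
    by (rule S.cr_weight_determined[OF X(1)])
  then obtain Sj where Sj: "\<And>j. finite (Sj j)"
    "\<And>j g q. D.cr_weight (\<beta> $ j) g \<Longrightarrow> (\<forall>p\<in>Sj j. g p = 0) \<Longrightarrow> g q = 0" by metis
  define S0 where "S0 = (\<Union>j. Sj j)"
  have S0: "finite S0" using Sj(1) by (simp add: S0_def)
  have "\<exists>e. \<forall>g\<in>{g. D.cr_weight (\<beta> $ j) g}. g q = (\<Sum>p\<in>S0. e p * g p)" for j q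
  proof (rule functional_combination[OF S0])
    show "(\<lambda>q. g q - c * h q) \<in> {g. D.cr_weight (\<beta> $ j) g}"
      if "g \<in> {g. D.cr_weight (\<beta> $ j) g}" "h \<in> {g. D.cr_weight (\<beta> $ j) g}" for c g h
      using D.cr_weight_diff that by blast
    show "g q = 0" if "g \<in> {g. D.cr_weight (\<beta> $ j) g}" "\<And>p. p \<in> S0 \<Longrightarrow> g p = 0" for g
      by (rule Sj(2)[of j]) (use that in \<open>auto simp: S0_def\<close>)
  qed
  then obtain e where e: "\<And>j q g. D.cr_weight (\<beta> $ j) g \<Longrightarrow> g q = (\<Sum>p\<in>S0. e j q p * g p)"
    by (simp only: mem_Collect_eq Ball_def) metis

  \<comment> \<open>One unknown for each component and each pair of sample points, because the
    squared modulus of \<open>G j\<close> is quadratic in the values at \<open>S0\<close>. The set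
    \<open>I\<close> below has one node more than there are unknowns, as
    \<open>power_relation\<close> demands.\<close>
  define K where "K = (UNIV :: 'N set) \<times> S0 \<times> S0"
  have K: "finite K" using S0 by (simp add: K_def)
  obtain I where I: "finite I" "card I = Suc (card K)" "I \<subseteq> range (S.x k)"
    using infinite_arbitrarily_large[OF inf] by blast
  define pt where "pt v = (SOME q. S.x k q = v)" for v
  have pt: "S.x k (pt v) = v" if "v \<in> I" for v
    unfolding pt_def by (rule someI_ex) (use that I(3) in auto)
  define coef where "coef v \<kappa> = e (fst \<kappa>) (pt v) (fst (snd \<kappa>)) * cnj (e (fst \<kappa>) (pt v) (snd (snd \<kappa>)))" for v \<kappa>
  define bk where "bk \<kappa> = 2 * \<beta> $ fst \<kappa>" for \<kappa> :: "'N \<times> 'a \<times> 'a"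

  \<comment> \<open>Exponents bounded by \<open>card K\<close> leave finitely many patterns, so one
    \<open>\<tau>\<close> keeps all the perturbed functions in \<open>W\<close>. The pattern is
    selected only afterwards, as it depends on \<open>\<tau>\<close> through
    \<open>y\<close>.\<close>
  let ?F = "I \<rightarrow>\<^sub>E {..card K}"
  have "\<exists>L. \<forall>v\<in>I. poly L v = real (m v)" for m :: "real \<Rightarrow> nat"
    by (rule interpolation_polynomial[OF I(1), of "\<lambda>v. real (m v)"]) blast
  then obtain L where L: "\<And>(m :: real \<Rightarrow> nat) v. v \<in> I \<Longrightarrow> poly (L m) v = real (m v)" by metis
  have "eventually (\<lambda>s. \<forall>m\<in>?F. (\<lambda>q. \<phi> q + s * poly (L m) ((cmod (f k q))\<^sup>2)) \<in> {\<psi> \<in> adm. cls \<psi> \<in> W}) (at_right 0)"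
    by (rule eventually_ball_finite)
      (use I(1) w1(2) \<phi>(2) in \<open>auto intro!: finite_PiE admissible_perturbation[OF \<phi>(1) f W(1), simplified]\<close>)
  moreover have "eventually (\<lambda>s::real. s > 0) (at_right 0)" by (simp add: eventually_at_filter)
  ultimately have "eventually (\<lambda>s. s > 0 \<and> (\<forall>m\<in>?F. (\<lambda>q. \<phi> q + s * poly (L m) ((cmod (f k q))\<^sup>2)) \<in> {\<psi> \<in> adm. cls \<psi> \<in> W})) (at_right 0)"
    by eventually_elim blast
  then obtain \<tau> where \<tau>: "\<tau> > 0"
    "\<And>m. m \<in> ?F \<Longrightarrow> (\<lambda>q. \<phi> q + \<tau> * poly (L m) ((cmod (f k q))\<^sup>2)) \<in> {\<psi> \<in> adm. cls \<psi> \<in> W}"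
    using eventually_happens'[OF trivial_limit_at_right_real] by blast

  define y where "y \<kappa> = complex_of_real (exp (bk \<kappa> * \<tau>))" for \<kappa>
  have y1: "y \<kappa> \<noteq> 1" for \<kappa>
  proof -
    have "bk \<kappa> * \<tau> > 0" using \<beta> \<tau>(1) by (simp add: bk_def)
    then have "exp (bk \<kappa> * \<tau>) \<noteq> 1" by auto
    then show ?thesis unfolding y_def of_real_eq_1_iff .
  qed
  obtain m c where mc: "\<And>i. m i \<le> card K" "(\<Sum>v\<in>I. c v) = 1"
    "\<And>\<kappa>. \<kappa> \<in> K \<Longrightarrow> (\<Sum>v\<in>I. c v * (coef v \<kappa> * y \<kappa> ^ m v)) = 0"
    by (rule power_relation[OF K I(1), of y coef]) (use I(2) y1 in auto)
  define m' where "m' = restrict m I"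
  have m': "m' \<in> ?F" using mc(1) by (auto simp: m'_def)
  define \<phi>1 where "\<phi>1 q = \<phi> q + \<tau> * poly (L m') ((cmod (f k q))\<^sup>2)" for q
  have \<phi>1: "\<phi>1 \<in> adm" "cls \<phi>1 \<in> W" using \<tau>(2)[OF m'] unfolding \<phi>1_def[abs_def] by auto
  \<comment> \<open>Since \<open>L m'\<close> interpolates the exponents, the exponential with rate
    \<open>bk \<kappa>\<close> of this difference is the power \<open>y \<kappa> ^ m v\<close> of
    the relation.\<close>
  have \<phi>1_pt: "\<phi>1 (pt v) - \<phi> (pt v) = \<tau> * m v" if "v \<in> I" for v
    using L[OF that, of m'] pt[OF that] that by (simp add: \<phi>1_def S.x_def[symmetric] m'_def)
  \<comment> \<open>Closeness at the nodes gives the limits of the exponentials, closeness at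
    \<open>S0\<close> a uniform bound for the unknowns.\<close>
  define P where "P = pt ` I \<union> S0"
  have P: "finite P" using I(1) S0 by (simp add: P_def)
  have "\<exists>\<psi> g. smooth_map A \<psi> \<and> (\<forall>p. T p (\<lambda>q. of_real (\<psi> q)) = 0) \<and>
    cr_sphere A (deformed E T \<psi>) T g \<beta> \<and> (\<forall>p\<in>P. \<bar>\<psi> p - \<phi>1 p\<bar> < inverse (real (Suc n)))" for n
    by (rule sphere_approximation[OF \<beta> W \<phi>1 P]) simp
  then obtain \<psi> g where \<psi>: "\<And>n. smooth_map A (\<psi> n)" "\<And>n p. T p (\<lambda>q. of_real (\<psi> n q)) = 0"
    "\<And>n. cr_sphere A (deformed E T (\<psi> n)) T (g n) \<beta>" "\<And>n p. p \<in> P \<Longrightarrow> \<bar>\<psi> n p - \<phi>1 p\<bar> < inverse (real (Suc n))"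
    by metis

  define u where "u n q = \<psi> n q - \<phi> q" for n q
  have u_smooth: "smooth_map A (u n)" for n unfolding u_def[abs_def] by (rule smooth_map_diff[OF \<psi>(1) sm])
  have Tu: "T p (\<lambda>q. of_real (u n q)) = 0" for n p
    using ctangent_diff[OF T_ctangent smooth_map_of_real[OF \<psi>(1)] smooth_map_of_real[OF sm]] \<psi>(2) T\<phi>
    by (simp add: u_def)
  have def: "deformed (deformed E T \<phi>) T (u n) = deformed E T (\<psi> n)" for n
    using deformed_deformed[OF Tu sm u_smooth, of n] by (simp add: u_def)
  define G where "G n j q = of_real (exp (- \<beta> $ j * u n q)) * g n j q" for n j q
  have G: "D.cr_weight (\<beta> $ j) (G n j)" for n j
    unfolding G_def
    by (rule D.cr_weight_transfer[OF u_smooth Tu]) (unfold def, rule cr_sphere.weight[OF \<psi>(3)])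
  have G_norm: "cmod (G n j q) \<le> exp (- \<beta> $ j * u n q)" for n j q
    using cr_sphere.f_le_1[OF \<psi>(3), of n j q] by (simp add: G_def norm_mult mult_left_le)
  define Mt where "Mt n \<kappa> = G n (fst \<kappa>) (fst (snd \<kappa>)) * cnj (G n (fst \<kappa>) (snd (snd \<kappa>)))" for n \<kappa>
  \<comment> \<open>The sphere equation of the approximating map at \<open>pt v\<close>, rewritten
    for the fixed structure. The unknown \<open>Mt n \<kappa>\<close> does not depend on
    \<open>v\<close>, and the other factor converges to a known value.\<close>
  have one: "1 = (\<Sum>\<kappa>\<in>K. Mt n \<kappa> * (coef v \<kappa> * of_real (exp (bk \<kappa> * u n (pt v)))))" for n v
  proof -
    let ?q = "pt v"
    have "of_real (exp (2 * \<beta> $ j * u n ?q)) * (G n j ?q * cnj (G n j ?q)) = complex_of_real ((cmod (g n j ?q))\<^sup>2)" for j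
    proof -
      have "exp (2 * \<beta> $ j * u n ?q) * (exp (- \<beta> $ j * u n ?q) * exp (- \<beta> $ j * u n ?q)) = 1"
        by (simp add: exp_add[symmetric])
      then have "complex_of_real (exp (2 * \<beta> $ j * u n ?q)) * (of_real (exp (- \<beta> $ j * u n ?q)) * of_real (exp (- \<beta> $ j * u n ?q))) = 1"
        by (metis of_real_mult of_real_1)
      then show ?thesis unfolding G_def complex_norm_square by (simp add: algebra_simps)
    qed
    then have "(\<Sum>j\<in>UNIV. of_real (exp (2 * \<beta> $ j * u n ?q)) * (G n j ?q * cnj (G n j ?q))) =
        complex_of_real (\<Sum>j\<in>UNIV. (cmod (g n j ?q))\<^sup>2)" by simp
    also have "\<dots> = 1" unfolding cr_sphere.unit[OF \<psi>(3)] by simp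
    finally have "1 = (\<Sum>j\<in>UNIV. of_real (exp (2 * \<beta> $ j * u n ?q)) * (G n j ?q * cnj (G n j ?q)))" by simp
    also have "\<dots> = (\<Sum>j\<in>UNIV. \<Sum>a\<in>S0. \<Sum>a'\<in>S0. Mt n (j, a, a') * (coef v (j, a, a') * of_real (exp (bk (j, a, a') * u n ?q))))"
    proof (rule sum.cong[OF refl])
      fix j
      have "G n j ?q * cnj (G n j ?q) = (\<Sum>a\<in>S0. e j ?q a * G n j a) * (\<Sum>a'\<in>S0. cnj (e j ?q a' * G n j a'))"
        by (subst (1 2) e[OF G]) (simp only: cnj_sum)
      also have "\<dots> = (\<Sum>a\<in>S0. \<Sum>a'\<in>S0. (e j ?q a * G n j a) * cnj (e j ?q a' * G n j a'))"
        by (rule sum_product)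
      finally show "of_real (exp (2 * \<beta> $ j * u n ?q)) * (G n j ?q * cnj (G n j ?q)) =
        (\<Sum>a\<in>S0. \<Sum>a'\<in>S0. Mt n (j, a, a') * (coef v (j, a, a') * of_real (exp (bk (j, a, a') * u n ?q))))"
        by (simp add: sum_distrib_left Mt_def coef_def bk_def mult_ac)
    qed
    also have "\<dots> = (\<Sum>\<kappa>\<in>K. Mt n \<kappa> * (coef v \<kappa> * of_real (exp (bk \<kappa> * u n ?q))))"
      by (simp add: K_def sum.cartesian_product case_prod_beta)
    finally show ?thesis .
  qed
  \<comment> \<open>Weighting the equations with \<open>c\<close> and summing over the nodes gives
    the unknown \<open>Mt n \<kappa>\<close> this coefficient. It tends to the left side of the
    relation, which is 0, while the ones on the other side of the equations add up to the sum of all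
    \<open>c v\<close>, which is 1.\<close>
  define \<Theta> where "\<Theta> n \<kappa> = (\<Sum>v\<in>I. c v * (coef v \<kappa> * of_real (exp (bk \<kappa> * u n (pt v)))))" for n \<kappa>
  have lim_u: "(\<lambda>n. u n q) \<longlonglongrightarrow> \<phi>1 q - \<phi> q" if q: "q \<in> P" for q
  proof -
    have "(\<lambda>n. \<psi> n q - \<phi>1 q) \<longlonglongrightarrow> 0"
      by (rule Lim_null_comparison[OF _ LIMSEQ_inverse_real_of_nat])
        (use \<psi>(4)[OF q] in \<open>auto intro!: always_eventually less_imp_le\<close>)
    from tendsto_add[OF this tendsto_const[of "\<phi>1 q - \<phi> q"]] show ?thesis by (simp add: u_def)
  qed
  have \<Theta>: "(\<lambda>n. \<Theta> n \<kappa>) \<longlonglongrightarrow> 0" if \<kappa>: "\<kappa> \<in> K" for \<kappa>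
  proof -
    have "(\<lambda>n. \<Theta> n \<kappa>) \<longlonglongrightarrow> (\<Sum>v\<in>I. c v * (coef v \<kappa> * of_real (exp (bk \<kappa> * (\<phi>1 (pt v) - \<phi> (pt v))))))"
      unfolding \<Theta>_def by (intro tendsto_intros lim_u) (auto simp: P_def)
    also have "(\<Sum>v\<in>I. c v * (coef v \<kappa> * of_real (exp (bk \<kappa> * (\<phi>1 (pt v) - \<phi> (pt v)))))) =
        (\<Sum>v\<in>I. c v * (coef v \<kappa> * y \<kappa> ^ m v))"
    proof (rule sum.cong[OF refl])
      fix v assume "v \<in> I"
      have "exp (bk \<kappa> * (\<tau> * real (m v))) = exp (bk \<kappa> * \<tau>) ^ m v"
        by (simp add: exp_of_nat_mult[symmetric] mult_ac)
      then show "c v * (coef v \<kappa> * of_real (exp (bk \<kappa> * (\<phi>1 (pt v) - \<phi> (pt v))))) = c v * (coef v \<kappa> * y \<kappa> ^ m v)"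
        unfolding \<phi>1_pt[OF \<open>v \<in> I\<close>] y_def by simp
    qed
    finally show ?thesis unfolding mc(3)[OF \<kappa>] .
  qed
  \<comment> \<open>Components of a sphere map are at most 1 in modulus, so \<open>G n j\<close> is
    bounded by an exponential of \<open>- u n\<close>, and \<open>u n\<close> stays bounded at the
    sample points.\<close>
  have bounded: "\<exists>R. \<forall>n. cmod (Mt n \<kappa>) \<le> R" if \<kappa>: "\<kappa> \<in> K" for \<kappa>
  proof -
    have b: "cmod (G n j a) \<le> exp (\<beta> $ j * (\<bar>\<phi>1 a - \<phi> a\<bar> + 1))" if a: "a \<in> S0" for n j a
    proof -
      have "\<bar>\<psi> n a - \<phi>1 a\<bar> < inverse (real (Suc n))" using \<psi>(4)[of a n] a by (simp add: P_def)
      also have "\<dots> \<le> 1" by (simp add: field_simps)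
      finally have "- u n a \<le> \<bar>\<phi>1 a - \<phi> a\<bar> + 1" by (simp add: u_def)
      then have "\<beta> $ j * (- u n a) \<le> \<beta> $ j * (\<bar>\<phi>1 a - \<phi> a\<bar> + 1)"
        using \<beta>[of j] by (intro mult_left_mono) auto
      then show ?thesis using G_norm[of n j a] by (simp add: order_trans)
    qed
    obtain j a a' where eq: "\<kappa> = (j, a, a')" by (cases \<kappa>)
    then have "a \<in> S0" "a' \<in> S0" using \<kappa> by (auto simp: K_def)
    then have "cmod (Mt n \<kappa>) \<le> exp (\<beta> $ j * (\<bar>\<phi>1 a - \<phi> a\<bar> + 1)) * exp (\<beta> $ j * (\<bar>\<phi>1 a' - \<phi> a'\<bar> + 1))" for n
      unfolding Mt_def eq fst_conv snd_conv norm_mult complex_mod_cnj by (intro mult_mono b) auto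
    then show ?thesis by blast
  qed
  have "(\<lambda>n. \<Sum>\<kappa>\<in>K. Mt n \<kappa> * \<Theta> n \<kappa>) \<longlonglongrightarrow> (\<Sum>\<kappa>\<in>K. 0)"
  proof (rule tendsto_sum)
    fix \<kappa> assume \<kappa>: "\<kappa> \<in> K"
    obtain R where R: "\<And>n. cmod (Mt n \<kappa>) \<le> R" using bounded[OF \<kappa>] by blast
    have "cmod (Mt n \<kappa> * \<Theta> n \<kappa>) \<le> R * cmod (\<Theta> n \<kappa>)" for n
      unfolding norm_mult by (rule mult_right_mono[OF R norm_ge_zero])
    then have "eventually (\<lambda>n. cmod (Mt n \<kappa> * \<Theta> n \<kappa>) \<le> R * cmod (\<Theta> n \<kappa>)) sequentially" by simp
    moreover have "(\<lambda>n. R * cmod (\<Theta> n \<kappa>)) \<longlonglongrightarrow> 0"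
      by (intro tendsto_mult_right_zero tendsto_norm_zero \<Theta>[OF \<kappa>])
    ultimately show "(\<lambda>n. Mt n \<kappa> * \<Theta> n \<kappa>) \<longlonglongrightarrow> 0" by (rule Lim_null_comparison)
  qed
  moreover have "(\<Sum>\<kappa>\<in>K. Mt n \<kappa> * \<Theta> n \<kappa>) = 1" for n
  proof -
    have "(\<Sum>\<kappa>\<in>K. Mt n \<kappa> * \<Theta> n \<kappa>) = (\<Sum>v\<in>I. c v * (\<Sum>\<kappa>\<in>K. Mt n \<kappa> * (coef v \<kappa> * of_real (exp (bk \<kappa> * u n (pt v))))))"
      unfolding \<Theta>_def sum_distrib_left by (subst sum.swap) (simp only: mult.left_commute)
    also have "\<dots> = (\<Sum>v\<in>I. c v)" unfolding one[symmetric] by simp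
    finally show ?thesis using mc(2) by simp
  qed
  ultimately have "(\<lambda>n. 1 :: complex) \<longlonglongrightarrow> 0" by simp
  then show False using LIMSEQ_unique[OF tendsto_const] by fastforce
qed

end

theorem theorem1p19:
  fixes n :: nat
    and A :: "('a::{t2_space,second_countable_topology}, real ^ 'm) chart set"
    and T10 :: "'a \<Rightarrow> 'a cvec set"
    and T :: "'a \<Rightarrow> 'a cvec"
    and \<beta> :: "real ^ 'N"
  assumes "n \<ge> 1" and "CARD('m) = 2 * n + 1"
    and "smooth_atlas A" and "orientable_atlas A"
    and "connected (UNIV :: 'a set)" and "compact (UNIV :: 'a set)"
    and "sasakian A n T10 T"
    and "\<forall>j. \<beta> $ j > 0"
  defines "M \<equiv> moduli_space A T10 T" and "S \<equiv> sphere_induced A T10 T \<beta>"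
  shows "M interior_of (M closure_of S) = {} \<and>
    (S \<noteq> {} \<longrightarrow> (\<forall>s\<in>S. s \<in> M derived_set_of S)) \<and>
    (\<forall>s\<in>S. \<exists>\<epsilon>>0. \<exists>\<gamma> :: real \<Rightarrow> ('a \<Rightarrow> real) set.
       continuous_map (top_of_set {0..<\<epsilon>}) M \<gamma> \<and> \<not> \<gamma> constant_on {0..<\<epsilon>} \<and>
       \<gamma> 0 = s \<and> \<gamma> ` {0..<\<epsilon>} \<subseteq> S)"
proof -
  interpret manifold A by unfold_locales (rule assms(3))
  interpret cr A T10 T by (rule sasakian_cr[OF assms(7)])
  have \<beta>: "\<beta> $ j > 0" for j using assms(8) by blast
  have "cvs.dim (T10 p) = n" for p
    using assms(7) by (simp add: sasakian_def CR_structure_def complex_subbundle_def)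
  moreover have "cvs.dim {0 :: 'a cvec} = 0"
    using cvs.dim_eq_card[of "{}" "{0}"] by (simp add: cvs.independent_empty cvs.span_insert_0)
  \<comment> \<open>Here \<open>n \<ge> 1\<close> enters: it provides the nonzero vector of type
    (1,0) from which the nonconstant functions \<open>x k\<close> are obtained.\<close>
  ultimately have "T10 undefined \<noteq> {0}" using assms(1) by (metis not_one_le_zero)
  then obtain Z where Z: "Z \<in> T10 undefined" "Z \<noteq> 0" using cvs.subspace_0[OF E_subspace] by blast
  have path: "\<exists>(\<epsilon> :: real) \<gamma>. \<epsilon> > 0 \<and> continuous_map (top_of_set {0..<\<epsilon>}) M \<gamma> \<and> \<gamma> 0 = s \<and>
    (\<forall>t\<in>{0..<\<epsilon>}. \<gamma> t \<in> S) \<and> (\<forall>t. 0 < t \<and> t < \<epsilon> \<longrightarrow> \<gamma> t \<noteq> s)" if s: "s \<in> S" for s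
  proof (rule sphere_path[OF assms(6) \<beta> Z s[unfolded S_def]])
    fix \<epsilon> :: real and \<gamma>
    assume \<gamma>: "\<epsilon> > 0" "continuous_map (top_of_set {0..<\<epsilon>}) (moduli_space A T10 T) \<gamma>" "\<gamma> 0 = s"
      "\<And>t. t \<in> {0..<\<epsilon>} \<Longrightarrow> \<gamma> t \<in> sphere_induced A T10 T \<beta>" "\<And>t. 0 < t \<Longrightarrow> t < \<epsilon> \<Longrightarrow> \<gamma> t \<noteq> s"
    show ?thesis
      unfolding M_def S_def by (intro exI[of _ \<epsilon>] exI[of _ \<gamma>] conjI ballI allI impI \<gamma>) simp_all
  qed
  have "M interior_of (M closure_of S) = {}"
    unfolding M_def S_def by (rule sphere_induced_nowhere_dense[OF assms(6,5) \<beta> Z])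
  moreover have "s \<in> M derived_set_of S" if s: "s \<in> S" for s
  proof -
    obtain \<epsilon> :: real and \<gamma> where \<gamma>: "\<epsilon> > 0" "continuous_map (top_of_set {0..<\<epsilon>}) M \<gamma>" "\<gamma> 0 = s"
      "\<forall>t\<in>{0..<\<epsilon>}. \<gamma> t \<in> S" "\<forall>t. 0 < t \<and> t < \<epsilon> \<longrightarrow> \<gamma> t \<noteq> s"
      using path[OF s] by blast
    have "\<exists>t. t \<noteq> s \<and> t \<in> S \<and> t \<in> V" if V: "s \<in> V" "openin M V" for V
    proof -
      have "openin (top_of_set {0..<\<epsilon>}) {t \<in> {0..<\<epsilon>}. \<gamma> t \<in> V}"
        using openin_continuous_map_preimage[OF \<gamma>(2) V(2)] by simp
      moreover have "0 \<in> {t \<in> {0..<\<epsilon>}. \<gamma> t \<in> V}" using \<gamma>(1,3) V(1) by simp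
      ultimately obtain r where r: "r > 0" "\<And>t. t \<in> {0..<\<epsilon>} \<Longrightarrow> dist t 0 < r \<Longrightarrow> t \<in> {t \<in> {0..<\<epsilon>}. \<gamma> t \<in> V}"
        unfolding openin_euclidean_subtopology_iff by blast
      let ?t = "min r \<epsilon> / 2"
      have "0 < ?t" "?t < \<epsilon>" "?t < r" using r(1) \<gamma>(1) by auto
      then show ?thesis using \<gamma>(4,5) r(2)[of ?t] by (intro exI[of _ "\<gamma> ?t"]) auto
    qed
    moreover have "s \<in> topspace M"
      using continuous_map_image_subset_topspace[OF \<gamma>(2)] \<gamma>(1,3) by force
    ultimately show ?thesis unfolding in_derived_set_of by blast
  qed
  moreover have "\<exists>\<epsilon>>0. \<exists>\<gamma> :: real \<Rightarrow> ('a \<Rightarrow> real) set. continuous_map (top_of_set {0..<\<epsilon>}) M \<gamma> \<and>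
      \<not> \<gamma> constant_on {0..<\<epsilon>} \<and> \<gamma> 0 = s \<and> \<gamma> ` {0..<\<epsilon>} \<subseteq> S" if s: "s \<in> S" for s
  proof -
    obtain \<epsilon> :: real and \<gamma> where \<gamma>: "\<epsilon> > 0" "continuous_map (top_of_set {0..<\<epsilon>}) M \<gamma>" "\<gamma> 0 = s"
      "\<forall>t\<in>{0..<\<epsilon>}. \<gamma> t \<in> S" "\<forall>t. 0 < t \<and> t < \<epsilon> \<longrightarrow> \<gamma> t \<noteq> s"
      using path[OF s] by blast
    have "\<gamma> (\<epsilon> / 2) \<noteq> \<gamma> 0" using \<gamma>(1,3,5) by simp
    moreover have "\<epsilon> / 2 \<in> {0..<\<epsilon>}" "0 \<in> {0..<\<epsilon>}" using \<gamma>(1) by auto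
    ultimately have "\<not> \<gamma> constant_on {0..<\<epsilon>}" unfolding constant_on_def by metis
    then show ?thesis using \<gamma> by blast
  qed
  ultimately show ?thesis by blast
qed

end
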